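(* (i) $\mathbb F=\mathbb M_\lambda(\mathtt{ata^+})$. (ii) $\mathbb F\vee\overline{\mathbb E}=\mathbb M_\lambda(\mathtt{ata^+},\mathtt{a^+t})=\mathbb M_\lambda(\mathtt{a^+ta^+})$. (iii) $\mathbb H=\mathbb M_\lambda(\mathtt{abta^+sb^+})$. (iv) The variety $\mathbb I$ is generated by the 19-element monoid $M_\lambda(\mathtt{ba^+sb^+})$. (v) The variety $\mathbb J$ is generated by the 31-element monoid $M_\lambda(\mathtt{atba^+sb^+})$.
   Context: Monoids are regarded as semigroups with an additional nullary operation fixing the identity element; varieties are varieties of monoids, $\operatorname{var}\Sigma$ is the monoid variety defined by the set of identities $\Sigma$, $\vee$ is the join, and $\overline{\mathbb V}$ denotes the variety dual to $\mathbb V$, i.e. consisting of all monoids anti-isomorphic to monoids of $\mathbb V$. Define $\mathbb E=\operatorname{var}\{x^2\approx x^3,\ xyx\approx x^2y,\ x^2y^2\approx y^2x^2\}$ (this is also the variety generated by $E^1$, where $E^1$ is obtained by adjoining an identity element to the semigroup with zero $E=\langle e,c\mid e^2=e,\ c^2=ec=0,\ ce=c\rangle$); $\mathbb F=\operatorname{var}\{x^2y^2\approx y^2x^2,\ xytxy\approx yxtxy,\ xtxs\approx xtxsx\}$; $\mathbb H=\operatorname{var}\{xtx\approx xtx^2,\ x^2y^2\approx y^2x^2,\ xytxy\approx yxtxy,\ xt_1xt_2t_3x\approx xt_1xt_2xt_3x,\ x^2yty\approx xyxty\approx yx^2ty\}$; $\mathbb I=\operatorname{var}\{xtx\approx xtx^2,\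 x^2y^2\approx y^2x^2,\ xytxy\approx yxtxy,\ xt_1xt_2t_3x\approx xt_1xt_2xt_3x,\ xtxysy\approx xtyxsy\}$; $\mathbb J=\operatorname{var}\{xtx\approx xtx^2,\ x^2y^2\approx y^2x^2,\ xytxy\approx yxtxy,\ xt_1xt_2t_3x\approx xt_1xt_2xt_3x,\ \mathbf w_n(\pi)\approx\mathbf w_n'(\pi)\mid n\ge0,\ \pi\in S_n\}$, where $S_n$ is the full symmetric group on $\{1,\dots,n\}$, $\mathbf w_n(\pi)=x\,y_{1\pi}y_{2\pi}\cdots y_{n\pi}\,x\,t_1y_1t_2y_2\cdots t_ny_n$ and $\mathbf w_n'(\pi)=x^2\,y_{1\pi}y_{2\pi}\cdots y_{n\pi}\,t_1y_1t_2y_2\cdots t_ny_n$. Let $\mathfrak A$ be a countably infinite alphabet, $\mathfrak A^*$ the free monoid over it; $a,b,t,s$ are distinct letters. A letter is multiple in a word if it occurs in it at least twice; $\operatorname{mul}(\mathbf u)$ is the set of multiple letters of $\mathbf u$. Let $\tau_1$ be the congruence on $\mathfrak A^*$ generated by the relations $a=a^2$, $a\in\mathfrak A$. Put $\mathbf u\,\gamma\,\mathbf v$ iff $\mathbf u\,\tau_1\,\mathbf v$ and $\operatorname{mul}(\mathbf u)=\operatorname{mul}(\mathbf v)$; put $\mathbf u\,\lambda\,\mathbf v$ iff $\mathbf u\,\gamma\,\mathbf v$ and, for each multiple letter, its first two occurrences are adjacent in $\mathbf u$ iff its first two occurrences are adjacent in $\mathbf v$. Then $\lambda$ is a congruence.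 In $\mathfrak A^*/\lambda$ write $\mathtt a=\{a\}$ and $\mathtt a^+=\{a^n\mid n\ge2\}$ for each letter $a$; juxtaposition of such symbols denotes the product in $\mathfrak A^*/\lambda$. Thus $\mathtt{ata^+}=\{ata^n\mid n\ge1\}$, $\mathtt{a^+t}=\{a^nt\mid n\ge2\}$, $\mathtt{a^+ta^+}=\{a^mta^n\mid m\ge2,\ n\ge1\}$, $\mathtt{abta^+sb^+}=\{abta^msb^n\mid m,n\ge1\}$, $\mathtt{ba^+sb^+}=\{ba^msb^n\mid m\ge2,\ n\ge1\}$, $\mathtt{atba^+sb^+}=\{atba^msb^n\mid m,n\ge1\}$. For a congruence $\tau$ on $\mathfrak A^*$ and $\tau$-classes $\mathtt u,\mathtt v$, write $\mathtt v\le_\tau\mathtt u$ if $\mathtt u=\mathtt p\,\mathtt v\,\mathtt s$ in $\mathfrak A^*/\tau$ for some $\mathtt p,\mathtt s\in\mathfrak A^*/\tau$. For a set $\mathtt W\subseteq\mathfrak A^*/\tau$ let $\mathtt W^{\le_\tau}=\{\mathtt v\mid \mathtt v\le_\tau\mathtt u \text{ for some }\mathtt u\in\mathtt W\}$, and let $M_\tau(\mathtt W)$ be the Rees quotient of $\mathfrak A^*/\tau$ over the ideal $(\mathfrak A^*/\tau)\setminus\mathtt W^{\le_\tau}$, i.e. the monoid $\mathtt W^{\le_\tau}\cup\{0\}$ in which the product of $\mathtt u,\mathtt v\in \mathtt W^{\le_\tau}$ is their product in $\mathfrak A^*/\tau$ if that lies in $\mathtt W^{\le_\tau}$, and all other products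 are $0$. $M_\tau(\mathtt w_1,\dots,\mathtt w_k)$ stands for $M_\tau(\{\mathtt w_1,\dots,\mathtt w_k\})$ and $\mathbb M_\tau(\mathtt w_1,\dots,\mathtt w_k)$ is the monoid variety it generates.
   Formalization: In (v) the number of elements of the monoid M_λ(atba⁺sb⁺) is corrected from 31 to 34: under the given definitions there are 33 λ-classes below atba⁺sb⁺, plus 0. *)

theory Defs
  imports
    "HOL-Algebra.Product_Groups"
    "HOL-Combinatorics.Permutations"
begin

section \<open>Words and identities\<close>

datatype letter = Lx | Ly nat | Lt nat | Ls

text \<open>A countably infinite alphabet.  The letters \<open>y\<close> and \<open>t\<close> are \<open>Ly 0\<close> and \<open>Lt 0\<close>, while
  \<open>y\<^sub>i\<close> and \<open>t\<^sub>i\<close> (with \<open>i \<ge> 1\<close>) are \<open>Ly i\<close> and \<open>Lt i\<close>.  The free monoid is the set of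
  all words under concatenation, and a pair of words is an identity.\<close>

type_synonym word = "letter list"

definition mprod :: "('m, 'b) monoid_scheme \<Rightarrow> 'm list \<Rightarrow> 'm" where
  "mprod G xs = foldr (\<lambda>x y. x \<otimes>\<^bsub>G\<^esub> y) xs \<one>\<^bsub>G\<^esub>"

definition satisfies :: "('m, 'b) monoid_scheme \<Rightarrow> word \<times> word \<Rightarrow> bool" where
  "satisfies M e \<longleftrightarrow>
     (\<forall>\<phi>. (\<forall>x. \<phi> x \<in> carrier M) \<longrightarrow> mprod M (map \<phi> (fst e)) = mprod M (map \<phi> (snd e)))"


section \<open>Varieties of monoids\<close>

text \<open>A class of monoids is represented by the set of its members whose carrier is a subset of a
  type \<open>'m\<close>.\<close>

definition var :: "(word \<times> word) set \<Rightarrow> 'm monoid set" where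
  "var \<Sigma> = {M. monoid M \<and> (\<forall>e\<in>\<Sigma>. satisfies M e)}"

text \<open>The variety generated by a class \<open>K\<close>: all homomorphic images of submonoids of direct products
  of (families of) members of \<open>K\<close>.  \<open>product_group\<close> is the direct product of a family of
  monoids, and a multiplicative surjection between monoids preserves the identity element.
  The index sets are taken from the pairs of words over \<open>'m\<close>; this loses no generality, since for
  a homomorphic image on \<open>'m\<close> it suffices to have one factor for every pair of words
  over \<open>'m\<close> that is not an identity of \<open>K\<close>.\<close>

definition generated_variety :: "'k monoid set \<Rightarrow> 'm monoid set" where
  "generated_variety K =
     {M. monoid M \<and>
         (\<exists>(I :: ('m list \<times> 'm list) set) A N h.
            (\<forall>i\<in>I. A i \<in> K) \<and>
            submonoid N (product_group I A) \<and>
            h \<in> hom ((product_group I A)\<lparr>carrier := N\<rparr>) M \<and>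
            h ` N = carrier M)}"

definition variety_join :: "'m monoid set \<Rightarrow> 'm monoid set \<Rightarrow> 'm monoid set" where
  "variety_join V W = generated_variety (V \<union> W)"

definition opposite :: "'m monoid \<Rightarrow> 'm monoid" where
  "opposite M = \<lparr>carrier = carrier M, monoid.mult = (\<lambda>x y. y \<otimes>\<^bsub>M\<^esub> x), one = \<one>\<^bsub>M\<^esub>\<rparr>"

definition dual_variety :: "'m monoid set \<Rightarrow> 'm monoid set" where
  "dual_variety V = {M. monoid M \<and> (\<exists>N\<in>V. M \<cong> opposite N)}"


section \<open>The varieties of the theorem\<close>

definition var_E :: "'m monoid set" where
  "var_E = var {
     ([Lx, Lx], [Lx, Lx, Lx]),
     ([Lx, Ly 0, Lx], [Lx, Lx, Ly 0]),
     ([Lx, Lx, Ly 0, Ly 0], [Ly 0, Ly 0, Lx, Lx])}"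

definition var_F :: "'m monoid set" where
  "var_F = var {
     ([Lx, Lx, Ly 0, Ly 0], [Ly 0, Ly 0, Lx, Lx]),
     ([Lx, Ly 0, Lt 0, Lx, Ly 0], [Ly 0, Lx, Lt 0, Lx, Ly 0]),
     ([Lx, Lt 0, Lx, Ls], [Lx, Lt 0, Lx, Ls, Lx])}"

definition common_identities :: "(word \<times> word) set" where
  "common_identities = {
     ([Lx, Lt 0, Lx], [Lx, Lt 0, Lx, Lx]),
     ([Lx, Lx, Ly 0, Ly 0], [Ly 0, Ly 0, Lx, Lx]),
     ([Lx, Ly 0, Lt 0, Lx, Ly 0], [Ly 0, Lx, Lt 0, Lx, Ly 0]),
     ([Lx, Lt 1, Lx, Lt 2, Lt 3, Lx], [Lx, Lt 1, Lx, Lt 2, Lx, Lt 3, Lx])}"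

definition var_H :: "'m monoid set" where
  "var_H = var (common_identities \<union> {
     ([Lx, Lx, Ly 0, Lt 0, Ly 0], [Lx, Ly 0, Lx, Lt 0, Ly 0]),
     ([Lx, Ly 0, Lx, Lt 0, Ly 0], [Ly 0, Lx, Lx, Lt 0, Ly 0])})"

definition var_I :: "'m monoid set" where
  "var_I = var (common_identities \<union> {
     ([Lx, Lt 0, Lx, Ly 0, Ls, Ly 0], [Lx, Lt 0, Ly 0, Lx, Ls, Ly 0])})"

definition w_word :: "nat \<Rightarrow> (nat \<Rightarrow> nat) \<Rightarrow> word" where
  "w_word n \<pi> = [Lx] @ map (\<lambda>i. Ly (\<pi> i)) [1..<n + 1] @ [Lx] @
     concat (map (\<lambda>i. [Lt i, Ly i]) [1..<n + 1])"

definition w'_word :: "nat \<Rightarrow> (nat \<Rightarrow> nat) \<Rightarrow> word" where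
  "w'_word n \<pi> = [Lx, Lx] @ map (\<lambda>i. Ly (\<pi> i)) [1..<n + 1] @
     concat (map (\<lambda>i. [Lt i, Ly i]) [1..<n + 1])"

definition var_J :: "'m monoid set" where
  "var_J = var (common_identities \<union>
     {(w_word n \<pi>, w'_word n \<pi>) | n \<pi>. \<pi> permutes {1..n}})"


section \<open>The congruence \<open>\<lambda>\<close>\<close>

definition mul :: "word \<Rightarrow> letter set" where
  "mul u = {a. count_list u a \<ge> 2}"

inductive tau1 :: "word \<Rightarrow> word \<Rightarrow> bool" where
  tau1_gen: "tau1 [a] [a, a]"
| tau1_refl: "tau1 u u"
| tau1_sym: "tau1 u v \<Longrightarrow> tau1 v u"
| tau1_trans: "tau1 u v \<Longrightarrow> tau1 v w \<Longrightarrow> tau1 u w"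
| tau1_mult: "tau1 u v \<Longrightarrow> tau1 u' v' \<Longrightarrow> tau1 (u @ u') (v @ v')"

definition gamma :: "word \<Rightarrow> word \<Rightarrow> bool" where
  "gamma u v \<longleftrightarrow> tau1 u v \<and> mul u = mul v"

definition first_two_adjacent :: "letter \<Rightarrow> word \<Rightarrow> bool" where
  "first_two_adjacent a u \<longleftrightarrow> (\<exists>p s. u = p @ [a, a] @ s \<and> a \<notin> set p)"

text \<open>Here \<open>mul u = mul v\<close> by \<open>gamma u v\<close>.\<close>

definition lam :: "(word \<times> word) set" where
  "lam = {(u, v). gamma u v \<and>
     (\<forall>a\<in>mul u. first_two_adjacent a u \<longleftrightarrow> first_two_adjacent a v)}"


section \<open>The monoids \<open>M\<^sub>\<tau>(W)\<close>\<close>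

text \<open>The quotient of the free monoid by a congruence \<open>\<tau>\<close>.\<close>

definition quotient_monoid :: "(word \<times> word) set \<Rightarrow> word set monoid" where
  "quotient_monoid \<tau> =
     \<lparr>carrier = UNIV // \<tau>,
      monoid.mult = (\<lambda>A B. \<Union>u\<in>A. \<Union>v\<in>B. \<tau> `` {u @ v}),
      one = \<tau> `` {[]}\<rparr>"

definition class_le :: "(word \<times> word) set \<Rightarrow> word set \<Rightarrow> word set \<Rightarrow> bool" where
  "class_le \<tau> v u \<longleftrightarrow>
     (\<exists>p\<in>carrier (quotient_monoid \<tau>). \<exists>s\<in>carrier (quotient_monoid \<tau>).
        u = p \<otimes>\<^bsub>quotient_monoid \<tau>\<^esub> v \<otimes>\<^bsub>quotient_monoid \<tau>\<^esub> s)"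

definition down_set :: "(word \<times> word) set \<Rightarrow> word set set \<Rightarrow> word set set" where
  "down_set \<tau> W = {v \<in> carrier (quotient_monoid \<tau>). \<exists>u\<in>W. class_le \<tau> v u}"

text \<open>The zero of the Rees quotient is \<open>None\<close>.\<close>

definition M_monoid :: "(word \<times> word) set \<Rightarrow> word set set \<Rightarrow> word set option monoid" where
  "M_monoid \<tau> W =
     \<lparr>carrier = insert None (Some ` down_set \<tau> W),
      monoid.mult = (\<lambda>p q. case (p, q) of
        (Some u, Some v) \<Rightarrow>
          (if u \<otimes>\<^bsub>quotient_monoid \<tau>\<^esub> v \<in> down_set \<tau> W
           then Some (u \<otimes>\<^bsub>quotient_monoid \<tau>\<^esub> v) else None)
      | _ \<Rightarrow> None),
      one = Some \<one>\<^bsub>quotient_monoid \<tau>\<^esub>\<rparr>"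

abbreviation M_lam :: "word set set \<Rightarrow> word set option monoid" where
  "M_lam \<equiv> M_monoid lam"

definition single :: "letter \<Rightarrow> word set" where
  "single a = {[a]}"

definition many :: "letter \<Rightarrow> word set" where
  "many a = {replicate n a | n. n \<ge> 2}"

text \<open>Juxtaposition of the symbols \<open>single a\<close> and \<open>many a\<close>, e.g. \<open>ata\<^sup>+\<close> is
  \<open>juxt [single a, single t, many a]\<close>.\<close>

definition juxt :: "word set list \<Rightarrow> word set" where
  "juxt = mprod (quotient_monoid lam)"

end

theory Submission
  imports Defs "HOL-Library.Countable_Set" "HOL-Library.Sublist"
begin

text \<open>By Birkhoff's theorem it suffices that the identities of \<open>M\<^sub>\<lambda>(w)\<close> are exactly the consequences
  of the defining identities.  An identity holds in \<open>M\<^sub>\<lambda>(W)\<close> iff under every substitution the images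
  of its sides are \<open>\<lambda>\<close>-equivalent as soon as one of them is a factor of a word of \<open>W\<close>, up to \<open>\<lambda>\<close>.

  Completeness: modulo the identities, only the first, second and last occurrence of a multiple letter
  matter, so every multiple letter may be assumed to occur exactly three times.  Then both sides of an
  identity of \<open>M\<^sub>\<lambda>(w)\<close> have the same occurrences of letters, and one side can be sorted into the
  other by transposing adjacent occurrences that are in the opposite order on the other side.  Every such
  transposition either follows from the identities, or else a substitution into \<open>w\<close> detects the order of
  the two occurrences, which is a contradiction.

  Soundness: after collapsing powers, \<open>w\<close> contains no pair of adjacent letters twice, so a letter that
  occurs twice in an identity can only be mapped to a power of a letter.\<close>

section \<open>Identities\<close>

text \<open>The systems for \<open>F\<close>, the dual of \<open>E\<close>, \<open>H\<close>,
  \<open>I\<close> and \<open>J\<close> share the consequences collected in the locale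
  \<open>base\<close>, so sorting is done once; for \<open>H\<close>, \<open>I\<close> and
  \<open>J\<close> only two first occurrences, or a first and a second one, can need more. Three
  occurrences stand for the roles first, second and last; a letter with only two gets its second one
  doubled. The obstacle is xytxy = yxtxy: it applies only if x and y can be made adjacent again
  further right, and this fails only if a simple letter stands between the third occurrence of one
  and the second occurrence of the other. The part a^+sb^+ of the words for \<open>H\<close>,
  \<open>I\<close> and \<open>J\<close> recognises exactly this configuration. No basis of the join
  is computed: it is compared with a^+ta^+ through identities of generating monoids, and there an
  infinite universe is used, which contains copies of the generators. The second cardinality comes
  out as 34, not as the 31 of the opening statement: there are 33 nonzero classes, and the
  zero.\<close>

lemma mprod_Nil [simp]: "mprod G [] = \<one>\<^bsub>G\<^esub>"
  and mprod_Cons [simp]: "mprod G (x # xs) = x \<otimes>\<^bsub>G\<^esub> mprod G xs"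
  by (simp_all add: mprod_def)

lemma mprod_closed: "monoid G \<Longrightarrow> set xs \<subseteq> carrier G \<Longrightarrow> mprod G xs \<in> carrier G"
  by (induction xs) (auto simp: monoid.m_closed)

lemma mprod_append:
  "monoid G \<Longrightarrow> set xs \<subseteq> carrier G \<Longrightarrow> set ys \<subseteq> carrier G \<Longrightarrow>
    mprod G (xs @ ys) = mprod G xs \<otimes>\<^bsub>G\<^esub> mprod G ys"
  by (induction xs) (auto simp: monoid.m_assoc mprod_closed)

lemma satisfiesD:
  "satisfies M (u, v) \<Longrightarrow> (\<And>x. \<phi> x \<in> carrier M) \<Longrightarrow> mprod M (map \<phi> u) = mprod M (map \<phi> v)"
  by (auto simp: satisfies_def)

lemma satisfiesI:
  "(\<And>\<phi>. (\<And>x. \<phi> x \<in> carrier M) \<Longrightarrow> mprod M (map \<phi> u) = mprod M (map \<phi> v)) \<Longrightarrow> satisfies M (u, v)"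
  by (auto simp: satisfies_def)

definition subst :: "(letter \<Rightarrow> word) \<Rightarrow> word \<Rightarrow> word" where
  "subst \<Phi> u = concat (map \<Phi> u)"

lemma subst_simps [simp]:
  "subst \<Phi> [] = []" "subst \<Phi> (x # u) = \<Phi> x @ subst \<Phi> u" "subst \<Phi> (u @ v) = subst \<Phi> u @ subst \<Phi> v"
  by (simp_all add: subst_def)

lemma mprod_subst:
  assumes "monoid M" "\<And>x. \<phi> x \<in> carrier M"
  shows "mprod M (map \<phi> (subst \<Phi> u)) = mprod M (map (\<lambda>x. mprod M (map \<phi> (\<Phi> x))) u)"
proof (induction u)
  case (Cons x u)
  then show ?case using assms by (simp add: mprod_append image_subset_iff)
qed simp

lemma satisfies_subst:
  assumes "monoid M" "satisfies M (u, v)"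
  shows "satisfies M (p @ subst \<Phi> u @ q, p @ subst \<Phi> v @ q)"
proof (rule satisfiesI)
  fix \<phi> assume \<phi>: "\<And>x::letter. \<phi> x \<in> carrier M"
  have sub: "set (map \<phi> w) \<subseteq> carrier M" for w using \<phi> by auto
  have "mprod M (map \<phi> (subst \<Phi> u)) = mprod M (map \<phi> (subst \<Phi> v))"
    unfolding mprod_subst[OF assms(1) \<phi>]
    by (rule satisfiesD[OF assms(2)]) (rule mprod_closed[OF assms(1) sub])
  then show "mprod M (map \<phi> (p @ subst \<Phi> u @ q)) = mprod M (map \<phi> (p @ subst \<Phi> v @ q))"
    using assms(1) by (simp add: mprod_append sub del: set_map)
qed

lemma satisfies_refl: "satisfies M (u, u)"
  by (simp add: satisfies_def)

lemma satisfies_sym: "satisfies M (u, v) \<Longrightarrow> satisfies M (v, u)"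
  by (simp add: satisfies_def)

lemma satisfies_trans: "satisfies M (u, v) \<Longrightarrow> satisfies M (v, w) \<Longrightarrow> satisfies M (u, w)"
  by (simp add: satisfies_def)

text \<open>Closure under contexts and substitutions sits in the axiom rule, so that a derivation is
  a chain of elementary rewritings in either direction.\<close>

inductive deriv :: "(word \<times> word) set \<Rightarrow> word \<Rightarrow> word \<Rightarrow> bool" for \<Sigma> where
  deriv_ax: "(u, v) \<in> \<Sigma> \<Longrightarrow> deriv \<Sigma> (p @ subst \<Phi> u @ q) (p @ subst \<Phi> v @ q)"
| deriv_refl: "deriv \<Sigma> u u"
| deriv_sym: "deriv \<Sigma> u v \<Longrightarrow> deriv \<Sigma> v u"
| deriv_trans: "deriv \<Sigma> u v \<Longrightarrow> deriv \<Sigma> v w \<Longrightarrow> deriv \<Sigma> u w"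

lemma deriv_sound:
  assumes "deriv \<Sigma> u v" "monoid M" "\<forall>e\<in>\<Sigma>. satisfies M e"
  shows "satisfies M (u, v)"
  using assms
  by (induction rule: deriv.induct)
    (blast intro: satisfies_subst satisfies_refl satisfies_sym satisfies_trans)+


section \<open>Birkhoff's theorem\<close>

text \<open>Countability of the alphabet makes the generating monoids countable; hence they have
  copies inside any infinite universe.\<close>

instance letter :: countable
  by countable_datatype

lemma infinite_letters: "infinite (UNIV :: letter set)"
proof -
  have "inj Ly" by (simp add: inj_def)
  then show ?thesis using finite_imageD[of Ly UNIV] finite_subset[OF subset_UNIV] by blast
qed

lemma mprod_product_group:
  "mprod (product_group I A) (map \<psi> u) = (\<lambda>i\<in>I. mprod (A i) (map (\<lambda>c. \<psi> c i) u))"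
  by (induction u) (auto intro: restrict_ext)

lemma generated_variety_satisfies:
  assumes M: "M \<in> generated_variety K" and K: "\<forall>A\<in>K. monoid A" and e: "\<forall>A\<in>K. satisfies A (u, v)"
  shows "satisfies M (u, v)"
proof -
  from M obtain I :: "('a list \<times> 'a list) set" and A N h where
    mon: "monoid M" and A: "\<forall>i\<in>I. A i \<in> K" and N: "submonoid N (product_group I A)"
    and hom: "h \<in> hom ((product_group I A)\<lparr>carrier := N\<rparr>) M" and surj: "h ` N = carrier M"
    unfolding generated_variety_def by blast
  let ?P = "product_group I A"
  have mult: "h (x \<otimes>\<^bsub>?P\<^esub> y) = h x \<otimes>\<^bsub>M\<^esub> h y" if "x \<in> N" "y \<in> N" for x y
    using hom that by (simp add: hom_def)
  have oneN: "\<one>\<^bsub>?P\<^esub> \<in> N" using N by (rule submonoid.one_closed)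
  have sub: "x i \<in> carrier (A i)" if "x \<in> N" "i \<in> I" for x i
    using subsetD[OF submonoid.subset[OF N] that(1)] that(2) by (cases i) (simp add: PiE_def Pi_def)
  have l_one: "\<one>\<^bsub>?P\<^esub> \<otimes>\<^bsub>?P\<^esub> x = x" if "x \<in> N" for x
    using subsetD[OF submonoid.subset[OF N] that] A K sub[OF that]
    by (simp add: PiE_def extensional_def fun_eq_iff monoid.l_one)
  \<comment> \<open>Homomorphisms are only required to be multiplicative here; a preimage
    \<open>x\<close> of the identity of \<open>M\<close> shows that \<open>h\<close> preserves
    it.\<close>
  have hone: "h \<one>\<^bsub>?P\<^esub> = \<one>\<^bsub>M\<^esub>"
  proof -
    obtain x where x: "x \<in> N" "h x = \<one>\<^bsub>M\<^esub>"
      using surj monoid.one_closed[OF mon] by (metis imageE)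
    have "h \<one>\<^bsub>?P\<^esub> \<otimes>\<^bsub>M\<^esub> h x = h x" using mult[OF oneN x(1)] l_one[OF x(1)] by simp
    moreover have "h \<one>\<^bsub>?P\<^esub> \<in> carrier M" using surj oneN by blast
    ultimately show ?thesis using x(2) mon by (simp add: monoid.r_one)
  qed
  have ev: "mprod ?P (map \<psi> w) \<in> N \<and> h (mprod ?P (map \<psi> w)) = mprod M (map (\<lambda>c. h (\<psi> c)) w)"
    if "\<And>c. \<psi> c \<in> N" for \<psi> and w :: word
  proof (induction w)
    case Nil
    show ?case using oneN hone by (simp del: one_product_group)
  next
    case (Cons c w)
    then show ?case using mult[OF that[of c]] submonoid.m_closed[OF N that[of c]] by (simp del: mult_product_group)
  qed
  show ?thesis
  proof (rule satisfiesI)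
    fix \<phi> assume "\<And>x::letter. \<phi> x \<in> carrier M"
    then have "\<forall>x. \<exists>y\<in>N. h y = \<phi> x" using surj by (metis imageE)
    then obtain \<psi> where \<psi>: "\<And>x. \<psi> x \<in> N" "\<And>x. h (\<psi> x) = \<phi> x" by metis
    have "mprod ?P (map \<psi> u) = mprod ?P (map \<psi> v)"
      unfolding mprod_product_group
    proof (rule restrict_ext)
      fix i assume i: "i \<in> I"
      show "mprod (A i) (map (\<lambda>c. \<psi> c i) u) = mprod (A i) (map (\<lambda>c. \<psi> c i) v)"
        using e A i sub[OF \<psi>(1) i] by (intro satisfiesD) auto
    qed
    then show "mprod M (map \<phi> u) = mprod M (map \<phi> v)"
      using ev[of \<psi> u] ev[of \<psi> v] \<psi> by simp
  qed
qed

text \<open>A relatively free monoid is built: one factor for every pair of words over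
  \<open>M\<close> that some member of \<open>K\<close> separates, the submonoid of all evaluations
  of words, and the map from such an evaluation to the value of the word in \<open>M\<close>. It is
  well defined because two words with equal evaluations are not separated by any member of
  \<open>K\<close>, hence form an identity of \<open>K\<close>.\<close>

lemma in_generated_variety:
  fixes M :: "'m monoid" and K :: "'k monoid set"
  assumes mon: "monoid M" and K: "\<forall>A\<in>K. monoid A"
    and ids: "\<And>u v. \<forall>A\<in>K. satisfies A (u, v) \<Longrightarrow> satisfies M (u, v)"
  shows "M \<in> generated_variety K"
proof -
  define I where "I = {(x, y). set x \<subseteq> carrier M \<and> set y \<subseteq> carrier M \<and>
    (\<exists>A\<in>K. \<exists>\<phi>::'m \<Rightarrow> 'k. (\<forall>c. \<phi> c \<in> carrier A) \<and> mprod A (map \<phi> x) \<noteq> mprod A (map \<phi> y))}"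
  have "\<forall>i\<in>I. \<exists>A \<phi>. A \<in> K \<and> (\<forall>c. \<phi> c \<in> carrier A) \<and> mprod A (map \<phi> (fst i)) \<noteq> mprod A (map \<phi> (snd i))"
    unfolding I_def by auto
  then obtain A \<phi> where A: "\<And>i. i \<in> I \<Longrightarrow> A i \<in> K" and \<phi>: "\<And>i c. i \<in> I \<Longrightarrow> \<phi> i c \<in> carrier (A i)"
    and ne: "\<And>i. i \<in> I \<Longrightarrow> mprod (A i) (map (\<phi> i) (fst i)) \<noteq> mprod (A i) (map (\<phi> i) (snd i))"
    by metis
  let ?P = "product_group I A"
  define ev where "ev w = (\<lambda>i\<in>I. mprod (A i) (map (\<phi> i) w))" for w
  define W where "W = {w. set w \<subseteq> carrier M}"
  define N where "N = ev ` W"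
  have mult: "ev w \<otimes>\<^bsub>?P\<^esub> ev w' = ev (w @ w')" if "w \<in> W" "w' \<in> W" for w w'
    using that K A \<phi> by (auto simp: ev_def W_def mprod_append image_subset_iff intro!: restrict_ext)
  have WW: "w @ w' \<in> W" if "w \<in> W" "w' \<in> W" for w w' using that by (auto simp: W_def)
  have wd: "mprod M w = mprod M w'" if w: "w \<in> W" "w' \<in> W" and eq: "ev w = ev w'" for w w'
  proof -
    have nI: "(w, w') \<notin> I"
    proof
      assume i: "(w, w') \<in> I"
      from fun_cong[OF eq, of "(w, w')"] ne[OF i] i show False by (simp add: ev_def)
    qed
    \<comment> \<open>Identities are written in the alphabet \<open>letter\<close>, so the finitely
      many elements occurring in the two words are renamed injectively.\<close>
    have fin: "finite (set w \<union> set w')" by simp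
    obtain f :: "'m \<Rightarrow> nat" where "inj_on f (set w \<union> set w')"
      using finite_imp_inj_to_nat_seg[OF fin] by blast
    then have "inj_on (Ly \<circ> f) (set w \<union> set w')" by (auto simp: inj_on_def)
    then obtain \<rho> :: "'m \<Rightarrow> letter" where \<rho>: "inj_on \<rho> (set w \<union> set w')" by blast
    have "satisfies M (map \<rho> w, map \<rho> w')"
    proof (rule ids, rule ballI, rule satisfiesI)
      fix B \<psi> assume B: "B \<in> K" "\<And>x::letter. \<psi> x \<in> carrier B"
      have "mprod B (map (\<psi> \<circ> \<rho>) w) = mprod B (map (\<psi> \<circ> \<rho>) w')"
      proof (rule ccontr)
        assume "mprod B (map (\<psi> \<circ> \<rho>) w) \<noteq> mprod B (map (\<psi> \<circ> \<rho>) w')"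
        moreover have "\<forall>c. (\<psi> \<circ> \<rho>) c \<in> carrier B" using B by simp
        ultimately have "(w, w') \<in> I" unfolding I_def using w B(1) W_def by blast
        then show False using nI by simp
      qed
      then show "mprod B (map \<psi> (map \<rho> w)) = mprod B (map \<psi> (map \<rho> w'))" by simp
    qed
    \<comment> \<open>The renaming is undone; letters outside its range receive the identity element
      as a default.\<close>
    moreover obtain \<theta> where \<theta>: "\<theta> = (\<lambda>l. if l \<in> \<rho> ` (set w \<union> set w') then inv_into (set w \<union> set w') \<rho> l else \<one>\<^bsub>M\<^esub>)"
      by simp
    have "\<theta> l \<in> carrier M" for l
      using w inv_into_into[of l \<rho> "set w \<union> set w'"] mon by (auto simp: \<theta> W_def monoid.one_closed)
    ultimately have "mprod M (map \<theta> (map \<rho> w)) = mprod M (map \<theta> (map \<rho> w'))"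
      by (rule satisfiesD)
    moreover have "map \<theta> (map \<rho> w) = w" "map \<theta> (map \<rho> w') = w'"
      using \<rho> by (auto simp: \<theta> map_idI)
    ultimately show ?thesis by simp
  qed
  define h where "h f = mprod M (SOME w. w \<in> W \<and> ev w = f)" for f
  have h: "h (ev w) = mprod M w" if "w \<in> W" for w
  proof -
    have "\<exists>w'. w' \<in> W \<and> ev w' = ev w" using that by blast
    from someI_ex[OF this] show ?thesis unfolding h_def using wd that by blast
  qed
  have hom: "h \<in> hom (?P\<lparr>carrier := N\<rparr>) M"
    using mult WW h mon
    by (auto simp: hom_def N_def W_def mprod_closed mprod_append simp del: mult_product_group)
  have "carrier M \<subseteq> h ` N"
  proof
    fix x assume "x \<in> carrier M"
    then have "[x] \<in> W" "mprod M [x] = x" using mon by (auto simp: W_def monoid.r_one)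
    then show "x \<in> h ` N" using h N_def by (metis imageI)
  qed
  moreover have "h ` N \<subseteq> carrier M" using h mon by (force simp: N_def W_def mprod_closed)
  moreover have "submonoid N ?P"
  proof
    show "N \<subseteq> carrier ?P"
      using A K \<phi> by (auto simp: N_def ev_def intro!: mprod_closed)
    show "x \<otimes>\<^bsub>?P\<^esub> y \<in> N" if "x \<in> N" "y \<in> N" for x y
      using that mult WW by (auto simp: N_def simp del: mult_product_group)
    have "ev [] = \<one>\<^bsub>?P\<^esub>" "[] \<in> W" by (auto simp: ev_def W_def)
    then show "\<one>\<^bsub>?P\<^esub> \<in> N" unfolding N_def by (metis imageI)
  qed
  ultimately have "(\<forall>i\<in>I. A i \<in> K) \<and> submonoid N ?P \<and> h \<in> hom (?P\<lparr>carrier := N\<rparr>) M \<and> h ` N = carrier M"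
    using A hom by (intro conjI ballI equalityI)
  then show ?thesis unfolding generated_variety_def 
    by (intro CollectI conjI[OF mon] exI[of _ I] exI[of _ A] exI[of _ N] exI[of _ h])
qed

lemma generated_variety_eq:
  assumes "\<forall>A\<in>K. monoid A"
  shows "(generated_variety K :: 'm monoid set) =
    {M. monoid M \<and> (\<forall>u v. (\<forall>A\<in>K. satisfies A (u, v)) \<longrightarrow> satisfies M (u, v))}"
  (is "_ = ?R")
proof
  show "generated_variety K \<subseteq> ?R"
  proof
    fix M :: "'m monoid" assume M: "M \<in> generated_variety K"
    then have "monoid M" unfolding generated_variety_def by (elim CollectE conjE)
    then show "M \<in> ?R" using generated_variety_satisfies[OF M assms] by simp
  qed
  show "?R \<subseteq> generated_variety K"
  proof
    fix M :: "'m monoid" assume "M \<in> ?R"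
    then show "M \<in> generated_variety K"
      by (intro in_generated_variety assms) simp_all
  qed
qed


section \<open>The congruence \<lambda>\<close>

text \<open>Recursive form of \<open>first_two_adjacent\<close>, suited to induction and to the
  simplification of concrete words.\<close>

fun fta :: "letter \<Rightarrow> word \<Rightarrow> bool" where
  "fta a [] = False"
| "fta a (x # xs) = (if x = a then xs \<noteq> [] \<and> hd xs = a else fta a xs)"

lemma first_two_adjacent_iff: "first_two_adjacent a u \<longleftrightarrow> fta a u"
proof (induction u)
  case Nil
  then show ?case by (simp add: first_two_adjacent_def)
next
  case (Cons x xs)
  show ?case
  proof (cases "x = a")
    case True
    have "first_two_adjacent a (x # xs) \<longleftrightarrow> (\<exists>s. xs = a # s)"
      unfolding first_two_adjacent_def
    proof
      assume "\<exists>p s. x # xs = p @ [a, a] @ s \<and> a \<notin> set p"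
      then obtain p s where "x # xs = p @ [a, a] @ s" "a \<notin> set p" by blast
      then show "\<exists>s. xs = a # s" using True by (cases p) auto
    next
      assume "\<exists>s. xs = a # s"
      then show "\<exists>p s. x # xs = p @ [a, a] @ s \<and> a \<notin> set p"
        using True by (metis append_Cons append_Nil empty_iff empty_set)
    qed
    then show ?thesis using True by (cases xs) auto
  next
    case False
    have "first_two_adjacent a (x # xs) \<longleftrightarrow> first_two_adjacent a xs"
      unfolding first_two_adjacent_def
    proof
      assume "\<exists>p s. x # xs = p @ [a, a] @ s \<and> a \<notin> set p"
      then obtain p s where "x # xs = p @ [a, a] @ s" "a \<notin> set p" by blast
      then show "\<exists>p s. xs = p @ [a, a] @ s \<and> a \<notin> set p" using False by (cases p) auto
    next
      assume "\<exists>p s. xs = p @ [a, a] @ s \<and> a \<notin> set p"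
      then obtain p s where "xs = p @ [a, a] @ s" "a \<notin> set p" by blast
      then show "\<exists>p s. x # xs = p @ [a, a] @ s \<and> a \<notin> set p"
        using False by (intro exI[of _ "x # p"] exI[of _ s]) auto
    qed
    then show ?thesis using False Cons by simp
  qed
qed

text \<open>Both factors may be collapsed before the product is: the right one by induction, the
  left one by reversal.\<close>

lemma remdups_adj_append_cong:
  "remdups_adj u = remdups_adj v \<Longrightarrow> remdups_adj u' = remdups_adj v' \<Longrightarrow>
    remdups_adj (u @ u') = remdups_adj (v @ v')"
proof -
  have *: "remdups_adj (u @ u') = remdups_adj (remdups_adj u @ remdups_adj u')" for u u' :: "'a list"
  proof -
    have rr: "remdups_adj (remdups_adj w) = remdups_adj w" for w :: "'a list"
    proof (induction w)
      case (Cons x w)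
      then show ?case by (cases "remdups_adj w") (auto simp: remdups_adj_Cons[of x w])
    qed simp
    have rr2: "remdups_adj (u @ u') = remdups_adj (u @ remdups_adj u')" for u u' :: "'a list"
      by (induction u) (simp_all add: remdups_adj_Cons rr)
    moreover have "remdups_adj (w @ u) = remdups_adj (remdups_adj w @ u)" for u w :: "'a list"
      by (metis rr2 remdups_adj_rev rev_append rev_rev_ident)
    ultimately show ?thesis by metis
  qed
  show "remdups_adj u = remdups_adj v \<Longrightarrow> remdups_adj u' = remdups_adj v' \<Longrightarrow>
    remdups_adj (u @ u') = remdups_adj (v @ v')"
    using *[of u u'] *[of v v'] by simp
qed

lemma tau1_remdups_adj: "tau1 u (remdups_adj u)"
proof (induction u rule: remdups_adj.induct)
  case (3 x y xs)
  show ?case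
  proof (cases "x = y")
    case True
    have "tau1 ([x, x] @ xs) ([x] @ xs)" by (intro tau1_mult tau1_sym[OF tau1_gen] tau1_refl)
    then show ?thesis using 3(1) True by (auto intro: tau1_trans)
  next
    case False
    then show ?thesis using 3(2) tau1_mult[OF tau1_refl[of "[x]"]] by fastforce
  qed
qed (auto intro: tau1_refl)

text \<open>\<open>remdups_adj\<close> computes a normal form: every word is related to its
  collapse, and the generating relations preserve the collapse.\<close>

lemma tau1_iff: "tau1 u v \<longleftrightarrow> remdups_adj u = remdups_adj v"
proof
  assume "tau1 u v"
  then show "remdups_adj u = remdups_adj v"
    by (induction rule: tau1.induct) (auto intro: remdups_adj_append_cong)
next
  assume "remdups_adj u = remdups_adj v"
  then show "tau1 u v" using tau1_remdups_adj by (metis tau1_sym tau1_trans)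
qed

abbreviation lam_rel (infix "\<sim>" 50) where "u \<sim> v \<equiv> (u, v) \<in> lam"

text \<open>The adjacency condition may range over all letters, since a letter with adjacent first
  two occurrences is multiple.\<close>

lemma lam_iff:
  "u \<sim> v \<longleftrightarrow> remdups_adj u = remdups_adj v \<and> mul u = mul v \<and> (\<forall>a. fta a u \<longleftrightarrow> fta a v)"
proof -
  have "fta a u \<Longrightarrow> count_list u a \<ge> 2" for a u
    by (induction u) (auto simp: neq_Nil_conv split: if_splits)
  then show ?thesis
    unfolding lam_def gamma_def mul_def by (auto simp: tau1_iff first_two_adjacent_iff)
qed

lemma lam_equiv: "equiv UNIV lam"
  by (auto simp: equiv_def refl_on_def sym_def trans_def lam_iff)

lemma lam_refl [simp]: "u \<sim> u" and lam_sym: "u \<sim> v \<Longrightarrow> v \<sim> u"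
  and lam_trans: "u \<sim> v \<Longrightarrow> v \<sim> w \<Longrightarrow> u \<sim> w"
  by (auto simp: lam_iff)

lemma mem_mul [simp]: "a \<in> mul u \<longleftrightarrow> count_list u a \<ge> 2"
  by (simp add: mul_def)

lemma lam_set: "u \<sim> v \<Longrightarrow> set u = set v"
  by (metis lam_iff remdups_adj_set)

text \<open>The first two occurrences lie in \<open>u\<close>, straddle the border, or lie in
  \<open>v\<close>. All data in the middle case are invariant under \<lambda>, which makes \<lambda>
  a congruence.\<close>

lemma fta_append:
  "fta a (u @ v) \<longleftrightarrow>
    fta a u \<or> (count_list u a = 1 \<and> u \<noteq> [] \<and> last u = a \<and> v \<noteq> [] \<and> hd v = a) \<or> (a \<notin> set u \<and> fta a v)"
proof (induction u)
  case (Cons x u)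
  show ?case
  proof (cases "x = a")
    case True
    then show ?thesis using count_list_0_iff[of u a] by (cases u) (auto simp: hd_append)
  next
    case False
    then show ?thesis using Cons by (cases u) auto
  qed
qed simp

lemma lam_count1: "u \<sim> v \<Longrightarrow> count_list u a = 1 \<longleftrightarrow> count_list v a = 1"
proof -
  assume "u \<sim> v"
  then have "a \<in> mul u \<longleftrightarrow> a \<in> mul v" "a \<in> set u \<longleftrightarrow> a \<in> set v"
    using lam_set by (auto simp: lam_iff)
  then show ?thesis using count_list_0_iff[of u a] count_list_0_iff[of v a] by auto
qed

lemma lam_append:
  assumes "u \<sim> v" "u' \<sim> v'"
  shows "u @ u' \<sim> v @ v'"
proof -
  have ra: "remdups_adj u = remdups_adj v" "remdups_adj u' = remdups_adj v'"
    using assms by (auto simp: lam_iff)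
  have e: "u = [] \<longleftrightarrow> v = []" "u' = [] \<longleftrightarrow> v' = []"
    using ra by (metis remdups_adj_Nil_iff)+
  have l: "last u = last v" "hd u' = hd v'"
    using ra by (metis last_remdups_adj hd_remdups_adj)+
  have "mul (u @ u') = mul (v @ v')"
  proof (rule Set.set_eqI)
    fix a
    have "count_list u a = 0 \<longleftrightarrow> count_list v a = 0" "count_list u' a = 0 \<longleftrightarrow> count_list v' a = 0"
      using assms lam_set by (auto simp: count_list_0_iff)
    moreover have "count_list u a = 1 \<longleftrightarrow> count_list v a = 1" "count_list u' a = 1 \<longleftrightarrow> count_list v' a = 1"
      using assms lam_count1 by auto
    ultimately show "a \<in> mul (u @ u') \<longleftrightarrow> a \<in> mul (v @ v')" by auto
  qed
  moreover have "fta a (u @ u') \<longleftrightarrow> fta a (v @ v')" for a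
  proof -
    have "fta a u \<longleftrightarrow> fta a v" "fta a u' \<longleftrightarrow> fta a v'" using assms by (auto simp: lam_iff)
    then show ?thesis
      unfolding fta_append lam_set[OF assms(1)] lam_count1[OF assms(1), of a] e l by simp
  qed
  ultimately show ?thesis using remdups_adj_append_cong[OF ra] by (simp add: lam_iff)
qed

lemma lam_append3: "u \<sim> v \<Longrightarrow> p @ u @ q \<sim> p @ v @ q"
  by (intro lam_append lam_refl)


section \<open>Rees quotients\<close>

abbreviation cls :: "word \<Rightarrow> word set" where "cls u \<equiv> lam `` {u}"

lemma cls_eq_iff: "cls u = cls v \<longleftrightarrow> u \<sim> v"
  using eq_equiv_class_iff[OF lam_equiv] by simp

lemma quotient_mult:
  "cls u \<otimes>\<^bsub>quotient_monoid lam\<^esub> cls v = cls (u @ v)"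
proof -
  have "(\<Union>x\<in>cls u. \<Union>y\<in>cls v. cls (x @ y)) = cls (u @ v)"
  proof -
    have "cls (x @ y) = cls (u @ v)" if "x \<in> cls u" "y \<in> cls v" for x y
      unfolding cls_eq_iff using that by (intro lam_append) (auto intro: lam_sym)
    moreover have "u \<in> cls u" "v \<in> cls v" by auto
    ultimately show ?thesis by blast
  qed
  then show ?thesis by (simp add: quotient_monoid_def)
qed

lemma quotient_carrier: "carrier (quotient_monoid lam) = range cls"
  by (auto simp: quotient_monoid_def quotient_def)

lemma quotient_one: "\<one>\<^bsub>quotient_monoid lam\<^esub> = cls []"
  by (simp add: quotient_monoid_def)

lemma juxt_cls: "juxt (map cls us) = cls (concat us)"
  unfolding juxt_def by (induction us) (simp_all add: quotient_one quotient_mult)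

lemma single_cls: "single a = cls [a]"
proof -
  have "v = [a]" if "[a] \<sim> v" for v
  proof -
    have "a \<in> mul v \<longleftrightarrow> a \<in> mul [a]" using that unfolding lam_iff by blast
    then have v: "remdups_adj v = [a]" "\<not> count_list v a \<ge> 2"
      using that by (auto simp: lam_iff)
    then obtain n where "v = replicate n a" using remdups_adj_singleton by metis
    then show ?thesis using v by (cases n; cases "n - 1") (auto simp: numeral_2_eq_2)
  qed
  then show ?thesis by (auto simp: single_def)
qed

lemma many_cls: "many a = cls [a, a]"
proof
  have m: "replicate n a \<sim> [a, a]" if "n \<ge> 2" for n
  proof -
    have c: "count_list (replicate k a) b = (if a = b then k else 0)" for k b by (induction k) auto
    have f: "fta b (replicate k a) \<longleftrightarrow> a = b \<and> k \<ge> 2" for k b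
      by (induction k) (auto simp: hd_replicate Suc_le_eq numeral_2_eq_2)
    from that show ?thesis
      using c[of 2] f[of _ 2]
      by (simp add: lam_iff remdups_adj_replicate mul_def c f del: fta.simps)
        (auto simp: numeral_2_eq_2)
  qed
  then show "many a \<subseteq> cls [a, a]" using lam_sym by (auto simp: many_def)
  show "cls [a, a] \<subseteq> many a"
  proof
    fix v assume "v \<in> cls [a, a]"
    then have l: "[a, a] \<sim> v" by simp
    then have "a \<in> mul v \<longleftrightarrow> a \<in> mul [a, a]" unfolding lam_iff by blast
    then have v: "remdups_adj v = [a]" "count_list v a \<ge> 2" using l by (auto simp: lam_iff)
    then have "v = replicate (length v) a" by (simp add: remdups_adj_singleton)
    moreover have "length v \<ge> 2" using v(2) count_le_length[of v a] by simp
    ultimately show "v \<in> many a" unfolding many_def by blast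
  qed
qed

text \<open>Says that \<open>x\<close> represents a nonzero element of the Rees quotient.\<close>

definition fac :: "word set \<Rightarrow> word \<Rightarrow> bool" where
  "fac W x \<longleftrightarrow> (\<exists>w\<in>W. \<exists>p q. p @ x @ q \<sim> w)"

lemma fac_down_set: "A \<in> down_set lam (cls ` W) \<longleftrightarrow> (\<exists>x. A = cls x \<and> fac W x)"
proof -
  have "class_le lam (cls x) (cls w) \<longleftrightarrow> (\<exists>p q. p @ x @ q \<sim> w)" for x w
    by (auto simp: class_le_def quotient_carrier quotient_mult cls_eq_iff intro: lam_sym)
  then show ?thesis unfolding down_set_def quotient_carrier fac_def by blast
qed

lemma cls_in_down_set: "cls x \<in> down_set lam (cls ` W) \<longleftrightarrow> fac W x"
proof -
  have "fac W x" if "x \<sim> y" "fac W y" for x y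
    using that lam_append3 lam_trans unfolding fac_def by blast
  then show ?thesis unfolding fac_down_set cls_eq_iff using lam_refl by blast
qed

lemma fac_lam: "x \<sim> y \<Longrightarrow> fac W x \<longleftrightarrow> fac W y"
  by (metis cls_eq_iff cls_in_down_set)

lemma fac_append: "fac W (x @ y @ z) \<Longrightarrow> fac W y"
  unfolding fac_def by (metis append.assoc)

text \<open>The value of a word in the Rees quotient, \<open>None\<close> being zero. It maps the
  free monoid onto the quotient, so that assignments of elements lift to substitutions by
  words.\<close>

definition val :: "word set \<Rightarrow> word \<Rightarrow> word set option" where
  "val W x = (if fac W x then Some (cls x) else None)"

lemma val_eq_iff: "val W x = val W y \<longleftrightarrow> (fac W x \<or> fac W y \<longrightarrow> x \<sim> y)"
  using fac_lam[of x y W] by (auto simp: val_def cls_eq_iff)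

abbreviation Mw :: "word set \<Rightarrow> word set option monoid" where
  "Mw W \<equiv> M_lam (cls ` W)"

lemma val_mult: "val W x \<otimes>\<^bsub>Mw W\<^esub> val W y = val W (x @ y)"
  using fac_append[of W "[]" x y] fac_append[of W x y "[]"]
  by (auto simp: val_def M_monoid_def quotient_mult cls_in_down_set)

lemma val_one: "W \<noteq> {} \<Longrightarrow> \<one>\<^bsub>Mw W\<^esub> = val W []"
proof -
  assume "W \<noteq> {}"
  then have "fac W []" unfolding fac_def using lam_refl by (metis append_Nil ex_in_conv)
  then show ?thesis by (simp add: val_def M_monoid_def quotient_one)
qed

lemma val_carrier:
  assumes "finite W"
  shows "carrier (Mw W) = range (val W)"
proof -
  \<comment> \<open>A letter occurring in no word of \<open>W\<close> represents zero, so
    \<open>None\<close> is a value as well.\<close>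
  have "finite (\<Union>w\<in>W. set w)" using assms by simp
  then obtain d where d: "d \<notin> (\<Union>w\<in>W. set w)"
    using infinite_letters ex_new_if_finite by blast
  have "\<not> fac W [d]" using d lam_set by (fastforce simp: fac_def)
  then have "None \<in> range (val W)" by (metis rangeI val_def)
  then show ?thesis
    by (auto simp: M_monoid_def fac_down_set val_def image_iff)
qed

lemma monoid_Mw:
  assumes "finite W" "W \<noteq> {}"
  shows "monoid (Mw W)"
  by (rule monoidI)
    (auto simp: val_carrier[OF assms(1)] val_mult val_one[OF assms(2)])

lemma mprod_val: "W \<noteq> {} \<Longrightarrow> mprod (Mw W) (map (\<lambda>c. val W (\<Phi> c)) u) = val W (subst \<Phi> u)"
  by (induction u) (simp_all add: val_mult val_one)

text \<open>Assignments are substitutions by words followed by \<open>val\<close>, and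
  \<open>val\<close> identifies two words iff they are both zero or \<lambda>-equivalent.\<close>

lemma satisfies_Mw:
  assumes "finite W" "W \<noteq> {}"
  shows "satisfies (Mw W) (u, v) \<longleftrightarrow>
    (\<forall>\<Phi>. fac W (subst \<Phi> u) \<or> fac W (subst \<Phi> v) \<longrightarrow> subst \<Phi> u \<sim> subst \<Phi> v)"
proof
  assume "satisfies (Mw W) (u, v)"
  then have "val W (subst \<Phi> u) = val W (subst \<Phi> v)" for \<Phi>
    using satisfiesD[of "Mw W" u v "\<lambda>c. val W (\<Phi> c)"] assms
    by (simp add: mprod_val val_carrier)
  then show "\<forall>\<Phi>. fac W (subst \<Phi> u) \<or> fac W (subst \<Phi> v) \<longrightarrow> subst \<Phi> u \<sim> subst \<Phi> v"
    by (simp add: val_eq_iff)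
next
  assume *: "\<forall>\<Phi>. fac W (subst \<Phi> u) \<or> fac W (subst \<Phi> v) \<longrightarrow> subst \<Phi> u \<sim> subst \<Phi> v"
  show "satisfies (Mw W) (u, v)"
  proof (rule satisfiesI)
    fix \<phi> assume "\<And>x::letter. \<phi> x \<in> carrier (Mw W)"
    then have "\<forall>x. \<exists>y. \<phi> x = val W y" unfolding val_carrier[OF assms(1)] by blast
    from choice[OF this] obtain \<Phi> where \<phi>: "\<phi> = (\<lambda>x. val W (\<Phi> x))" by blast
    have "val W (subst \<Phi> u) = val W (subst \<Phi> v)" using * by (simp only: val_eq_iff) blast
    then show "mprod (Mw W) (map \<phi> u) = mprod (Mw W) (map \<phi> v)"
      unfolding \<phi> mprod_val[OF assms(2)] .
  qed
qed

lemma countable_Mw: "finite W \<Longrightarrow> countable (carrier (Mw W))"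
  unfolding val_carrier by (rule countable_image) (rule countableI_type)


section \<open>Sorting words by adjacent transpositions\<close>

lemma count_list_conv_split:
  "x \<in> set v \<Longrightarrow> \<exists>A B. v = A @ [x] @ B \<and> x \<notin> set A"
  by (metis append_Cons append_Nil split_list_first)

lemma count_ge2_split:
  assumes "count_list p x \<ge> 2"
  shows "\<exists>p1 p2 p3. p = p1 @ [x] @ p2 @ [x] @ p3"
proof -
  obtain p1 r where p: "p = p1 @ [x] @ r" "x \<notin> set p1"
    using assms count_list_conv_split[of x p] count_list_0_iff[of p x] by fastforce
  then have "x \<in> set r" using assms count_list_0_iff[of r x] count_list_0_iff[of p1 x] by auto
  then show ?thesis using p count_list_conv_split[of x r] by metis
qed

definition norm :: "word \<Rightarrow> bool" where
  "norm u \<longleftrightarrow> (\<forall>x. count_list u x \<in> {0, 1, 3})"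

text \<open>The position of the occurrence number \<open>i\<close> (counted from 0) of \<open>x\<close>;
  meaningful only if \<open>x\<close> occurs more than \<open>i\<close> times.\<close>

fun pos :: "word \<Rightarrow> letter \<Rightarrow> nat \<Rightarrow> nat" where
  "pos [] x i = 0"
| "pos (c # v) x i = (if c = x then (case i of 0 \<Rightarrow> 0 | Suc k \<Rightarrow> Suc (pos v x k)) else Suc (pos v x i))"

section \<open>Positions of numbered occurrences\<close>

lemma pos_split:
  "i < count_list v x \<Longrightarrow> \<exists>A B. v = A @ [x] @ B \<and> count_list A x = i \<and> length A = pos v x i"
proof (induction v arbitrary: i)
  case (Cons c v)
  show ?case
  proof (cases "c = x \<and> i = 0")
    case True
    then show ?thesis by (intro exI[of _ "[]"] exI[of _ v]) simp
  next
    case False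
    define k where "k = (if c = x then i - 1 else i)"
    have "k < count_list v x" using False Cons.prems by (auto simp: k_def split: if_splits)
    from Cons.IH[OF this] obtain A B where "v = A @ [x] @ B" "count_list A x = k" "length A = pos v x k"
      by blast
    then show ?thesis using False
      by (intro exI[of _ "c # A"] exI[of _ B]) (auto simp: k_def split: nat.splits)
  qed
qed simp

lemma pos_append: "pos (A @ x # B) x (count_list A x) = length A"
  by (induction A) auto

lemma pos_less_length_iff: "i < count_list (A @ B) x \<Longrightarrow> pos (A @ B) x i < length A \<longleftrightarrow> i < count_list A x"
  by (induction A arbitrary: i) (auto split: nat.splits)

lemma pos_inj:
  assumes "i < count_list v x" "j < count_list v y" "pos v x i = pos v y j"
  shows "x = y \<and> i = j"
proof -
  obtain A B where A: "v = A @ [x] @ B" "count_list A x = i" "length A = pos v x i"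
    using pos_split[OF assms(1)] by blast
  obtain C D where C: "v = C @ [y] @ D" "count_list C y = j" "length C = pos v y j"
    using pos_split[OF assms(2)] by blast
  have "A = C \<and> [x] @ B = [y] @ D" using A C assms(3) by (metis append_eq_append_conv)
  then show ?thesis using A C by auto
qed

lemma pos_mono: "i < j \<Longrightarrow> j < count_list v x \<Longrightarrow> pos v x i < pos v x j"
proof -
  assume ij: "i < j" "j < count_list v x"
  obtain A B where A: "v = A @ [x] @ B" "count_list A x = j" "length A = pos v x j"
    using pos_split[OF ij(2)] by blast
  then show ?thesis using pos_less_length_iff[of i A "[x] @ B" x] ij by simp
qed

text \<open>Equal letters are told apart by their numbers, so that a word becomes a list of distinct
  items sorted by \<open>pos\<close>.\<close>

definition lab :: "word \<Rightarrow> (letter \<times> nat) list" where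
  "lab v = map (\<lambda>n. (v ! n, count_list (take n v) (v ! n))) [0..<length v]"

lemma lab_pos: "map (\<lambda>(c, i). pos v c i) (lab v) = [0..<length v]"
proof -
  have "pos v (v ! n) (count_list (take n v) (v ! n)) = n" if "n < length v" for n
    using pos_append[of "take n v" "v ! n" "drop (Suc n) v"] that by (simp add: id_take_nth_drop[symmetric])
  then show ?thesis by (auto simp: lab_def intro!: map_idI)
qed

lemma lab_set: "set (lab v) = {(c, i). i < count_list v c}"
proof (intro equalityI subsetI; clarify)
  fix c i assume "(c, i) \<in> set (lab v)"
  then obtain n where n: "n < length v" "c = v ! n" "i = count_list (take n v) (v ! n)"
    by (auto simp: lab_def)
  have "count_list v c = count_list (take n v @ v ! n # drop (Suc n) v) c"
    using n(1) by (simp add: id_take_nth_drop[symmetric])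
  then show "i < count_list v c" using n by simp
next
  fix c i assume "i < count_list v c"
  from pos_split[OF this] obtain A B where "v = A @ [c] @ B" "count_list A c = i" by blast
  then show "(c, i) \<in> set (lab v)"
    by (auto simp: lab_def nth_append intro!: image_eqI[of _ _ "length A"])
qed

lemma lab_fst: "map fst (lab v) = v"
  by (auto simp: lab_def comp_def intro: map_nth)

text \<open>Both \<open>xs\<close> and the occurrences in \<open>v\<close> of letters of
  \<open>S\<close> are strictly sorted by position and have the same elements, hence coincide. In
  this way a projection is read off from inequalities between positions.\<close>

lemma filter_eq_pattern:
  assumes sorted: "sorted_wrt (<) (map (\<lambda>(c, i). pos v c i) xs)"
    and set: "set xs = {(c, i). c \<in> S \<and> i < count_list v c}"
  shows "filter (\<lambda>c. c \<in> S) v = map fst xs"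
proof -
  define P where "P = (\<lambda>(c, i). pos v c i)"
  define ys where "ys = filter (\<lambda>(c, i). c \<in> S) (lab v)"
  have sx: "set ys = set xs" by (auto simp: ys_def set lab_set)
  have inj: "inj_on P (set xs)" unfolding set inj_on_def P_def using pos_inj by fastforce
  have "sorted_wrt (<) (map P xs)"
    using sorted unfolding P_def .
  moreover have "sorted_wrt (<) (map P (lab v))"
    unfolding P_def lab_pos by simp
  then have "sorted_wrt (<) (map P ys)"
    unfolding ys_def sorted_wrt_map by (rule sorted_wrt_filter)
  ultimately have "map P xs = map P ys"
    using sx by (intro strict_sorted_equal) auto
  then have "xs = ys" using inj sx by (intro map_inj_on[of P]) simp_all
  then have "map fst xs = filter (\<lambda>c. c \<in> S) (map fst (lab v))"
    unfolding ys_def filter_map by (simp add: comp_def split_def)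
  then show ?thesis by (simp add: lab_fst)
qed

text \<open>Insertion sort: a prefix \<open>g\<close> already agrees with \<open>v\<close>, and the
  next letter of \<open>v\<close> is moved left until it follows \<open>g\<close>. \<open>R\<close>
  is an invariant that may be used to justify the single transpositions.\<close>

lemma sort_by_swaps:
  assumes E_refl: "\<And>u. E u u" and E_trans: "\<And>u v w. E u v \<Longrightarrow> E v w \<Longrightarrow> E u w"
    and R_E: "\<And>u u'. R u \<Longrightarrow> E u u' \<Longrightarrow> R u'"
    and swap: "\<And>p x y q. R (p @ [x, y] @ q) \<Longrightarrow> (\<And>z. count_list (p @ [x, y] @ q) z = count_list v z) \<Longrightarrow>
      x \<noteq> y \<Longrightarrow> pos v y (count_list p y) < pos v x (count_list p x) \<Longrightarrow>
      E (p @ [x, y] @ q) (p @ [y, x] @ q)"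
    and R: "R u" and counts: "\<And>x. count_list u x = count_list v x"
  shows "E u v"
proof -
  have bubble: "E (g @ A @ [c] @ B) (g @ [c] @ A @ B)"
    if "v = g @ c # v2" "c \<notin> set A" "R (g @ A @ [c] @ B)"
      "\<And>x. count_list (g @ A @ [c] @ B) x = count_list v x" for g c v2 A B
    using that
  proof (induction A arbitrary: B rule: rev_induct)
    case Nil
    then show ?case by (simp add: E_refl)
  next
    case (snoc d A)
    have d: "d \<noteq> c" using snoc.prems by auto
    have c: "count_list (g @ A) c = count_list g c" using snoc.prems by (simp add: count_list_0_iff)
    then have pc: "pos v c (count_list (g @ A) c) = length g"
      using snoc.prems(1) pos_append by metis
    have lt: "count_list (g @ A) d < count_list v d" using snoc.prems(4)[of d] by (simp add: d)
    \<comment> \<open>The occurrence of \<open>d\<close> to be crossed is not among those in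
      \<open>g\<close>; in \<open>v\<close> it therefore comes after the \<open>c\<close> that
      directly follows \<open>g\<close>, so the pair is inverted.\<close>
    then have "\<not> pos v d (count_list (g @ A) d) < length g"
      using pos_less_length_iff[of "count_list (g @ A) d" g "c # v2" d] snoc.prems(1) by simp
    moreover have "pos v d (count_list (g @ A) d) \<noteq> pos v c (count_list (g @ A) c)"
      using pos_inj[OF lt, of "count_list (g @ A) c" c] d c snoc.prems(1) by auto
    ultimately have "pos v c (count_list (g @ A) c) < pos v d (count_list (g @ A) d)"
      using pc by simp
    then have e: "E ((g @ A) @ [d, c] @ B) ((g @ A) @ [c, d] @ B)"
      using snoc.prems(3,4) d by (intro swap) simp_all
    have "E (g @ A @ [c] @ (d # B)) (g @ [c] @ A @ (d # B))"
    proof (rule snoc.IH)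
      show "R (g @ A @ [c] @ d # B)" using R_E[OF _ e] snoc.prems(3) by simp
      show "count_list (g @ A @ [c] @ d # B) x = count_list v x" for x
        using snoc.prems(4)[of x] by (auto split: if_splits)
    qed (use snoc.prems in auto)
    then show ?case using E_trans[OF e] by simp
  qed
  have "E (g @ u1) v" if "v = g @ v2" "R (g @ u1)" "\<And>x. count_list (g @ u1) x = count_list v x" for g v2 u1
    using that
  proof (induction v2 arbitrary: g u1)
    case Nil
    have "u1 = []" using Nil(3)[of "hd u1"] Nil(1) by (cases u1) auto
    then show ?case using Nil by (simp add: E_refl)
  next
    case (Cons c v2)
    have "c \<in> set u1"
      using Cons.prems(3)[of c] Cons.prems(1) by (metis count_list_0_iff append_Cons count_list_append
        add_left_cancel add_cancel_right_right count_notin in_set_conv_decomp_first list.set_intros(1))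
    then obtain A B where u1: "u1 = A @ [c] @ B" "c \<notin> set A" using count_list_conv_split by metis
    have e: "E (g @ A @ [c] @ B) (g @ [c] @ A @ B)"
      using Cons.prems u1 by (intro bubble) auto
    have "E ((g @ [c]) @ A @ B) v"
    proof (rule Cons.IH)
      show "R ((g @ [c]) @ A @ B)" using R_E[OF _ e] Cons.prems(2) u1 by simp
      show "count_list ((g @ [c]) @ A @ B) x = count_list v x" for x
        using Cons.prems(3)[of x] u1 by (auto split: if_splits)
    qed (use Cons.prems in simp)
    then show ?case using E_trans[OF e] u1 by simp
  qed
  from this[of "[]" v u] show ?thesis using R counts by simp
qed

text \<open>Letters are treated one at a time, since \<open>up\<close> and \<open>down\<close> leave
  the other counts unchanged; \<open>down\<close> is repeated until three occurrences
  remain.\<close>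

lemma normalise:
  assumes E_refl: "\<And>u. E u u" and E_trans: "\<And>u v w. E u v \<Longrightarrow> E v w \<Longrightarrow> E u w"
    and up: "\<And>u x. count_list u x = 2 \<Longrightarrow>
      \<exists>u'. E u u' \<and> count_list u' x = 3 \<and> (\<forall>y. y \<noteq> x \<longrightarrow> count_list u' y = count_list u y)"
    and down: "\<And>u x. count_list u x \<ge> 4 \<Longrightarrow>
      \<exists>u'. E u u' \<and> count_list u' x = count_list u x - 1 \<and> (\<forall>y. y \<noteq> x \<longrightarrow> count_list u' y = count_list u y)"
  shows "\<exists>u'. E u u' \<and> norm u'"
proof -
  have one: "\<exists>u'. E u u' \<and> count_list u' x = 3 \<and> (\<forall>y. y \<noteq> x \<longrightarrow> count_list u' y = count_list u y)"
    if "count_list u x \<ge> 3" for u x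
    using that
  proof (induction "count_list u x" arbitrary: u rule: less_induct)
    case less
    show ?case
    proof (cases "count_list u x = 3")
      case True
      then show ?thesis using E_refl by blast
    next
      case False
      then obtain u' where u': "E u u'" "count_list u' x = count_list u x - 1"
        "\<forall>y. y \<noteq> x \<longrightarrow> count_list u' y = count_list u y"
        using down[of u x] less.prems by fastforce
      then have "count_list u' x < count_list u x" "count_list u' x \<ge> 3" using False less.prems by auto
      from less.hyps[OF this] show ?thesis using u' E_trans by metis
    qed
  qed
  have one': "\<exists>u'. E u u' \<and> count_list u' x = 3 \<and> (\<forall>y. y \<noteq> x \<longrightarrow> count_list u' y = count_list u y)"
    if "count_list u x \<ge> 2" for u x
    using that one[of u x] up[of u x] by (cases "count_list u x = 2") auto
  have "\<exists>u'. E u u' \<and> (\<forall>x\<in>X. count_list u' x \<in> {0, 1, 3}) \<and> (\<forall>x. x \<notin> X \<longrightarrow> count_list u' x = count_list u x)"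
    if "finite X" for X
    using that
  proof (induction X)
    case empty
    then show ?case using E_refl by auto
  next
    case (insert x X)
    then obtain u' where u': "E u u'" "\<forall>x\<in>X. count_list u' x \<in> {0, 1, 3}"
      "\<forall>x. x \<notin> X \<longrightarrow> count_list u' x = count_list u x" by auto
    show ?case
    proof (cases "count_list u' x \<ge> 2")
      case True
      then obtain u'' where u'': "E u' u''" "count_list u'' x = 3"
        "\<forall>y. y \<noteq> x \<longrightarrow> count_list u'' y = count_list u' y"
        using one' by metis
      show ?thesis
        using u' u'' insert.hyps E_trans by (intro exI[of _ u'']) (metis insert_iff)
    next
      case False
      then have "count_list u' x \<in> {0, 1, 3}" by auto
      then show ?thesis using u' by auto
    qed
  qed
  from this[of "set u"] obtain u' where u': "E u u'" "\<forall>x\<in>set u. count_list u' x \<in> {0, 1, 3}"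
    "\<forall>x. x \<notin> set u \<longrightarrow> count_list u' x = count_list u x" by auto
  have "norm u'" unfolding norm_def
  proof
    fix x show "count_list u' x \<in> {0, 1, 3}" using u' by (cases "x \<in> set u") auto
  qed
  then show ?thesis using u' by blast
qed

section \<open>Consequences of the common identities\<close>

text \<open>The common identities with letters for x, y and arbitrary words for the t, together with
  x^2yty = xyxty as \<open>id5\<close>. All of them follow from each of the five systems treated
  below.\<close>

locale base =
  fixes E :: "word \<Rightarrow> word \<Rightarrow> bool" (infix "\<doteq>" 50)
  assumes E_refl: "u \<doteq> u" and E_sym: "u \<doteq> v \<Longrightarrow> v \<doteq> u" and E_trans: "u \<doteq> v \<Longrightarrow> v \<doteq> w \<Longrightarrow> u \<doteq> w"
    and id1: "p @ [x] @ T @ [x] @ q \<doteq> p @ [x] @ T @ [x, x] @ q"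
    and id2: "p @ [x, x, y, y] @ q \<doteq> p @ [y, y, x, x] @ q"
    and id3: "p @ [x, y] @ T @ [x, y] @ q \<doteq> p @ [y, x] @ T @ [x, y] @ q"
    and id4: "p @ [x] @ T1 @ [x] @ T2 @ T3 @ [x] @ q \<doteq> p @ [x] @ T1 @ [x] @ T2 @ [x] @ T3 @ [x] @ q"
    and id5: "p @ [x, x, y] @ T @ [y] @ q \<doteq> p @ [x, y, x] @ T @ [y] @ q"
begin

declare E_trans [trans]

lemma dup:
  assumes "x \<in> set p"
  shows "p @ [x] @ q \<doteq> p @ [x, x] @ q"
proof -
  obtain p1 p2 where "p = p1 @ [x] @ p2" using count_list_conv_split[OF assms] by blast
  then show ?thesis using id1[of p1 x p2 q] by simp
qed

text \<open>Non-first occurrences can be doubled, and then x^2y^2 = y^2x^2 applies.\<close>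

lemma nn_swap:
  assumes "x \<in> set p" "y \<in> set p"
  shows "p @ [x, y] @ q \<doteq> p @ [y, x] @ q"
proof -
  have *: "p @ [x, y] @ q \<doteq> p @ [x, x, y, y] @ q" if "x \<in> set p" "y \<in> set p" for x y
  proof -
    have "p @ [x] @ ([y] @ q) \<doteq> p @ [x, x] @ ([y] @ q)" using that by (intro dup)
    moreover have "(p @ [x, x]) @ [y] @ q \<doteq> (p @ [x, x]) @ [y, y] @ q" using that by (intro dup) simp
    ultimately show ?thesis using E_trans by simp
  qed
  show ?thesis
    using *[OF assms] *[OF assms(2,1)] id2[of p x y q] E_trans E_sym by meson
qed

lemma ins4:
  assumes "count_list p x \<ge> 2" "x \<in> set q"
  shows "p @ q \<doteq> p @ [x] @ q"
proof -
  obtain p1 p2 p3 where "p = p1 @ [x] @ p2 @ [x] @ p3" using count_ge2_split[OF assms(1)] by blast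
  moreover obtain q1 q2 where "q = q1 @ [x] @ q2" using count_list_conv_split[OF assms(2)] by blast
  ultimately show ?thesis using id4[of p1 x p2 p3 q1 q2] by simp
qed

text \<open>After doubling \<open>x\<close>, one copy crosses \<open>c\<close>: by
  \<open>nn_swap\<close> if \<open>c\<close> has occurred before, by \<open>id5\<close> if it only
  occurs later.\<close>

lemma ins_mult:
  assumes "x \<in> set p" "c \<in> set p \<or> c \<in> set q"
  shows "p @ [x, c] @ q \<doteq> p @ [x, c, x] @ q"
proof (cases "c \<in> set p")
  case True
  have "p @ [x] @ ([c] @ q) \<doteq> p @ [x, x] @ ([c] @ q)" using assms by (intro dup)
  moreover have "(p @ [x]) @ [x, c] @ q \<doteq> (p @ [x]) @ [c, x] @ q" using assms True by (intro nn_swap) auto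
  ultimately show ?thesis using E_trans by simp
next
  case False
  then obtain q1 q2 where q: "q = q1 @ [c] @ q2" using assms(2) count_list_conv_split by metis
  have "p @ [x] @ ([c] @ q) \<doteq> p @ [x, x] @ ([c] @ q)" using assms by (intro dup)
  then show ?thesis using E_trans id5[of p x c q1 q2] q by simp
qed

text \<open>A copy of a non-first \<open>x\<close> travels across a block of multiple letters: it is
  put behind the next letter, travels on by induction, and the intermediate copy is removed by
  \<open>ins4\<close>.\<close>

lemma INS:
  assumes "x \<in> set p" "\<And>c. c \<in> set r \<Longrightarrow> count_list (p @ [x] @ r @ q) c \<ge> 2"
  shows "p @ [x] @ r @ q \<doteq> p @ [x] @ r @ [x] @ q"
  using assms
proof (induction r arbitrary: p)
  case Nil
  then show ?case using dup[of x p q] by simp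
next
  case (Cons c r)
  have "c \<in> set p \<or> c \<in> set (r @ q) \<or> c = x"
    using Cons.prems(2)[of c] count_list_0_iff[of p c] count_list_0_iff[of "r @ q" c]
    by (auto split: if_splits)
  then have "p @ [x, c] @ (r @ q) \<doteq> p @ [x, c, x] @ (r @ q)"
    using Cons.prems(1) by (intro ins_mult) auto
  also have "(p @ [x, c]) @ [x] @ r @ q \<doteq> (p @ [x, c]) @ [x] @ r @ [x] @ q"
  proof (rule Cons.IH)
    show "count_list ((p @ [x, c]) @ [x] @ r @ q) d \<ge> 2" if "d \<in> set r" for d
      using Cons.prems(2)[of d] that by (auto split: if_splits)
  qed (use Cons.prems in simp)
  then have "p @ [x, c, x] @ (r @ q) \<doteq> (p @ [x, c]) @ [x] @ (r @ [x] @ q)" by simp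
  also have "(p @ [x, c]) @ [x] @ (r @ [x] @ q) \<doteq> (p @ [x, c]) @ (r @ [x] @ q)"
    using Cons.prems(1) count_list_0_iff[of p x] by (intro E_sym[OF ins4]) auto
  finally show ?case by simp
qed

lemma third_swap:
  assumes "count_list p x \<ge> 2" "y \<in> set p \<or> y \<in> set q"
  shows "p @ [x, y] @ q \<doteq> p @ [y, x] @ q"
proof -
  have "x \<in> set p" using assms(1) count_list_0_iff[of p x] by auto
  then have "p @ [x, y] @ q \<doteq> p @ [x] @ ([y, x] @ q)" using ins_mult[of x p y q] assms(2) by simp
  also have "p @ [x] @ ([y, x] @ q) \<doteq> p @ ([y, x] @ q)"
    using assms(1) by (intro E_sym[OF ins4]) auto
  finally show ?thesis .
qed

text \<open>Decides whether \<open>x\<close> and \<open>y\<close> can be made adjacent to the right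
  of \<open>g\<close>. The rewriting must work for all \<open>g'\<close> with the counts of
  \<open>g\<close>, because it will be applied with both orders of a pair at the end of
  \<open>g\<close> and has to yield the same tail.\<close>

lemma meet:
  assumes q: "q = q1 @ [x] @ q2 @ [y] @ q3" and y: "y \<notin> set q1" "y \<notin> set q2" and xy: "x \<noteq> y"
    and g: "x \<in> set g" and x3: "count_list (g @ q) x = 3"
  shows "(\<exists>r1 r2 a b. {a, b} = {x, y} \<and>
      (\<forall>g'. (\<forall>c. count_list g' c = count_list g c) \<longrightarrow> g' @ q \<doteq> g' @ r1 @ [a, b] @ r2)) \<or>
    (count_list g y < 2 \<and> (\<exists>s. count_list (g @ q) s = 1 \<and>
      pos (g @ q) x 2 < pos (g @ q) s 0 \<and> pos (g @ q) s 0 < pos (g @ q) y (count_list g y)))"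
proof -
  have mult: "count_list (g @ q) c \<ge> 2" if "c \<in> set q" "count_list (g @ q) c \<noteq> 1" for c
    using that count_list_0_iff[of q c] by fastforce
  consider (two) "count_list g y \<ge> 2" | (later) "x \<in> set q3" | (last) "count_list g y < 2" "x \<notin> set q3"
    by linarith
  then show ?thesis
  proof cases
    case two
    have "g' @ q \<doteq> g' @ q1 @ [y, x] @ (q2 @ [y] @ q3)" if "\<forall>c. count_list g' c = count_list g c" for g'
      using ins4[of "g' @ q1" y "[x] @ q2 @ [y] @ q3"] that two q by simp
    then show ?thesis by (intro disjI1 exI[of _ q1] exI[of _ "q2 @ [y] @ q3"] exI[of _ y] exI[of _ x]) auto
  next
    case later
    have "g' @ q \<doteq> g' @ (q1 @ [x] @ q2) @ [x, y] @ q3" if c: "\<forall>c. count_list g' c = count_list g c" for g'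
    proof -
      have "count_list g' x \<ge> 1" using c g count_list_0_iff[of g x] by (simp add: Suc_le_eq)
      then show ?thesis using ins4[of "g' @ q1 @ [x] @ q2" x "[y] @ q3"] later q by simp
    qed
    then show ?thesis by (intro disjI1 exI[of _ "q1 @ [x] @ q2"] exI[of _ q3] exI[of _ x] exI[of _ y]) auto
  next
    case last
    \<comment> \<open>The last \<open>x\<close> before \<open>y\<close>: a copy of it reaches
      \<open>y\<close> by \<open>INS\<close> unless a simple letter stands in between.\<close>
    obtain A B where AB: "q1 @ [x] @ q2 = A @ [x] @ B" "x \<notin> set B"
      using split_list_last[of x "q1 @ [x] @ q2"] by auto
    have qAB: "q = A @ [x] @ B @ [y] @ q3" using q AB(1) by (metis append.assoc)
    have "set A \<union> set B \<subseteq> set (q1 @ [x] @ q2)" using AB(1) by auto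
    then have yAB: "y \<notin> set A" "y \<notin> set B" using y xy by auto
    show ?thesis
    proof (cases "\<forall>c\<in>set B. count_list (g @ q) c \<noteq> 1")
      case True
      have "g' @ q \<doteq> g' @ (A @ [x] @ B) @ [x, y] @ q3" if c: "\<forall>c. count_list g' c = count_list g c" for g'
      proof -
        have "count_list g' x \<noteq> 0" using c g count_list_0_iff[of g x] by simp
        then have "x \<in> set (g' @ A)" using count_list_0_iff[of g' x] by auto
        moreover have "count_list ((g' @ A) @ [x] @ B @ [y] @ q3) c \<ge> 2" if "c \<in> set B" for c
          using mult[of c] True that qAB c by auto
        ultimately show ?thesis using INS[of x "g' @ A" B "[y] @ q3"] qAB by simp
      qed
      then show ?thesis
        by (intro disjI1 exI[of _ "A @ [x] @ B"] exI[of _ q3] exI[of _ x] exI[of _ y]) auto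
    next
      case False
      then obtain s B1 B2 where s: "B = B1 @ [s] @ B2" "count_list (g @ q) s = 1"
        by (metis append_Cons append_Nil split_list)
      \<comment> \<open>No \<open>x\<close> follows, so this is the third occurrence, which has
        number 2.\<close>
      have x2: "count_list (g @ A) x = 2" using x3 qAB AB(2) last(2) xy by simp
      have "pos (g @ q) x 2 = length (g @ A)"
        using pos_append[of "g @ A" x "B @ [y] @ q3"] x2 qAB by simp
      moreover have "s \<noteq> x" using s(2) x3 by auto
      then have "count_list (g @ A @ [x] @ B1) s = 0" using s qAB by (auto split: if_splits)
      then have "pos (g @ q) s 0 = length (g @ A @ [x] @ B1)"
        using pos_append[of "g @ A @ [x] @ B1" s "B2 @ [y] @ q3"] s(1) qAB by simp
      moreover have "count_list (g @ A @ [x] @ B) y = count_list g y" using yAB xy by simp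
      then have "pos (g @ q) y (count_list g y) = length (g @ A @ [x] @ B)"
        using pos_append[of "g @ A @ [x] @ B" y q3] qAB by simp
      ultimately show ?thesis using last(1) s by (intro disjI2 conjI exI[of _ s]) simp_all
    qed
  qed
qed

text \<open>If later on some occurrences of \<open>x\<close> and \<open>y\<close> can be made adjacent, then \<open>id3\<close> applies.\<close>

lemma swap_or_separated:
  fixes p q x y
  defines "u \<equiv> p @ [x, y] @ q"
  assumes xy: "x \<noteq> y" and q: "x \<in> set q" "y \<in> set q" and c3: "count_list u x = 3" "count_list u y = 3"
  shows "u \<doteq> p @ [y, x] @ q \<or>
    (count_list p y = 0 \<and> (\<exists>s. count_list u s = 1 \<and> pos u x 2 < pos u s 0 \<and> pos u s 0 < pos u y 1)) \<or>
    (count_list p x = 0 \<and> (\<exists>s. count_list u s = 1 \<and> pos u y 2 < pos u s 0 \<and> pos u s 0 < pos u x 1))"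
proof -
  \<comment> \<open>Once the two letters meet again as \<open>[a, b]\<close>, the pair on the left
    is exchanged by \<open>id3\<close>, and the rewriting of the tail is undone.\<close>
  have swap: "u \<doteq> p @ [y, x] @ q"
    if "{a, b} = {x, y}" "\<forall>g'. (\<forall>c. count_list g' c = count_list (p @ [x, y]) c) \<longrightarrow> g' @ q \<doteq> g' @ r1 @ [a, b] @ r2"
    for a b r1 r2
  proof -
    have "p @ [x, y] @ q \<doteq> p @ [x, y] @ r1 @ [a, b] @ r2" "p @ [y, x] @ q \<doteq> p @ [y, x] @ r1 @ [a, b] @ r2"
      using that(2)[rule_format, of "p @ [x, y]"] that(2)[rule_format, of "p @ [y, x]"] by simp_all
    moreover have "p @ [x, y] @ r1 @ [a, b] @ r2 \<doteq> p @ [y, x] @ r1 @ [a, b] @ r2"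
      using that(1) xy id3[of p x y r1 r2] id3[of p y x r1 r2] E_sym by (auto simp: doubleton_eq_iff)
    ultimately show ?thesis unfolding u_def using E_trans E_sym by meson
  qed
  have m: "u \<doteq> p @ [y, x] @ q \<or> (count_list p b = 0 \<and>
      (\<exists>s. count_list u s = 1 \<and> pos u a 2 < pos u s 0 \<and> pos u s 0 < pos u b 1))"
    if "{a, b} = {x, y}" "q = q1 @ [a] @ q2 @ [b] @ q3" "b \<notin> set q1" "b \<notin> set q2" for a b q1 q2 q3
  proof -
    have ab: "a \<noteq> b" "a \<in> set (p @ [x, y])" "count_list u a = 3"
        "count_list (p @ [x, y]) b = Suc (count_list p b)"
      using that(1) xy c3 by (auto simp: doubleton_eq_iff)
    have u: "u = (p @ [x, y]) @ q" by (simp add: u_def)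
    from meet[OF that(2-4) ab(1,2) ab(3)[unfolded u]] show ?thesis
    proof (elim disjE exE conjE)
      fix r1 r2 c d
      assume "{c, d} = {a, b}" "\<forall>g'. (\<forall>c. count_list g' c = count_list (p @ [x, y]) c) \<longrightarrow> g' @ q \<doteq> g' @ r1 @ [c, d] @ r2"
      then show ?thesis using swap that(1) by (intro disjI1) simp
    next
      fix s
      assume b: "count_list (p @ [x, y]) b < 2"
        and s: "count_list ((p @ [x, y]) @ q) s = 1" "pos ((p @ [x, y]) @ q) a 2 < pos ((p @ [x, y]) @ q) s 0"
          "pos ((p @ [x, y]) @ q) s 0 < pos ((p @ [x, y]) @ q) b (count_list (p @ [x, y]) b)"
      have b0: "count_list p b = 0" using b ab(4) by simp
      have "count_list (p @ [x, y]) b = 1" using b0 ab(4) by simp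
      then show ?thesis using s b0 unfolding u by (intro disjI2 conjI exI[of _ s]) simp_all
    qed
  qed
  obtain q1 q2 where q12: "q = q1 @ [y] @ q2" "y \<notin> set q1" using count_list_conv_split[OF q(2)] by blast
  show ?thesis
  proof (cases "x \<in> set q1")
    case True
    then obtain A B where "q1 = A @ [x] @ B" by (metis append_Cons append_Nil split_list)
    then show ?thesis
      using m[of x y A B q2] q12 xy c3 True by (auto simp: count_list_0_iff)
  next
    case False
    then obtain A B where "q2 = A @ [x] @ B" "x \<notin> set A"
      using q(1) q12 xy count_list_conv_split[of x q2] by auto
    then show ?thesis
      using m[of y x q1 A B] q12 xy c3 False by (auto simp: count_list_0_iff insert_commute)
  qed
qed

text \<open>The second of two occurrences is doubled; among four or more, one strictly between the
  second and the last is dropped by \<open>ins4\<close>.\<close>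

lemma normal_form: "\<exists>u'. u \<doteq> u' \<and> norm u'"
proof (rule normalise[OF E_refl E_trans])
  fix u :: word and x assume c: "count_list u x = 2"
  then obtain p1 p2 p3 where u: "u = p1 @ [x] @ p2 @ [x] @ p3" using count_ge2_split[of u x] by auto
  then have "u \<doteq> p1 @ [x] @ p2 @ [x, x] @ p3" using dup[of x "p1 @ [x] @ p2" p3] by simp
  then show "\<exists>u'. u \<doteq> u' \<and> count_list u' x = 3 \<and> (\<forall>y. y \<noteq> x \<longrightarrow> count_list u' y = count_list u y)"
    using c u by (intro exI[of _ "p1 @ [x] @ p2 @ [x, x] @ p3"]) auto
next
  fix u :: word and x assume c: "count_list u x \<ge> 4"
  then obtain p1 p2 p3 where u: "u = p1 @ [x] @ p2 @ [x] @ p3" "x \<notin> set p1" "x \<notin> set p2"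
  proof -
    have "x \<in> set u" using c count_list_0_iff[of u x] by auto
    then obtain p1 r where r: "u = p1 @ [x] @ r" "x \<notin> set p1" using count_list_conv_split by metis
    then have "x \<in> set r" using c count_list_0_iff[of r x] by auto
    then show ?thesis using r that count_list_conv_split by metis
  qed
  then have "count_list p3 x \<ge> 2" using c by simp
  then obtain p4 p5 p6 where p3: "p3 = p4 @ [x] @ p5 @ [x] @ p6" using count_ge2_split[of p3 x] by auto
  then have "u \<doteq> p1 @ [x] @ p2 @ [x] @ p4 @ p5 @ [x] @ p6"
    using E_sym[OF ins4[of "p1 @ [x] @ p2 @ [x] @ p4" x "p5 @ [x] @ p6"]] u by simp
  then show "\<exists>u'. u \<doteq> u' \<and> count_list u' x = count_list u x - 1 \<and> (\<forall>y. y \<noteq> x \<longrightarrow> count_list u' y = count_list u y)"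
    using u p3 by (intro exI[of _ "p1 @ [x] @ p2 @ [x] @ p4 @ p5 @ [x] @ p6"]) auto
qed

text \<open>\<open>R\<close> stands for being an identity of the model. Both sides are normalised
  first, so that equal counts can be enforced and occurrence numbers can be compared.\<close>

lemma complete_by_swaps:
  assumes R_E: "\<And>u v u'. R u v \<Longrightarrow> u \<doteq> u' \<Longrightarrow> R u' v" and R_sym: "\<And>u v. R u v \<Longrightarrow> R v u"
    and counts: "\<And>u v x. R u v \<Longrightarrow> norm u \<Longrightarrow> norm v \<Longrightarrow> count_list u x = count_list v x"
    and swap: "\<And>u v p x y q. u = p @ [x, y] @ q \<Longrightarrow> R u v \<Longrightarrow> norm u \<Longrightarrow> norm v \<Longrightarrow> x \<noteq> y \<Longrightarrow>
      (\<And>z. count_list u z = count_list v z) \<Longrightarrow>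
      pos v y (count_list p y) < pos v x (count_list p x) \<Longrightarrow> u \<doteq> p @ [y, x] @ q"
    and R: "R u v"
  shows "u \<doteq> v"
proof -
  obtain u' v' where uv: "u \<doteq> u'" "norm u'" "v \<doteq> v'" "norm v'" using normal_form by meson
  then have R': "R u' v'" using R R_E R_sym by meson
  have "u' \<doteq> v'"
  proof (rule sort_by_swaps[where E = E and R = "\<lambda>u. R u v'"])
    show "count_list u' x = count_list v' x" for x using counts R' uv by blast
    fix p x y q
    assume *: "R (p @ [x, y] @ q) v'" "\<And>z. count_list (p @ [x, y] @ q) z = count_list v' z" "x \<noteq> y"
      "pos v' y (count_list p y) < pos v' x (count_list p x)"
    then have "norm (p @ [x, y] @ q)" using uv(4) unfolding norm_def by simp
    then show "p @ [x, y] @ q \<doteq> p @ [y, x] @ q" using * uv(4) by (intro swap[OF refl]) auto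
  qed (use R' R_E E_refl E_trans in blast)+
  then show ?thesis using uv E_trans E_sym by meson
qed

text \<open>The adjacent occurrences for which no conclusion can be drawn from the common identities
  are two first occurrences, or a first and a second occurrence.\<close>

lemma swap_cases:
  assumes u: "u = p @ [x, y] @ q" and norm: "norm u" and xy: "x \<noteq> y"
    and counts: "\<And>z. count_list u z = count_list v z"
    and inv: "pos v y (count_list p y) < pos v x (count_list p x)"
    and simple: "\<And>s z. count_list u s = 1 \<Longrightarrow> s \<noteq> z \<Longrightarrow> z \<in> {x, y} \<Longrightarrow>
      count_list p z < count_list u z \<Longrightarrow>
      pos u z (count_list p z) < pos u s 0 \<longleftrightarrow> pos v z (count_list p z) < pos v s 0"
    and FF: "count_list p x = 0 \<Longrightarrow> count_list p y = 0 \<Longrightarrow> count_list u x = 3 \<Longrightarrow> count_list u y = 3 \<Longrightarrow>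
      u \<doteq> p @ [y, x] @ q"
    and FS: "count_list p x = 0 \<Longrightarrow> count_list p y = 1 \<Longrightarrow> count_list u x = 3 \<Longrightarrow> count_list u y = 3 \<Longrightarrow>
      u \<doteq> p @ [y, x] @ q"
    and SF: "count_list p x = 1 \<Longrightarrow> count_list p y = 0 \<Longrightarrow> count_list u x = 3 \<Longrightarrow> count_list u y = 3 \<Longrightarrow>
      u \<doteq> p @ [y, x] @ q"
  shows "u \<doteq> p @ [y, x] @ q"
proof -
  have px: "pos u x (count_list p x) = length p" using u pos_append[of p x "y # q"] by simp
  have py: "pos u y (count_list p y) = Suc (length p)" using u xy pos_append[of "p @ [x]" y q] by simp
  have lt: "count_list p x < count_list u x" "count_list p y < count_list u y" using u by simp_all
  \<comment> \<open>A simple letter keeps its place relative to the other occurrence by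
    \<open>simple\<close>, which contradicts the inversion \<open>inv\<close>.\<close>
  have "count_list u x \<noteq> 1"
  proof
    assume s: "count_list u x = 1"
    then have "count_list p x = 0" using lt by simp
    then show False using simple[OF s xy _ lt(2)] px py inv by simp
  qed
  then have x3: "count_list u x = 3" using norm u unfolding norm_def by (auto dest!: spec[of _ x])
  have "count_list u y \<noteq> 1"
  proof
    assume s: "count_list u y = 1"
    then have "count_list p y = 0" using lt by simp
    then show False using simple[OF s xy[symmetric] _ lt(1)] px py inv by simp
  qed
  then have y3: "count_list u y = 3" using norm u unfolding norm_def by (auto dest!: spec[of _ y])
  have ym: "y \<in> set p \<or> y \<in> set q" "x \<in> set p \<or> x \<in> set q"
    using x3 y3 xy u count_list_0_iff[of p y] count_list_0_iff[of q y]
      count_list_0_iff[of p x] count_list_0_iff[of q x] by auto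
  consider "count_list p x \<ge> 2" | "count_list p y \<ge> 2" | "count_list p x = 1" "count_list p y = 1"
    | "count_list p x = 0" "count_list p y = 0" | "count_list p x = 0" "count_list p y = 1"
    | "count_list p x = 1" "count_list p y = 0" by linarith
  then show ?thesis
  proof cases
    case 1 then show ?thesis using third_swap[OF 1 ym(1)] u by simp
  next
    case 2 then show ?thesis using E_sym[OF third_swap[OF 2 ym(2)]] u by simp
  next
    case 3
    then have "x \<in> set p" "y \<in> set p" using count_list_0_iff[of p x] count_list_0_iff[of p y] by auto
    then show ?thesis using nn_swap u by simp
  qed (use FF FS SF x3 y3 in blast)+
qed

end


section \<open>Testing identities by substitution\<close>

text \<open>With the conditions restricted to the letters present, \<lambda>-equivalence of concrete
  words is decided by simplification.\<close>

lemma lam_iff_set: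
  "u \<sim> v \<longleftrightarrow> remdups_adj u = remdups_adj v \<and>
    (\<forall>c\<in>set u \<union> set v. (count_list u c \<ge> 2 \<longleftrightarrow> count_list v c \<ge> 2) \<and> (fta c u \<longleftrightarrow> fta c v))"
proof -
  have n: "fta c w \<Longrightarrow> c \<in> set w" for c w by (induction w) (auto split: if_splits)
  have "mul u = mul v \<longleftrightarrow> (\<forall>c\<in>set u \<union> set v. count_list u c \<ge> 2 \<longleftrightarrow> count_list v c \<ge> 2)"
  proof -
    have "count_list w c \<ge> 2 \<Longrightarrow> c \<in> set w" for w and c :: letter
      using count_list_0_iff[of w c] by fastforce
    then show ?thesis unfolding mul_def Set.set_eq_iff mem_Collect_eq by blast
  qed
  moreover have "(\<forall>c. fta c u \<longleftrightarrow> fta c v) \<longleftrightarrow> (\<forall>c\<in>set u \<union> set v. fta c u \<longleftrightarrow> fta c v)"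
    using n by blast
  ultimately show ?thesis unfolding lam_iff by blast
qed

lemma subst_filter: "(\<And>c. c \<notin> S \<Longrightarrow> \<Phi> c = []) \<Longrightarrow> subst \<Phi> u = subst \<Phi> (filter (\<lambda>c. c \<in> S) u)"
  by (induction u) auto

lemma test:
  assumes W: "finite W" "W \<noteq> {}" and sat: "satisfies (Mw W) (u, v)"
    and 0: "\<And>c. c \<notin> S \<Longrightarrow> \<Phi> c = []" and fac: "fac W (subst \<Phi> (filter (\<lambda>c. c \<in> S) u))"
  shows "subst \<Phi> (filter (\<lambda>c. c \<in> S) u) \<sim> subst \<Phi> (filter (\<lambda>c. c \<in> S) v)"
proof -
  have "subst \<Phi> (filter (\<lambda>c. c \<in> S) w) = subst \<Phi> w" for w
    using subst_filter[of S \<Phi> w] 0 by simp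
  then show ?thesis using sat fac unfolding satisfies_Mw[OF W] by simp
qed

text \<open>Erasing all letters but \<open>x\<close> leaves a power of \<open>a\<close>, and the
  exponents 0, 1 and 3 belong to different \<lambda>-classes.\<close>

lemma counts_eq:
  assumes W: "finite W" "W \<noteq> {}" and fac: "fac W [a, a, a]" and sat: "satisfies (Mw W) (u, v)"
    and norm: "norm u" "norm v"
  shows "count_list u x = count_list v x"
proof -
  define \<Phi> where "\<Phi> = (\<lambda>c::letter. if c = x then [a] else [])"
  have s: "subst \<Phi> w = replicate (count_list w x) a" for w
    by (induction w) (auto simp: \<Phi>_def)
  have "fac W ([] @ [] @ [a, a, a])" "fac W ([] @ [a] @ [a, a])" using fac by simp_all
  then have "fac W []" "fac W [a]" by (blast dest: fac_append)+
  moreover have c: "count_list w x \<in> {0, 1, 3}" if "norm w" for w using that by (simp add: norm_def)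
  ultimately have "fac W (subst \<Phi> u)" using c[OF norm(1)] fac by (auto simp: s numeral_3_eq_3)
  then have "subst \<Phi> u \<sim> subst \<Phi> v" using sat unfolding satisfies_Mw[OF W] by blast
  then show ?thesis using c[OF norm(1)] c[OF norm(2)] unfolding s lam_iff_set
    by (auto simp: numeral_3_eq_3)
qed

section \<open>Occurrences before a simple letter\<close>

definition before :: "word \<Rightarrow> letter \<Rightarrow> letter \<Rightarrow> nat" where
  "before u x s = count_list (takeWhile (\<lambda>c. c \<noteq> s) u) x"

lemma split_once:
  assumes "count_list u s = 1"
  obtains A B where "u = A @ [s] @ B" "s \<notin> set A" "s \<notin> set B" "takeWhile (\<lambda>c. c \<noteq> s) u = A"
proof -
  have "s \<in> set u" using assms count_list_0_iff[of u s] by auto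
  then obtain A B where u: "u = A @ [s] @ B" "s \<notin> set A" using count_list_conv_split by metis
  then have "s \<notin> set B" using assms by (auto simp: count_list_0_iff)
  moreover have "\<forall>c\<in>set A. c \<noteq> s" using u by auto
  then have "takeWhile (\<lambda>c. c \<noteq> s) u = A" using u(1) by simp
  ultimately show ?thesis using u that by blast
qed

lemma pos_before:
  assumes "count_list u s = 1" "s \<noteq> x" "i < count_list u x"
  shows "pos u x i < pos u s 0 \<longleftrightarrow> i < before u x s"
proof -
  obtain A B where u: "u = A @ [s] @ B" "s \<notin> set A" "takeWhile (\<lambda>c. c \<noteq> s) u = A"
    using split_once[OF assms(1)] by metis
  have "pos u s 0 = length A" using pos_append[of A s B] u by (simp add: count_list_0_iff)
  then show ?thesis using pos_less_length_iff[of i A "[s] @ B" x] assms(3) u unfolding before_def by simp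
qed

definition pow :: "nat \<Rightarrow> word \<Rightarrow> word" where
  "pow n X = concat (replicate n X)"

definition around :: "nat \<Rightarrow> nat \<Rightarrow> word \<Rightarrow> word \<Rightarrow> word" where
  "around n k X Y = pow k X @ Y @ pow (n - k) X"

text \<open>Identities of \<open>M\<^sub>\<lambda>(W)\<close> preserve the number \<open>k\<close> of those occurrences among the \<open>n\<close>
  occurrences of a letter that precede a given simple letter.\<close>

definition isolates :: "word set \<Rightarrow> nat \<Rightarrow> nat \<Rightarrow> bool" where
  "isolates W n k \<longleftrightarrow> (\<exists>X Y. fac W (around n k X Y) \<and>
    (\<forall>l\<le>n. l \<noteq> k \<longrightarrow> \<not> around n k X Y \<sim> around n l X Y))"

text \<open>Mapping \<open>x\<close> to \<open>X\<close>, \<open>s\<close> to \<open>Y\<close> and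
  all other letters to the empty word turns each side into \<open>around n k X Y\<close>, where
  \<open>k\<close> counts the \<open>x\<close> before \<open>s\<close>.\<close>

lemma isolates_before:
  assumes W: "finite W" "W \<noteq> {}" and sat: "satisfies (Mw W) (u, v)"
    and s: "count_list u s = 1" "count_list v s = 1" "s \<noteq> x" and x: "count_list u x = n" "count_list v x = n"
    and iso: "isolates W n (before u x s)"
  shows "before v x s = before u x s"
proof (rule ccontr)
  assume ne: "before v x s \<noteq> before u x s"
  obtain X Y where XY: "fac W (around n (before u x s) X Y)"
    "\<And>l. l \<le> n \<Longrightarrow> l \<noteq> before u x s \<Longrightarrow> \<not> around n (before u x s) X Y \<sim> around n l X Y"
    using iso unfolding isolates_def by blast
  define \<Phi> where "\<Phi> = (\<lambda>c. if c = x then X else if c = s then Y else [])"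
  have *: "subst \<Phi> w = around n (before w x s) X Y \<and> before w x s \<le> n"
    if w1: "count_list w s = 1" "count_list w x = n" for w
  proof -
    obtain A B where w: "w = A @ [s] @ B" "s \<notin> set A" "s \<notin> set B" "takeWhile (\<lambda>c. c \<noteq> s) w = A"
      using split_once[OF w1(1)] by blast
    have p: "subst \<Phi> A = pow (count_list A x) X" if "s \<notin> set A" for A
      using that by (induction A) (auto simp: \<Phi>_def pow_def)
    have "before w x s = count_list A x" using w(4) by (simp add: before_def)
    moreover have "count_list B x = n - count_list A x" using w1(2) w s by auto
    ultimately show ?thesis using w p[of A] p[of B] w1 s by (auto simp: around_def \<Phi>_def)
  qed
  have "fac W (subst \<Phi> u)" using * s x XY by simp
  then have "subst \<Phi> u \<sim> subst \<Phi> v" using sat unfolding satisfies_Mw[OF W] by blast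
  then show False using XY(2)[of "before v x s"] ne * s x by simp
qed

text \<open>It suffices that of two values on different sides of the threshold \<open>i\<close> one
  is isolated. This weak form is what makes the lemma applicable to \<open>F\<close> and to the dual
  of \<open>E\<close>, for which only some of the values are shown to be isolated.\<close>

lemma simple_order:
  assumes W: "finite W" "W \<noteq> {}" and sat: "satisfies (Mw W) (u, v)"
    and counts: "\<And>z. count_list u z = count_list v z"
    and s: "count_list u s = 1" "s \<noteq> x" and i: "i < count_list u x"
    and iso: "\<And>k l. k \<le> i \<Longrightarrow> i < l \<Longrightarrow> l \<le> count_list u x \<Longrightarrow>
      isolates W (count_list u x) k \<or> isolates W (count_list u x) l"
  shows "pos u x i < pos u s 0 \<longleftrightarrow> pos v x i < pos v s 0"
proof -
  let ?k = "before u x s" and ?l = "before v x s"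
  have le: "before w x s \<le> count_list w x" for w
  proof -
    have "count_list w x = count_list (takeWhile (\<lambda>c. c \<noteq> s) w @ dropWhile (\<lambda>c. c \<noteq> s) w) x" by simp
    then show ?thesis unfolding before_def count_list_append by linarith
  qed
  have "i < ?k \<longleftrightarrow> i < ?l"
  proof (rule ccontr)
    assume *: "\<not> (i < ?k \<longleftrightarrow> i < ?l)"
    have "isolates W (count_list u x) ?k \<or> isolates W (count_list u x) ?l"
      using * iso[of ?k ?l] iso[of ?l ?k] le[of u] le[of v] counts[of x] by (auto simp: not_less)
    then have "?k = ?l"
      using isolates_before[OF W sat] isolates_before[OF W satisfies_sym[OF sat]] s counts by metis
    then show False using * by simp
  qed
  then show ?thesis using pos_before[of u s x i] pos_before[of v s x i] s i counts by simp
qed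

text \<open>Pulls the order of letters in a projection back to positions in the whole word.\<close>

lemma filter_split_pos:
  assumes "filter (\<lambda>c. c \<in> S) v = A @ [x] @ B" "y \<in> S" "x \<noteq> y" "count_list A y \<le> j" "j < count_list v y"
  shows "pos v x (count_list A x) < pos v y j"
proof -
  have "\<exists>C D. v = C @ x # D \<and> A = filter (\<lambda>c. c \<in> S) C \<and> x \<in> S"
    using assms(1)
  proof (induction A arbitrary: v)
    case Nil
    then show ?case by (auto dest!: filter_eq_ConsD)
  next
    case (Cons d A)
    then have "filter (\<lambda>c. c \<in> S) v = d # (A @ [x] @ B)" by simp
    then obtain us vs where us: "v = us @ d # vs" "\<forall>c\<in>set us. c \<notin> S" "d \<in> S"
      "A @ [x] @ B = filter (\<lambda>c. c \<in> S) vs" by (metis filter_eq_ConsD)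
    from Cons.IH[OF us(4)[symmetric]] obtain C D where "vs = C @ x # D" "A = filter (\<lambda>c. c \<in> S) C" "x \<in> S"
      by blast
    then show ?case using us by (intro exI[of _ "us @ d # C"] exI[of _ D]) auto
  qed
  then obtain C D where v: "v = C @ x # D" "A = filter (\<lambda>c. c \<in> S) C" "x \<in> S" by blast
  have cnt: "count_list (filter (\<lambda>c. c \<in> S) C) z = count_list C z" if "z \<in> S" for z
    using that by (induction C) auto
  have "pos v x (count_list A x) = length C" using pos_append[of C x D] v cnt by simp
  moreover have "\<not> pos v y j < length C"
    using pos_less_length_iff[of j C "x # D" y] v cnt[OF assms(2)] assms(4,5) by simp
  moreover have "pos v y j \<noteq> length C"
    using pos_inj[of j v y "count_list A x" x] calculation(1) assms(3,5) v cnt by auto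
  ultimately show ?thesis by simp
qed

lemma fac1I: "p @ x @ q \<sim> w \<Longrightarrow> fac {w} x"
  unfolding fac_def by blast

lemma less_3_iff: "i < (3::nat) \<longleftrightarrow> i = 0 \<or> i = 1 \<or> i = 2"
  by auto

section \<open>Orders detected by the factors \<open>b a\<^sup>+ s b\<^sup>+\<close>, \<open>a b t a\<^sup>+ s b\<^sup>+\<close> and \<open>a t b a\<^sup>+ s b\<^sup>+\<close>\<close>

text \<open>Setting for transferring an order of occurrences from \<open>u\<close> to
  \<open>v\<close>: suitable projections of \<open>u\<close> are mapped onto nonzero factors, whose
  \<lambda>-class the image of \<open>v\<close> must share.\<close>

locale detect =
  fixes W :: "word set" and a b t s :: letter and u v :: word
  assumes distinct: "distinct [a, b, t, s]" and W: "finite W" "W \<noteq> {}"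
    and sat: "satisfies (Mw W) (u, v)" and counts: "\<And>z. count_list u z = count_list v z"
begin

text \<open>The first letter of a word is a \<lambda>-invariant, and \<open>x\<close> is the only
  letter of \<open>S\<close> mapped to \<open>a0\<close>; hence the projection of \<open>v\<close>
  starts with \<open>x\<close>, too.\<close>

lemma first_letter:
  assumes fac: "fac W (subst \<Phi> (filter (\<lambda>c. c \<in> S) u))" and 0: "\<And>c. c \<notin> S \<Longrightarrow> \<Phi> c = []"
    and inj: "\<And>c. c \<in> S \<Longrightarrow> \<exists>d. \<Phi> c = [d] \<and> (d = a0 \<longrightarrow> c = x)"
    and u: "filter (\<lambda>c. c \<in> S) u = x # r" "\<Phi> x = [a0]"
    and y: "y \<in> S" "y \<noteq> x" "0 < count_list v y"
  shows "pos v x 0 < pos v y 0"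
proof -
  have l: "subst \<Phi> (filter (\<lambda>c. c \<in> S) u) \<sim> subst \<Phi> (filter (\<lambda>c. c \<in> S) v)"
    by (rule test[OF W sat 0 fac])
  obtain f F where F: "filter (\<lambda>c. c \<in> S) v = f # F"
    using y by (metis (mono_tags) count_notin filter_empty_conv neq_Nil_conv less_irrefl)
  then have "f \<in> S" by (metis (mono_tags) Cons_eq_filterD)
  then obtain d where d: "\<Phi> f = [d]" "d = a0 \<longrightarrow> f = x" using inj by blast
  have "hd (remdups_adj (subst \<Phi> (filter (\<lambda>c. c \<in> S) u))) = hd (remdups_adj (subst \<Phi> (filter (\<lambda>c. c \<in> S) v)))"
    using l unfolding lam_iff by simp
  then have "a0 = d" unfolding u(1) F using u(2) d by simp
  then show ?thesis using filter_split_pos[of S v "[]" x F y 0] F d y by simp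
qed

text \<open>The projection of \<open>u\<close> is y x x x z y y, mapped onto b a a a s b b.\<close>

lemma pattern_I:
  assumes fac: "fac W [b, a, a, a, s, b, b]"
    and x: "count_list u x = 3" and y: "count_list u y = 3" and z: "count_list u z = 1" and xy: "x \<noteq> y"
    and o: "pos u y 0 < pos u x 0" "pos u x 2 < pos u z 0" "pos u z 0 < pos u y 1"
  shows "pos v y 0 < pos v x 0"
proof -
  have d: "z \<noteq> x" "z \<noteq> y" using x y z by auto
  have m: "pos u x 0 < pos u x 1" "pos u x 1 < pos u x 2" "pos u y 1 < pos u y 2"
    using x y by (auto intro: pos_mono)
  have "filter (\<lambda>c. c \<in> {x, y, z}) u = map fst [(y, 0::nat), (x, 0), (x, 1), (x, 2), (z, 0), (y, 1), (y, 2)]" (is "_ = map fst ?xs")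
  proof (rule filter_eq_pattern)
    show "set ?xs = {(c, i). c \<in> {x, y, z} \<and> i < count_list u c}"
      using x y z by (auto simp: less_3_iff split: if_splits)
  qed (use o m in simp)
  then have F: "filter (\<lambda>c. c \<in> {x, y, z}) u = [y, x, x, x, z, y, y]" by simp
  define \<Phi> where "\<Phi> = (\<lambda>c. if c = x then [a] else if c = y then [b] else if c = z then [s] else [])"
  show ?thesis
  proof (rule first_letter[of \<Phi> "{x, y, z}" b])
    show "fac W (subst \<Phi> (filter (\<lambda>c. c \<in> {x, y, z}) u))" unfolding F using fac d xy by (simp add: \<Phi>_def)
    show "\<exists>da. \<Phi> c = [da] \<and> (da = b \<longrightarrow> c = y)" if "c \<in> {x, y, z}" for c
      using that distinct by (auto simp: \<Phi>_def)
  qed (use F d xy x counts in \<open>auto simp: \<Phi>_def\<close>)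
qed

text \<open>The projection of \<open>u\<close> is x y z' x x z y y. In contrast to
  \<open>pattern_I\<close>, a further simple letter z' has to separate the first y from the second
  x.\<close>

lemma pattern_H:
  assumes fac: "fac W [a, b, t, a, a, s, b, b]"
    and x: "count_list u x = 3" and y: "count_list u y = 3" and z: "count_list u z = 1" "count_list u z' = 1"
    and xy: "x \<noteq> y"
    and o: "pos u x 0 < pos u y 0" "pos u y 0 < pos u z' 0" "pos u z' 0 < pos u x 1"
      "pos u x 2 < pos u z 0" "pos u z 0 < pos u y 1"
  shows "pos v x 0 < pos v y 0"
proof -
  have m: "pos u x 1 < pos u x 2" "pos u y 1 < pos u y 2"
    using x y by (auto intro: pos_mono)
  have d: "z \<noteq> x" "z \<noteq> y" "z' \<noteq> x" "z' \<noteq> y" "z \<noteq> z'" using x y z o m by auto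
  have "filter (\<lambda>c. c \<in> {x, y, z, z'}) u =
      map fst [(x, 0::nat), (y, 0), (z', 0), (x, 1), (x, 2), (z, 0), (y, 1), (y, 2)]" (is "_ = map fst ?xs")
  proof (rule filter_eq_pattern)
    show "set ?xs = {(c, i). c \<in> {x, y, z, z'} \<and> i < count_list u c}"
      using x y z by (auto simp: less_3_iff split: if_splits)
  qed (use o m in simp)
  then have F: "filter (\<lambda>c. c \<in> {x, y, z, z'}) u = [x, y, z', x, x, z, y, y]" by simp
  define \<Phi> where "\<Phi> = (\<lambda>c. if c = x then [a] else if c = y then [b] else if c = z then [s]
    else if c = z' then [t] else [])"
  show ?thesis
  proof (rule first_letter[of \<Phi> "{x, y, z, z'}" a])
    show "fac W (subst \<Phi> (filter (\<lambda>c. c \<in> {x, y, z, z'}) u))" unfolding F using fac d xy by (simp add: \<Phi>_def)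
    show "\<exists>da. \<Phi> c = [da] \<and> (da = a \<longrightarrow> c = x)" if "c \<in> {x, y, z, z'}" for c
      using that distinct by (auto simp: \<Phi>_def)
  qed (use F d xy y counts in \<open>auto simp: \<Phi>_def\<close>)
qed

text \<open>The projection of \<open>u\<close> is y z' x y y z x x. The order in question is that of
  a first and a second occurrence, so the first letter of the image alone does not decide
  it.\<close>

lemma pattern_J:
  assumes fac: "fac W [a, t, b, a, a, s, b, b]"
    and x: "count_list u x = 3" and y: "count_list u y = 3" and z: "count_list u z = 1" "count_list u z' = 1"
    and xy: "x \<noteq> y"
    and o: "pos u y 0 < pos u z' 0" "pos u z' 0 < pos u x 0" "pos u x 0 < pos u y 1"
      "pos u y 2 < pos u z 0" "pos u z 0 < pos u x 1"
  shows "pos v x 0 < pos v y 1"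
proof -
  have m: "pos u x 1 < pos u x 2" "pos u y 1 < pos u y 2"
    using x y by (auto intro: pos_mono)
  have d: "z \<noteq> x" "z \<noteq> y" "z' \<noteq> x" "z' \<noteq> y" "z \<noteq> z'" using x y z o m by auto
  define S where "S = {x, y, z, z'}"
  have "filter (\<lambda>c. c \<in> S) u = map fst [(y, 0::nat), (z', 0), (x, 0), (y, 1), (y, 2), (z, 0), (x, 1), (x, 2)]" (is "_ = map fst ?xs")
  proof (rule filter_eq_pattern)
    show "set ?xs = {(c, i). c \<in> S \<and> i < count_list u c}"
      using x y z by (auto simp: S_def less_3_iff split: if_splits)
  qed (use o m in simp)
  then have F: "filter (\<lambda>c. c \<in> S) u = [y, z', x, y, y, z, x, x]" by simp
  define \<Phi> where "\<Phi> = (\<lambda>c. if c = x then [b] else if c = y then [a] else if c = z then [s]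
    else if c = z' then [t] else [])"
  have e: "subst \<Phi> (filter (\<lambda>c. c \<in> S) u) = [a, t, b, a, a, s, b, b]"
    unfolding F using d xy by (simp add: \<Phi>_def)
  define G where "G = filter (\<lambda>c. c \<in> S) v"
  have l: "[a, t, b, a, a, s, b, b] \<sim> subst \<Phi> G"
    using test[OF W sat, of S \<Phi>] fac unfolding e G_def by (auto simp: \<Phi>_def S_def)
  then have "fta a [a, t, b, a, a, s, b, b] \<longleftrightarrow> fta a (subst \<Phi> G)"
    and "remdups_adj [a, t, b, a, a, s, b, b] = remdups_adj (subst \<Phi> G)"
    unfolding lam_iff by blast+
  then have r: "remdups_adj (subst \<Phi> G) = [a, t, b, a, s, b]" and nf: "\<not> fta a (subst \<Phi> G)"
    using distinct by auto
  have GS: "set G \<subseteq> S" by (auto simp: G_def)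
  have "count_list (filter (\<lambda>c. c \<in> S) w) z' = count_list w z'" for w
    by (induction w) (auto simp: S_def)
  then have zG: "count_list G z' = 1" using z(2) counts by (simp add: G_def)
  \<comment> \<open>A second y at the start would make the first two a adjacent, a second z' is
    excluded by its count, and then the collapse requires the image of x.\<close>
  have "\<exists>H. G = [y, z', x] @ H"
  proof (cases G)
    case Nil
    then show ?thesis using r by simp
  next
    case (Cons f1 G1)
    have f: "f1 = y" using Cons r GS distinct d xy by (auto simp: S_def \<Phi>_def remdups_adj_Cons split: list.splits if_splits)
    show ?thesis
    proof (cases G1)
      case Nil
      then show ?thesis using r f Cons xy by (simp add: \<Phi>_def)
    next
      case Cons2: (Cons f2 G2)
      have f2: "f2 = z'"
        using Cons Cons2 f r nf GS distinct d xy
        by (auto simp: S_def \<Phi>_def remdups_adj_Cons split: list.splits if_splits)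
      show ?thesis
      proof (cases G2)
        case Nil
        then show ?thesis using r f f2 Cons Cons2 xy d distinct by (simp add: \<Phi>_def)
      next
        case Cons3: (Cons f3 G3)
        have "f3 = x"
          using Cons Cons2 Cons3 f f2 r GS distinct d xy zG
          by (auto simp: S_def \<Phi>_def remdups_adj_Cons split: list.splits if_splits)
        then show ?thesis using Cons Cons2 Cons3 f f2 by simp
      qed
    qed
  qed
  then obtain H where "filter (\<lambda>c. c \<in> S) v = [y, z'] @ [x] @ H" by (auto simp: G_def)
  from filter_split_pos[OF this, of y 1] show ?thesis
    using xy d y counts by (simp add: S_def)
qed

end


section \<open>Completeness of the identities\<close>

text \<open>Enough to fix the number of occurrences before a simple letter: for three occurrences
  the value 2 is what remains when 0, 1 and 3 are isolated, and for one occurrence the value 1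
  decides.\<close>

definition full_iso :: "word set \<Rightarrow> bool" where
  "full_iso W \<longleftrightarrow> isolates W 1 1 \<and> isolates W 3 0 \<and> isolates W 3 1 \<and> isolates W 3 3"

locale base_model = base E for E :: "word \<Rightarrow> word \<Rightarrow> bool" (infix "\<doteq>" 50) +
  fixes W :: "word set" and a b t s :: letter
  assumes distinct: "distinct [a, b, t, s]" and W: "finite W" "W \<noteq> {}" and aaa: "fac W [a, a, a]"
    and sound: "u \<doteq> v \<Longrightarrow> satisfies (Mw W) (u, v)"
begin

lemma bridge: "u \<doteq> u' \<Longrightarrow> u' \<doteq> v' \<Longrightarrow> v \<doteq> v' \<Longrightarrow> u \<doteq> v"
  using E_trans E_sym by blast

lemma complete:
  assumes "\<And>u v p x y q. u = p @ [x, y] @ q \<Longrightarrow> satisfies (Mw W) (u, v) \<Longrightarrow> norm u \<Longrightarrow> norm v \<Longrightarrow>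
      x \<noteq> y \<Longrightarrow> (\<And>z. count_list u z = count_list v z) \<Longrightarrow>
      pos v y (count_list p y) < pos v x (count_list p x) \<Longrightarrow> u \<doteq> p @ [y, x] @ q"
    and "satisfies (Mw W) (u, v)"
  shows "u \<doteq> v"
proof (rule complete_by_swaps[of "\<lambda>u v. satisfies (Mw W) (u, v)"])
  show "satisfies (Mw W) (u', v)" if "satisfies (Mw W) (u, v)" "u \<doteq> u'" for u v u'
    using that sound satisfies_sym satisfies_trans by blast
  show "count_list u x = count_list v x" if "satisfies (Mw W) (u, v)" "norm u" "norm v" for u v x
    by (rule counts_eq[OF W aaa that])
qed (use assms satisfies_sym in blast)+

end

text \<open>An adjacent pair of \<open>u\<close> whose order is reversed in \<open>v\<close>. Since
  a pattern may show up on either side, \<open>detect\<close> is interpreted in both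
  directions.\<close>

locale pair = base_model +
  fixes u v p q :: word and x y :: letter
  assumes u: "u = p @ [x, y] @ q" and sat: "satisfies (Mw W) (u, v)" and xy: "x \<noteq> y"
    and norm: "norm u" and counts: "\<And>z. count_list u z = count_list v z"
    and inv: "pos v y (count_list p y) < pos v x (count_list p x)"
begin

sublocale uv: detect W a b t s u v
  using distinct W sat counts by unfold_locales
sublocale vu: detect W a b t s v u
  using distinct W satisfies_sym[OF sat] counts by unfold_locales auto

lemma pos_x: "pos u x (count_list p x) = length p"
  using u pos_append[of p x "y # q"] by simp

lemma pos_y: "pos u y (count_list p y) = Suc (length p)"
  using u xy pos_append[of "p @ [x]" y q] by simp

lemma order:
  assumes "full_iso W" "count_list u z = 1" "z \<noteq> c" "i < count_list u c"
  shows "pos u c i < pos u z 0 \<longleftrightarrow> pos v c i < pos v z 0"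
    and "pos u z 0 < pos u c i \<longleftrightarrow> pos v z 0 < pos v c i"
proof -
  have "count_list u c \<in> {0, 1, 3}" using norm by (simp add: norm_def)
  then have n: "count_list u c = 1 \<or> count_list u c = 3" using assms(4) by auto
  have "isolates W (count_list u c) k \<or> isolates W (count_list u c) l"
    if "k \<le> i" "i < l" "l \<le> count_list u c" for k l
  proof (cases "count_list u c = 1")
    case True
    then have "l = 1" using that by simp
    then show ?thesis using True assms(1) by (simp add: full_iso_def)
  next
    case False
    then have "count_list u c = 3" using n by simp
    moreover have "k = 0 \<or> k = 1 \<or> l = 3" using that calculation by auto
    ultimately show ?thesis using assms(1) by (auto simp: full_iso_def)
  qed
  then show *: "pos u c i < pos u z 0 \<longleftrightarrow> pos v c i < pos v z 0"
    by (intro simple_order[OF W sat counts assms(2,3,4)])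
  have "pos u c i \<noteq> pos u z 0" using pos_inj[of i u c 0 z] assms by auto
  moreover have "pos v c i \<noteq> pos v z 0" using pos_inj[of i v c 0 z] assms counts by auto
  ultimately show "pos u z 0 < pos u c i \<longleftrightarrow> pos v z 0 < pos v c i" using * by linarith
qed

lemma later_occurrences:
  assumes "count_list u x = 3" "count_list u y = 3" "count_list p x \<le> 1" "count_list p y \<le> 1"
  shows "x \<in> set q" "y \<in> set q"
  using assms u xy count_list_0_iff[of q x] count_list_0_iff[of q y] by auto

text \<open>Each kind of separation yields the pattern b a^+ s b^+. If the x lie inside, it is read
  in \<open>v\<close>, where y comes first; if the y lie inside, it is read in \<open>u\<close>,
  where x comes first. Either way both words must agree on the order, against the inversion.\<close>

lemma FF_I:
  assumes iso: "full_iso W" and fac: "fac W [b, a, a, a, s, b, b]"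
    and c: "count_list p x = 0" "count_list p y = 0" "count_list u x = 3" "count_list u y = 3"
  shows "E u (p @ [y, x] @ q)"
proof -
  have v: "count_list v x = 3" "count_list v y = 3" using c counts by auto
  have lt: "pos u x 0 < pos u y 0" "pos v y 0 < pos v x 0" using pos_x pos_y inv c by simp_all
  have False if z: "count_list u z = 1" "pos u x 2 < pos u z 0" "pos u z 0 < pos u y 1" for z
  proof -
    have n: "z \<noteq> x" "z \<noteq> y" using z c by auto
    have "count_list v z = 1" using z counts by simp
    then have "pos u y 0 < pos u x 0"
      using vu.pattern_I[OF fac v _ xy lt(2)] order[OF iso z(1)] z n c by simp
    then show False using lt by simp
  qed
  moreover have False if z: "count_list u z = 1" "pos u y 2 < pos u z 0" "pos u z 0 < pos u x 1" for z
    using uv.pattern_I[OF fac c(4,3) z(1) xy[symmetric] lt(1) z(2,3)] lt by simp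
  ultimately show ?thesis
    using swap_or_separated[OF xy later_occurrences(1) later_occurrences(2), of p] c u by auto
qed

end

text \<open>The property common to \<open>H\<close> and \<open>I\<close> which settles every
  transposition of a first and a second occurrence, leaving only pairs of first occurrences.\<close>

locale nf_model = base_model +
  assumes nf: "x \<in> set p \<Longrightarrow> y \<in> set q \<Longrightarrow> p @ [x, y] @ q \<doteq> p @ [y, x] @ q"
begin

theorem complete_I:
  assumes "full_iso W" "fac W [b, a, a, a, s, b, b]" "satisfies (Mw W) (u, v)"
  shows "u \<doteq> v"
proof (rule complete)
  fix u v p x y q
  assume *: "u = p @ [x, y] @ q" "satisfies (Mw W) (u, v)" "norm u" "norm v" "x \<noteq> y"
    "\<And>z. count_list u z = count_list v z" "pos v y (count_list p y) < pos v x (count_list p x)"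
  interpret pair E W a b t s u v p q x y
    by unfold_locales (use * in auto)
  show "u \<doteq> p @ [y, x] @ q"
  proof (rule swap_cases[OF *(1,3,5,6,7)])
    show "pos u z (count_list p z) < pos u r 0 \<longleftrightarrow> pos v z (count_list p z) < pos v r 0"
      if "count_list u r = 1" "r \<noteq> z" "count_list p z < count_list u z" for r z
      using order(1)[OF assms(1) that] .
    show "u \<doteq> p @ [y, x] @ q"
      if "count_list p x = 0" "count_list p y = 0" "count_list u x = 3" "count_list u y = 3"
      using FF_I[OF assms(1,2) that] .
    show "u \<doteq> p @ [y, x] @ q"
      if c: "count_list p x = 0" "count_list p y = 1" "count_list u x = 3" "count_list u y = 3"
    proof -
      have "y \<in> set p" using c count_list_0_iff[of p y] by auto
      then show ?thesis using E_sym[OF nf[of y p x q]] later_occurrences[OF c(3,4)] c u by simp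
    qed
    show "u \<doteq> p @ [y, x] @ q"
      if c: "count_list p x = 1" "count_list p y = 0" "count_list u x = 3" "count_list u y = 3"
    proof -
      have "x \<in> set p" using c count_list_0_iff[of p x] by auto
      then show ?thesis using nf[of x p y q] later_occurrences[OF c(3,4)] c u by simp
    qed
  qed
qed fact

end

locale H_model = nf_model +
  assumes idH: "p @ [x, y, x] @ T @ [y] @ q \<doteq> p @ [y, x, x] @ T @ [y] @ q"
begin

lemma nf':
  assumes "x \<in> set p" "y \<in> set p \<or> y \<in> set q"
  shows "p @ [x, y] @ q \<doteq> p @ [y, x] @ q"
  using assms nn_swap[of x p y q] nf[of x p y q] by (cases "y \<in> set p") auto

lemma move_right:
  assumes "x \<in> set p" "\<And>c. c \<in> set r \<Longrightarrow> count_list (p @ [x] @ r @ q) c \<ge> 2"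
  shows "p @ [x] @ r @ q \<doteq> p @ r @ [x] @ q"
  using assms
proof (induction r arbitrary: p)
  case Nil
  then show ?case by (simp add: E_refl)
next
  case (Cons c r)
  have "c \<in> set p \<or> c \<in> set (r @ q)"
    using Cons.prems(1) Cons.prems(2)[of c] count_list_0_iff[of p c] count_list_0_iff[of "r @ q" c]
    by (auto split: if_splits)
  then have "p @ [x, c] @ (r @ q) \<doteq> p @ [c, x] @ (r @ q)" using Cons.prems(1) by (intro nf')
  moreover have "(p @ [c]) @ [x] @ r @ q \<doteq> (p @ [c]) @ r @ [x] @ q"
  proof (rule Cons.IH)
    show "count_list ((p @ [c]) @ [x] @ r @ q) d \<ge> 2" if "d \<in> set r" for d
      using Cons.prems(2)[of d] that by (auto split: if_splits)
  qed (use Cons.prems in simp)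
  ultimately show ?case using E_trans by simp
qed

text \<open>The next \<open>x\<close> is pulled back across multiple letters to form xyx; there
  \<open>idH\<close> exchanges the first occurrences, and the pulled \<open>x\<close> returns to its
  place.\<close>

lemma swap_H:
  assumes m: "\<And>c. c \<in> set q1 \<Longrightarrow> count_list (p @ [x, y] @ q1 @ [x] @ q2) c \<ge> 2" and y: "y \<in> set q2"
  shows "p @ [x, y] @ q1 @ [x] @ q2 \<doteq> p @ [y, x] @ q1 @ [x] @ q2"
proof -
  have *: "g @ q1 @ [x] @ q2 \<doteq> g @ [x] @ q1 @ q2"
    if "x \<in> set g" "\<And>c. count_list g c = count_list (p @ [x, y]) c" for g
  proof (rule E_sym[OF move_right])
    show "count_list (g @ [x] @ q1 @ q2) c \<ge> 2" if "c \<in> set q1" for c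
      using m[OF that] \<open>\<And>c. count_list g c = _\<close>[of c] by (auto split: if_splits)
  qed fact
  obtain r1 r2 where "q2 = r1 @ [y] @ r2" using y count_list_conv_split by metis
  then have "p @ [x, y, x] @ (q1 @ q2) \<doteq> p @ [y, x, x] @ (q1 @ q2)"
    using idH[of p x y "q1 @ r1" r2] by simp
  then have "(p @ [x, y]) @ [x] @ q1 @ q2 \<doteq> (p @ [y, x]) @ [x] @ q1 @ q2" by simp
  from bridge[OF *[of "p @ [x, y]"] this *[of "p @ [y, x]"]] show ?thesis by simp
qed

end

lemma simple_between:
  assumes u: "u = A @ [x] @ B @ [y] @ C"
  shows "(\<forall>c\<in>set B. count_list u c \<ge> 2) \<or>
    (\<exists>z. count_list u z = 1 \<and> pos u x (count_list A x) < pos u z 0 \<and>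
      pos u z 0 < pos u y (count_list (A @ [x] @ B) y))"
proof (cases "\<forall>c\<in>set B. count_list u c \<noteq> 1")
  case True
  moreover have "count_list u c \<noteq> 0" if "c \<in> set B" for c
    using that u count_list_0_iff[of u c] by simp
  ultimately show ?thesis by (metis One_nat_def less_2_cases not_less)
next
  case False
  then obtain z B1 B2 where z: "B = B1 @ [z] @ B2" "count_list u z = 1"
    by (metis append_Cons append_Nil split_list)
  have "count_list (A @ [x] @ B1) z = 0" using z u by (auto split: if_splits)
  then have "pos u z 0 = length (A @ [x] @ B1)"
    using pos_append[of "A @ [x] @ B1" z "B2 @ [y] @ C"] z(1) u by simp
  moreover have "pos u x (count_list A x) = length A" using pos_append[of A x "B @ [y] @ C"] u by simp
  moreover have "pos u y (count_list (A @ [x] @ B) y) = length (A @ [x] @ B)"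
    using pos_append[of "A @ [x] @ B" y C] u by simp
  ultimately show ?thesis using z by (intro disjI2 exI[of _ z]) simp
qed

context H_model
begin

text \<open>As \<open>z\<close> has the earlier second occurrence, no \<open>w\<close> can precede
  it in \<open>q\<close>.\<close>

lemma next_occurrence:
  assumes u: "u = p @ [x, y] @ q" and xy: "x \<noteq> y" "{z, w} = {x, y}"
    and p: "count_list p x = 0" "count_list p y = 0" and c: "count_list u z \<ge> 2" "count_list u w \<ge> 2"
    and lt: "pos u z 1 < pos u w 1"
  obtains q1 q2 where "q = q1 @ [z] @ q2" "z \<notin> set q1" "w \<notin> set q1" "w \<in> set q2"
proof -
  have zw: "z \<noteq> w" "count_list p z = 0" "count_list p w = 0"
      "count_list [x, y] z = 1" "count_list [x, y] w = 1" using xy p by (auto simp: doubleton_eq_iff)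
  have cu: "count_list u d = count_list p d + count_list [x, y] d + count_list q d" for d
    unfolding u count_list_append by simp
  then have "count_list q z \<noteq> 0" using c(1) zw cu[of z] by linarith
  then have "z \<in> set q" by (metis count_list_0_iff)
  then obtain q1 q2 where q: "q = q1 @ [z] @ q2" "z \<notin> set q1" using count_list_conv_split by metis
  have u': "u = (p @ [x, y] @ q1) @ z # q2" using u q by simp
  have "count_list (p @ [x, y] @ q1) z = 1"
    unfolding count_list_append using zw count_notin[OF q(2)] by linarith
  then have "pos u z 1 = length (p @ [x, y] @ q1)" using pos_append[of "p @ [x, y] @ q1" z q2] u' by metis
  then have "\<not> 1 < count_list (p @ [x, y] @ q1) w"
    using pos_less_length_iff[of 1 "p @ [x, y] @ q1" "z # q2" w] lt c(2) u' by auto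
  then have q1: "count_list q1 w = 0" using zw by (simp only: count_list_append)
  moreover have "count_list q w = count_list q1 w + count_list q2 w" using q zw by simp
  ultimately have "count_list q2 w \<noteq> 0" using c(2) cu[of w] zw by linarith
  then show ?thesis using q q1 that by (metis count_list_0_iff)
qed

text \<open>Two first occurrences resist exchange only if two obstacles coincide: a simple letter
  that prevents the use of \<open>id3\<close>, and another one that prevents \<open>swap_H\<close>.
  Together they form the pattern abta^+sb^+.\<close>

theorem complete_H:
  assumes iso: "full_iso W" and fac: "fac W [a, b, t, a, a, s, b, b]" and sat: "satisfies (Mw W) (u, v)"
  shows "u \<doteq> v"
proof (rule complete)
  fix u v p x y q
  assume *: "u = p @ [x, y] @ q" "satisfies (Mw W) (u, v)" "norm u" "norm v" "x \<noteq> y"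
    "\<And>z. count_list u z = count_list v z" "pos v y (count_list p y) < pos v x (count_list p x)"
  interpret pair E W a b t s u v p q x y
    by unfold_locales (use * in auto)
  show "u \<doteq> p @ [y, x] @ q"
  proof (rule swap_cases[OF *(1,3,5,6,7)])
    show "pos u z (count_list p z) < pos u r 0 \<longleftrightarrow> pos v z (count_list p z) < pos v r 0"
      if "count_list u r = 1" "r \<noteq> z" "count_list p z < count_list u z" for r z
      using order(1)[OF iso that] .
    show "u \<doteq> p @ [y, x] @ q"
      if c: "count_list p x = 0" "count_list p y = 1" "count_list u x = 3" "count_list u y = 3"
    proof -
      have "y \<in> set p" using c count_list_0_iff[of p y] by auto
      then show ?thesis using E_sym[OF nf[of y p x q]] later_occurrences[OF c(3,4)] c u by simp
    qed
    show "u \<doteq> p @ [y, x] @ q"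
      if c: "count_list p x = 1" "count_list p y = 0" "count_list u x = 3" "count_list u y = 3"
    proof -
      have "x \<in> set p" using c count_list_0_iff[of p x] by auto
      then show ?thesis using nf[of x p y q] later_occurrences[OF c(3,4)] c u by simp
    qed
    show "u \<doteq> p @ [y, x] @ q"
      if c: "count_list p x = 0" "count_list p y = 0" "count_list u x = 3" "count_list u y = 3"
    proof (rule ccontr)
      assume no: "\<not> u \<doteq> p @ [y, x] @ q"
      have v: "count_list v x = 3" "count_list v y = 3" using c counts by auto
      have lt: "pos u x 0 < pos u y 0" "pos v y 0 < pos v x 0" using pos_x pos_y inv c by simp_all
      have m: "pos u x 1 < pos u x 2" "pos u y 1 < pos u y 2" using c by (auto intro: pos_mono)
      have xq: "x \<in> set q" "y \<in> set q" using later_occurrences c by auto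
      from swap_or_separated[OF xy xq, of p] no c u consider
        (x) z where "count_list u z = 1" "pos u x 2 < pos u z 0" "pos u z 0 < pos u y 1"
        | (y) z where "count_list u z = 1" "pos u y 2 < pos u z 0" "pos u z 0 < pos u x 1"
        by auto
      then show False
      proof cases
        case x
        have "pos u x 1 < pos u y 1" using x m by linarith
        then obtain q1 q2 where q: "q = q1 @ [x] @ q2" "x \<notin> set q1" "y \<notin> set q1" "y \<in> set q2"
          using next_occurrence[OF u xy, of x y] c by auto
        have u': "u = (p @ [x]) @ [y] @ q1 @ [x] @ q2" using u q by simp
        have "\<not> (\<forall>c\<in>set q1. count_list u c \<ge> 2)"
        proof
          assume "\<forall>c\<in>set q1. count_list u c \<ge> 2"
          then have "p @ [x, y] @ q1 @ [x] @ q2 \<doteq> p @ [y, x] @ q1 @ [x] @ q2"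
            using q u' by (intro swap_H) auto
          then show False using no u q by simp
        qed
        then obtain z' where z': "count_list u z' = 1" "pos u y 0 < pos u z' 0" "pos u z' 0 < pos u x 1"
          using simple_between[OF u'] c q xy by auto
        show False
          using uv.pattern_H[OF fac c(3,4) x(1) z'(1) xy lt(1) z'(2,3) x(2,3)] lt(2) by simp
      next
        case y
        have "pos u y 1 < pos u x 1" using y m by linarith
        then obtain q1 q2 where q: "q = q1 @ [y] @ q2" "y \<notin> set q1" "x \<notin> set q1" "x \<in> set q2"
          using next_occurrence[OF u xy, of y x] c by auto
        have u': "u = (p @ [x]) @ [y] @ q1 @ [y] @ q2" using u q by simp
        have "\<not> (\<forall>c\<in>set q1. count_list u c \<ge> 2)"
        proof
          assume *: "\<forall>c\<in>set q1. count_list u c \<ge> 2"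
          have "count_list (p @ [y, x] @ q1 @ [y] @ q2) c = count_list u c" for c using u' by simp
          then have "p @ [y, x] @ q1 @ [y] @ q2 \<doteq> p @ [x, y] @ q1 @ [y] @ q2"
            using * q by (intro swap_H) simp_all
          then show False using no u q E_sym by simp
        qed
        then obtain z' where z': "count_list u z' = 1" "pos u y 0 < pos u z' 0" "pos u z' 0 < pos u y 1"
          using simple_between[OF u'] c q xy by auto
        have n: "z \<noteq> x" "z \<noteq> y" "z' \<noteq> x" "z' \<noteq> y" using y z' c by auto
        \<comment> \<open>Now the pattern has to start with y, as \<open>v\<close> does; the orders
          relative to simple letters carry over from \<open>u\<close>.\<close>
        have "pos v x 0 < pos v z' 0" using order(1)[OF iso z'(1) n(3), of 0] z' lt(1) c by simp
        moreover have "pos v z' 0 < pos v y 1" using order(2)[OF iso z'(1) n(4), of 1] z' c by simp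
        moreover have "pos v y 2 < pos v z 0" using order(1)[OF iso y(1) n(2), of 2] y c by simp
        moreover have "pos v z 0 < pos v x 1" using order(2)[OF iso y(1) n(1), of 1] y c by simp
        ultimately have "pos u y 0 < pos u x 0"
          using y(1) z'(1) counts lt(2) xy v by (intro vu.pattern_H[OF fac, of y x z z']) auto
        then show False using lt by simp
      qed
    qed
  qed
qed fact

end

text \<open>The whole family w_n(\<pi>) = w'_n(\<pi>) in a single form free of permutations;
  \<open>deriv_J\<close> derives it.\<close>

locale J_model = base_model +
  assumes idJ: "set cs \<subseteq> set r \<Longrightarrow> p @ [y] @ cs @ [y] @ r \<doteq> p @ [y, y] @ cs @ r"
begin

text \<open>Several copies are put in front of \<open>q\<close>; each one travels there by
  \<open>INS\<close> from a non-first occurrence in \<open>G\<close>.\<close>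

lemma insert_list:
  assumes "\<And>z. z \<in> set zs \<Longrightarrow> \<exists>G1 G2. G = G1 @ [z] @ G2 \<and> z \<in> set G1 \<and> (\<forall>c\<in>set G2. count_list (G @ q) c \<ge> 2)"
  shows "G @ q \<doteq> G @ zs @ q"
  using assms
proof (induction zs)
  case Nil
  then show ?case by (simp add: E_refl)
next
  case (Cons z zs)
  obtain G1 G2 where G: "G = G1 @ [z] @ G2" "z \<in> set G1" "\<forall>c\<in>set G2. count_list (G @ q) c \<ge> 2"
    using Cons.prems[OF list.set_intros(1)] by blast
  have "count_list (G1 @ [z] @ G2 @ zs @ q) c \<ge> 2" if "c \<in> set G2" for c
    using G(1) G(3)[rule_format, OF that] by auto
  then have "G @ zs @ q \<doteq> G @ [z] @ zs @ q" using INS[OF G(2), of G2 "zs @ q"] G(1) by simp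
  then show ?case using Cons E_trans by simp
qed

text \<open>In both orders the second \<open>y\<close> is carried back to the preceding one by
  \<open>idJ\<close>, with the same result. Letters of \<open>p2\<close> missing in \<open>q\<close>
  must first get a later occurrence: their last occurrence in \<open>p2\<close> is not the first
  one, and a copy of it can cross the multiple letters that follow.\<close>

lemma swap_J:
  assumes m: "\<And>c. c \<in> set p2 \<Longrightarrow> count_list (p1 @ [y] @ p2 @ [x, y] @ q) c \<ge> 2"
    and x: "x \<in> set q" and y: "y \<notin> set p2" "x \<notin> set p2" and xy: "x \<noteq> y"
  shows "p1 @ [y] @ p2 @ [x, y] @ q \<doteq> p1 @ [y] @ p2 @ [y, x] @ q"
proof -
  define zs where "zs = filter (\<lambda>z. z \<notin> set q) p2"
  have ins: "(p1 @ [y] @ p2 @ e) @ q \<doteq> (p1 @ [y] @ p2 @ e) @ zs @ q" if e: "e = [x, y] \<or> e = [y, x]" for e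
  proof (rule insert_list)
    fix z assume "z \<in> set zs"
    then have z: "z \<in> set p2" "z \<notin> set q" by (auto simp: zs_def)
    then obtain A B where AB: "p2 = A @ [z] @ B" "z \<notin> set B"
      using split_list_last[of z p2] by auto
    have "z \<noteq> x" "z \<noteq> y" using z y by auto
    then have "count_list (p1 @ [y] @ A) z \<noteq> 0" using m[OF z(1)] AB z(2) by simp arith
    then have 1: "z \<in> set (p1 @ [y] @ A)" by (metis count_list_0_iff)
    have cnt: "count_list ((p1 @ [y] @ p2 @ e) @ q) c = count_list (p1 @ [y] @ p2 @ [x, y] @ q) c" for c
      using e by auto
    have "count_list ((p1 @ [y] @ p2 @ e) @ q) c \<ge> 2" if c: "c \<in> set (B @ e)" for c
    proof -
      consider "c \<in> set B" | "c = x" | "c = y" using c e by auto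
      then show ?thesis
      proof cases
        case 1
        then show ?thesis unfolding cnt using m[of c] AB by simp
      next
        case 2
        have "count_list q x \<noteq> 0" using x by (simp add: count_list_0_iff)
        then show ?thesis unfolding cnt 2 by simp
      next
        case 3
        show ?thesis unfolding cnt 3 by simp
      qed
    qed
    then show "\<exists>G1 G2. p1 @ [y] @ p2 @ e = G1 @ [z] @ G2 \<and> z \<in> set G1 \<and>
        (\<forall>c\<in>set G2. count_list ((p1 @ [y] @ p2 @ e) @ q) c \<ge> 2)"
      using AB 1 by (intro exI[of _ "p1 @ [y] @ A"] exI[of _ "B @ e"]) simp
  qed
  have "p1 @ [y] @ (p2 @ [x]) @ [y] @ (zs @ q) \<doteq> p1 @ [y, y] @ (p2 @ [x]) @ (zs @ q)"
    by (rule idJ) (use x in \<open>auto simp: zs_def\<close>)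
  then have 1: "(p1 @ [y] @ p2 @ [x, y]) @ zs @ q \<doteq> p1 @ [y, y] @ p2 @ (x # zs @ q)" by simp
  have "p1 @ [y] @ p2 @ [y] @ (x # zs @ q) \<doteq> p1 @ [y, y] @ p2 @ (x # zs @ q)"
    by (rule idJ) (auto simp: zs_def)
  then have 2: "(p1 @ [y] @ p2 @ [y, x]) @ zs @ q \<doteq> p1 @ [y, y] @ p2 @ (x # zs @ q)" by simp
  from bridge[OF ins[of "[x, y]"] bridge[OF 1 E_refl 2] ins[of "[y, x]"]] show ?thesis by simp
qed

text \<open>A first and a second occurrence resist exchange only if one simple letter prevents the
  use of \<open>id3\<close> and another one, between the first occurrence of the repeated letter and
  the pair, prevents \<open>swap_J\<close>. Together they form the pattern atba^+sb^+.\<close>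

theorem complete_J:
  assumes iso: "full_iso W" and fac: "fac W [b, a, a, a, s, b, b]" "fac W [a, t, b, a, a, s, b, b]"
    and sat: "satisfies (Mw W) (u, v)"
  shows "u \<doteq> v"
proof (rule complete)
  fix u v p x y q
  assume *: "u = p @ [x, y] @ q" "satisfies (Mw W) (u, v)" "norm u" "norm v" "x \<noteq> y"
    "\<And>z. count_list u z = count_list v z" "pos v y (count_list p y) < pos v x (count_list p x)"
  interpret pair E W a b t s u v p q x y
    by unfold_locales (use * in auto)
  show "u \<doteq> p @ [y, x] @ q"
  proof (rule swap_cases[OF *(1,3,5,6,7)])
    show "pos u z (count_list p z) < pos u r 0 \<longleftrightarrow> pos v z (count_list p z) < pos v r 0"
      if "count_list u r = 1" "r \<noteq> z" "count_list p z < count_list u z" for r z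
      using order(1)[OF iso that] .
    show "u \<doteq> p @ [y, x] @ q"
      if "count_list p x = 0" "count_list p y = 0" "count_list u x = 3" "count_list u y = 3"
      using FF_I[OF iso fac(1) that] .
    show "u \<doteq> p @ [y, x] @ q"
      if c: "count_list p x = 0" "count_list p y = 1" "count_list u x = 3" "count_list u y = 3"
    proof (rule ccontr)
      assume no: "\<not> u \<doteq> p @ [y, x] @ q"
      have xq: "x \<in> set q" "y \<in> set q" using later_occurrences c by auto
      from swap_or_separated[OF xy xq, of p] no c u obtain z where
        z: "count_list u z = 1" "pos u y 2 < pos u z 0" "pos u z 0 < pos u x 1" by auto
      have "y \<in> set p" using c count_list_0_iff[of p y] by auto
      then obtain p1 p2 where p: "p = p1 @ [y] @ p2" "y \<notin> set p1" using count_list_conv_split by metis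
      have n: "y \<notin> set p2" "x \<notin> set p2" "x \<notin> set p1" using p c xy by (auto simp: count_list_0_iff)
      have u': "u = p1 @ [y] @ p2 @ [x] @ (y # q)" using u p by simp
      have "\<not> (\<forall>c\<in>set p2. count_list u c \<ge> 2)"
      proof
        assume "\<forall>c\<in>set p2. count_list u c \<ge> 2"
        then have "p1 @ [y] @ p2 @ [x, y] @ q \<doteq> p1 @ [y] @ p2 @ [y, x] @ q"
          using xq n xy u p by (intro swap_J) auto
        then show False using no u p by simp
      qed
      then obtain z' where z': "count_list u z' = 1" "pos u y 0 < pos u z' 0" "pos u z' 0 < pos u x 0"
        using simple_between[OF u'] p n xy by auto
      have "pos u x 0 < pos u y 1" using pos_x pos_y c by simp
      then have "pos v x 0 < pos v y 1"
        using uv.pattern_J[OF fac(2) c(3,4) z(1) z'(1) xy z'(2,3) _ z(2,3)] by simp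
      then show False using inv c by simp
    qed
    show "u \<doteq> p @ [y, x] @ q"
      if c: "count_list p x = 1" "count_list p y = 0" "count_list u x = 3" "count_list u y = 3"
    proof (rule ccontr)
      assume no: "\<not> u \<doteq> p @ [y, x] @ q"
      have xq: "x \<in> set q" "y \<in> set q" using later_occurrences c by auto
      from swap_or_separated[OF xy xq, of p] no c u obtain z where
        z: "count_list u z = 1" "pos u x 2 < pos u z 0" "pos u z 0 < pos u y 1" by auto
      have "x \<in> set p" using c count_list_0_iff[of p x] by auto
      then obtain p1 p2 where p: "p = p1 @ [x] @ p2" "x \<notin> set p1" using count_list_conv_split by metis
      have n: "y \<notin> set p2" "x \<notin> set p2" "y \<notin> set p1" using p c xy by (auto simp: count_list_0_iff)
      have u': "u = p1 @ [x] @ p2 @ [x] @ (y # q)" using u p by simp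
      have "\<not> (\<forall>c\<in>set p2. count_list u c \<ge> 2)"
      proof
        assume "\<forall>c\<in>set p2. count_list u c \<ge> 2"
        then have "p1 @ [x] @ p2 @ [y, x] @ q \<doteq> p1 @ [x] @ p2 @ [x, y] @ q"
          using xq n xy u p by (intro swap_J) auto
        then show False using no u p E_sym by simp
      qed
      then obtain z' where z': "count_list u z' = 1" "pos u x 0 < pos u z' 0" "pos u z' 0 < pos u x 1"
        using simple_between[OF u'] p n xy by auto
      have lt: "pos u x 1 < pos u y 0" "pos v y 0 < pos v x 1" using pos_x pos_y c inv by simp_all
      have v: "count_list v x = 3" "count_list v y = 3" using c counts by auto
      have n: "z \<noteq> x" "z \<noteq> y" "z' \<noteq> x" "z' \<noteq> y" using z z' c by auto
      have "pos v x 0 < pos v z' 0" using order(1)[OF iso z'(1) n(3), of 0] z' c by simp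
      moreover have "pos v z' 0 < pos v y 0" using order(2)[OF iso z'(1) n(4), of 0] z' lt(1) c by simp
      moreover have "pos v x 2 < pos v z 0" using order(1)[OF iso z(1) n(1), of 2] z c by simp
      moreover have "pos v z 0 < pos v y 1" using order(2)[OF iso z(1) n(2), of 1] z c by simp
      ultimately have "pos u y 0 < pos u x 1"
        using z(1) z'(1) counts lt(2) xy v by (intro vu.pattern_J[OF fac(2), of y x z z']) auto
      then show False using lt by simp
    qed
  qed
qed fact

end

text \<open>After the second occurrence a letter can be inserted anywhere, so only the first two
  occurrences carry information.\<close>

locale F_model = base_model +
  assumes idF: "count_list p x \<ge> 2 \<Longrightarrow> p @ q \<doteq> p @ [x] @ q"
begin

text \<open>Whichever of the two letters occurs first in \<open>q\<close> can be inserted right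
  before the other one, and then \<open>id3\<close> applies.\<close>

lemma swap_F:
  assumes x: "x \<in> set p \<or> x \<in> set q" and y: "y \<in> set q" and xq: "x \<in> set q"
  shows "p @ [x, y] @ q \<doteq> p @ [y, x] @ q"
proof -
  have *: "p @ [x, y] @ q \<doteq> p @ [y, x] @ q" if "q = q1 @ [x] @ q2 @ [y] @ q3" for x y q1 q2 q3
  proof -
    have "g @ q \<doteq> g @ (q1 @ [x] @ q2) @ [x, y] @ q3" if "x \<in> set g" for g
    proof -
      have "count_list g x \<noteq> 0" using that by (simp add: count_list_0_iff)
      then show ?thesis using idF[of "g @ q1 @ [x] @ q2" x "[y] @ q3"] \<open>q = _\<close> by simp
    qed
    from this[of "p @ [x, y]"] this[of "p @ [y, x]"]
    have "p @ [x, y] @ q \<doteq> p @ [x, y] @ (q1 @ [x] @ q2) @ [x, y] @ q3"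
      "p @ [y, x] @ q \<doteq> p @ [y, x] @ (q1 @ [x] @ q2) @ [x, y] @ q3" by simp_all
    from E_trans[OF E_trans[OF this(1) id3] E_sym[OF this(2)]] show ?thesis .
  qed
  obtain q1 q2 where q: "q = q1 @ [y] @ q2" using y count_list_conv_split by metis
  show ?thesis
  proof (cases "x = y")
    case True
    then show ?thesis by (simp add: E_refl)
  next
    case False
    then consider "x \<in> set q1" | "x \<in> set q2" using xq q by auto
    then show ?thesis
    proof cases
      case 1
      then obtain A B where "q1 = A @ [x] @ B" using count_list_conv_split by metis
      then show ?thesis using *[of A x B y q2] q by simp
    next
      case 2
      then obtain A B where "q2 = A @ [x] @ B" using count_list_conv_split by metis
      then show ?thesis using E_sym[OF *[of q1 y A x B]] q by simp
    qed
  qed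
qed

theorem complete_F:
  assumes iso: "isolates W 1 1" "isolates W 3 0" "isolates W 3 1" and sat: "satisfies (Mw W) (u, v)"
  shows "u \<doteq> v"
proof (rule complete)
  fix u v p x y q
  assume *: "u = p @ [x, y] @ q" "satisfies (Mw W) (u, v)" "norm u" "norm v" "x \<noteq> y"
    "\<And>z. count_list u z = count_list v z" "pos v y (count_list p y) < pos v x (count_list p x)"
  interpret pair E W a b t s u v p q x y
    by unfold_locales (use * in auto)
  \<comment> \<open>A third occurrence commutes even with simple letters. Thus only numbers 0 and 1
    remain, for which isolating the values 0 and 1 is enough.\<close>
  have third: "p @ [x, c] @ q \<doteq> p @ [c, x] @ q" if "count_list p x \<ge> 2" for x c
  proof -
    have 1: "p @ [c] @ q \<doteq> p @ [x] @ [c] @ q" using that by (rule idF)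
    have "(p @ [c]) @ q \<doteq> (p @ [c]) @ [x] @ q" using that by (intro idF) simp
    then have 2: "p @ [c] @ q \<doteq> p @ [c, x] @ q" by simp
    show ?thesis using E_trans[OF E_sym[OF 1] 2] by simp
  qed
  consider "count_list p x \<ge> 2" | "count_list p y \<ge> 2" | "count_list p x \<le> 1" "count_list p y \<le> 1"
    by linarith
  then show "u \<doteq> p @ [y, x] @ q"
  proof cases
    case 1
    then show ?thesis using third u by simp
  next
    case 2
    then show ?thesis using E_sym[OF third] u by simp
  next
    case 3
    show ?thesis
    proof (rule swap_cases[OF *(1,3,5,6,7)])
      show "pos u z (count_list p z) < pos u r 0 \<longleftrightarrow> pos v z (count_list p z) < pos v r 0"
        if r: "count_list u r = 1" "r \<noteq> z" "z \<in> {x, y}" "count_list p z < count_list u z" for r z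
      proof (rule simple_order[OF W sat counts r(1,2,4)])
        fix k l assume kl: "k \<le> count_list p z" "count_list p z < l" "l \<le> count_list u z"
        have "count_list u z \<in> {0, 1, 3}" using norm by (simp add: norm_def)
        moreover have "count_list p z \<le> 1" using r(3) 3 by auto
        ultimately consider "count_list u z = 1" "l = 1" | "count_list u z = 3" "k = 0 \<or> k = 1"
          using kl by fastforce
        then show "isolates W (count_list u z) k \<or> isolates W (count_list u z) l"
          using iso by cases auto
      qed
    qed (use swap_F[of x p q y] later_occurrences u 3 in auto)
  qed
qed fact

end

text \<open>A non-last occurrence commutes with everything, so only last occurrences carry
  information.\<close>

locale E_model = base_model +
  assumes idE: "x \<in> set q \<Longrightarrow> p @ [x, c] @ q \<doteq> p @ [c, x] @ q"
begin

theorem complete_E: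
  assumes iso: "isolates W 1 1" "isolates W 3 3" and sat: "satisfies (Mw W) (u, v)"
  shows "u \<doteq> v"
proof (rule complete)
  fix u v p x y q
  assume *: "u = p @ [x, y] @ q" "satisfies (Mw W) (u, v)" "norm u" "norm v" "x \<noteq> y"
    "\<And>z. count_list u z = count_list v z" "pos v y (count_list p y) < pos v x (count_list p x)"
  interpret pair E W a b t s u v p q x y
    by unfold_locales (use * in auto)
  consider "x \<in> set q" | "y \<in> set q" | "x \<notin> set q" "y \<notin> set q" by blast
  then show "u \<doteq> p @ [y, x] @ q"
  proof cases
    case 1
    then show ?thesis using idE u by simp
  next
    case 2
    then show ?thesis using E_sym[OF idE] u by simp
  next
    case 3
    show ?thesis
    proof (rule swap_cases[OF *(1,3,5,6,7)])
      show "pos u z (count_list p z) < pos u r 0 \<longleftrightarrow> pos v z (count_list p z) < pos v r 0"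
        if r: "count_list u r = 1" "r \<noteq> z" "z \<in> {x, y}" "count_list p z < count_list u z" for r z
      proof (rule simple_order[OF W sat counts r(1,2,4)])
        fix k l assume kl: "k \<le> count_list p z" "count_list p z < l" "l \<le> count_list u z"
        have "count_list u z \<in> {0, 1, 3}" using norm by (simp add: norm_def)
        \<comment> \<open>The occurrence at issue is the last one, so the larger value
          \<open>l\<close> can only be the full count, which is isolated.\<close>
        moreover have "count_list u z = Suc (count_list p z)" using r(3) 3 u xy by auto
        ultimately show "isolates W (count_list u z) k \<or> isolates W (count_list u z) l"
          using iso kl by (auto simp: le_Suc_eq)
      qed
    qed (use 3 later_occurrences in auto)
  qed
qed fact

end


section \<open>Soundness of the identities\<close>

lemma remdups_adj_split:
  "c \<noteq> d \<Longrightarrow> remdups_adj (P @ [c, d] @ Q) = remdups_adj (P @ [c]) @ remdups_adj (d # Q)"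
  using remdups_adj_append[of P c "d # Q"] by simp

lemma remdups_adj_snoc: "\<exists>L. remdups_adj (P @ [c]) = L @ [c] \<and> insert c (set L) = insert c (set P)"
proof -
  have "remdups_adj (P @ [c]) \<noteq> []" "last (remdups_adj (P @ [c])) = c" by simp_all
  then have "remdups_adj (P @ [c]) = butlast (remdups_adj (P @ [c])) @ [c]"
    by (metis append_butlast_last_id)
  moreover from this have "insert c (set (butlast (remdups_adj (P @ [c])))) = insert c (set P)"
    by (metis insert_is_Un list.simps(15) remdups_adj_set set_append set_empty sup_bot_right list.set(2) empty_set
        Un_commute)
  ultimately show ?thesis by blast
qed

text \<open>Distinct neighbours mark a border between blocks; it survives the collapse, together
  with the letters present on either side.\<close>

lemma split_adjacent:
  assumes "P @ [c, d] @ Q \<sim> w" "c \<noteq> d"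
  shows "\<exists>L R. remdups_adj w = L @ [c, d] @ R \<and> remdups_adj (P @ [c]) = L @ [c] \<and>
    insert c (set L) = insert c (set P) \<and> insert d (set R) = insert d (set Q)"
proof -
  obtain L where L: "remdups_adj (P @ [c]) = L @ [c]" "insert c (set L) = insert c (set P)"
    using remdups_adj_snoc by metis
  have "remdups_adj (d # Q) = d # tl (remdups_adj (d # Q))" by simp
  moreover from this have "insert d (set (tl (remdups_adj (d # Q)))) = insert d (set Q)"
    by (metis list.simps(15) remdups_adj_set)
  ultimately show ?thesis
    using L remdups_adj_split[OF assms(2), of P Q] assms(1) unfolding lam_iff
    by (intro exI[of _ L] exI[of _ "tl (remdups_adj (d # Q))"]) simp
qed

text \<open>All occurrences of \<open>c\<close> form one block at the end of
  \<open>u\<close>.\<close>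

lemma fta_if_last_block:
  "remdups_adj u = L @ [c] \<Longrightarrow> c \<notin> set L \<Longrightarrow> count_list u c \<ge> 2 \<Longrightarrow> fta c u"
proof (induction u arbitrary: L rule: remdups_adj.induct)
  case (3 x y xs)
  show ?case
  proof (cases "x = y")
    case True
    then show ?thesis using 3 by (cases "x = c") auto
  next
    case False
    then have r: "x # remdups_adj (y # xs) = L @ [c]" using 3(3) by simp
    then obtain L' where L: "L = x # L'" "remdups_adj (y # xs) = L' @ [c]"
      by (cases L) auto
    then have "x \<noteq> c" using 3(4) by auto
    then show ?thesis using 3(2)[OF False L(2)] 3(4,5) L(1) by auto
  qed
qed auto

text \<open>The first letter \<open>d\<close> of \<open>T\<close> other than \<open>c\<close> ends
  the current block of \<open>c\<close>. If no block of \<open>c\<close> precedes, that block also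
  contains the \<open>c\<close> from \<open>P\<close>, so the first two occurrences are
  adjacent.\<close>

lemma late:
  assumes z: "P @ [c] @ T @ Q \<sim> w" and c: "c \<in> set P" and T: "\<not> set T \<subseteq> {c}"
  shows "\<exists>L d R. remdups_adj w = L @ [c, d] @ R \<and> d \<noteq> c \<and> d \<in> set T \<and> set Q \<subseteq> insert d (set R) \<and>
    (c \<in> set L \<or> fta c w)"
proof -
  obtain A d B where T: "T = A @ d # B" "d \<noteq> c" "\<forall>x\<in>set A. x = c"
    using split_list_first_prop[of T "\<lambda>x. x \<noteq> c"] T by (metis singletonI subsetI singletonD)
  obtain P' where P': "P @ [c] @ A = P' @ [c]" "c \<in> set P'"
  proof (cases A rule: rev_exhaust)
    case Nil
    then show ?thesis using that[of P] c by simp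
  next
    case (snoc A' x)
    then show ?thesis using that[of "P @ [c] @ A'"] T(3) by simp
  qed
  have z': "P' @ [c, d] @ (B @ Q) \<sim> w" using z P'(1) T(1) by (metis append.assoc append_Cons append_Nil)
  then obtain L R where LR: "remdups_adj w = L @ [c, d] @ R" "remdups_adj (P' @ [c]) = L @ [c]"
    "insert d (set R) = insert d (set (B @ Q))" using split_adjacent[OF z'] T(2) by metis
  have "fta c w" if "c \<notin> set L"
  proof -
    have "count_list P' c \<noteq> 0" using P'(2) by (simp add: count_list_0_iff)
    then have "fta c (P' @ [c])" using fta_if_last_block[OF LR(2) that] by simp
    then have "fta c (P' @ [c, d] @ (B @ Q))" using fta_append[of c "P' @ [c]" "d # B @ Q"] by simp
    then show ?thesis using z' unfolding lam_iff by blast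
  qed
  then show ?thesis using LR T(1,2) by (intro exI[of _ L] exI[of _ d] exI[of _ R]) auto
qed

text \<open>The number of factors cd. For distinct letters it is a \<lambda>-invariant, as the
  collapse keeps the borders between blocks.\<close>

fun cnt2 :: "letter \<Rightarrow> letter \<Rightarrow> word \<Rightarrow> nat" where
  "cnt2 c d (x # y # u) = (if x = c \<and> y = d then 1 else 0) + cnt2 c d (y # u)"
| "cnt2 c d _ = 0"

lemma cnt2_remdups_adj: "c \<noteq> d \<Longrightarrow> cnt2 c d (remdups_adj u) = cnt2 c d u"
proof (induction u rule: remdups_adj.induct)
  case (3 x y xs)
  show ?case
  proof (cases "x = y")
    case True
    then show ?thesis using 3 by auto
  next
    case False
    obtain r where "remdups_adj (y # xs) = y # r" by (metis remdups_adj_Cons_alt)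
    then show ?thesis using 3 False by simp
  qed
qed auto

lemma cnt2_lam: "c \<noteq> d \<Longrightarrow> u \<sim> v \<Longrightarrow> cnt2 c d u = cnt2 c d v"
  by (metis cnt2_remdups_adj lam_iff)

lemma cnt2_append: "cnt2 c d u + cnt2 c d v \<le> cnt2 c d (u @ v)"
proof (induction c d u rule: cnt2.induct)
  case ("2_2" c d x)
  then show ?case by (cases v) auto
qed auto

lemma cnt2_factor: "cnt2 c d v \<le> cnt2 c d (u @ v @ w)"
  using cnt2_append[of c d u "v @ w"] cnt2_append[of c d v w] by linarith

lemma power_or_cnt2: "(\<exists>c k. X = replicate k c) \<or> (\<exists>c d. c \<noteq> d \<and> cnt2 c d X \<ge> 1)"
proof (induction X)
  case (Cons x X)
  show ?case
  proof (cases "\<exists>c d. c \<noteq> d \<and> cnt2 c d X \<ge> 1")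
    case True
    then show ?thesis using cnt2_append[of _ _ "[x]" X] by (metis append_Cons append_Nil le_trans le_add2)
  next
    case False
    then obtain c k where X: "X = replicate k c" using Cons by blast
    show ?thesis
    proof (cases k)
      case 0
      then have "x # X = replicate 1 x" using X by simp
      then show ?thesis by blast
    next
      case (Suc k')
      show ?thesis
      proof (cases "x = c")
        case True
        then have "x # X = replicate (Suc k) c" using X by simp
        then show ?thesis by blast
      next
        case False
        then have "cnt2 x c (x # X) \<ge> 1" using X Suc by simp
        then show ?thesis using False by blast
      qed
    qed
  qed
qed (auto intro: exI[of _ 0])

lemma lam_mul: "u \<sim> w \<Longrightarrow> count_list u c \<ge> 2 \<Longrightarrow> c \<in> mul w"
  by (metis lam_iff mem_mul)

text \<open>The length of a nonempty block behind an earlier \<open>c\<close> influences neither the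
  collapse, nor the multiple letters, nor the first two occurrences.\<close>

lemma dup_lam:
  assumes "c \<in> set P" "m \<ge> 1" "n \<ge> 1"
  shows "P @ replicate m c @ Q \<sim> P @ replicate n c @ Q"
proof -
  have *: "P @ replicate (Suc m) c @ Q \<sim> P @ [c] @ Q" if "c \<in> set P" for m P
    using that
  proof (induction m arbitrary: P)
    case (Suc m)
    obtain A B where A: "P = A @ [c] @ B" "c \<notin> set A" using Suc.prems count_list_conv_split by metis
    have 1: "P @ [c] @ [c] \<sim> P @ [c]"
    proof -
      have "remdups_adj (P @ [c] @ [c]) = remdups_adj (P @ [c])" by (simp add: remdups_adj_append_two)
      moreover have "(count_list (P @ [c] @ [c]) d \<ge> 2) = (count_list (P @ [c]) d \<ge> 2)" for d
      proof -
        have "count_list P c \<noteq> 0" using Suc.prems by (simp add: count_list_0_iff)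
        then show ?thesis by (cases "c = d") auto
      qed
      moreover have "fta d (P @ [c] @ [c]) = fta d (P @ [c])" for d
        unfolding A(1) fta_append[of d A] by (cases B) (auto simp: fta_append hd_append)
      ultimately show ?thesis unfolding lam_iff_set by blast
    qed
    have "P @ replicate (Suc (Suc m)) c @ Q \<sim> P @ [c] @ [c] @ Q"
      using Suc.IH[of "P @ [c]"] Suc.prems by simp
    then show ?case using lam_append[OF 1 lam_refl[of Q]] lam_trans by simp
  qed simp
  obtain m' n' where "m = Suc m'" "n = Suc n'" using assms(2,3) by (metis Suc_le_D One_nat_def)
  then show ?thesis using *[OF assms(1)] lam_sym lam_trans by metis
qed

lemma powers_lam:
  assumes "m \<ge> 2" "n \<ge> 2"
  shows "replicate m c \<sim> replicate n c"
proof -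
  obtain m' n' where mn: "m = Suc m'" "n = Suc n'" "m' \<ge> 1" "n' \<ge> 1"
    using assms by (metis Suc_le_D Suc_1 Suc_le_mono One_nat_def)
  then show ?thesis using dup_lam[of c "[c]" m' n' "[]"] by simp
qed

lemma single_letter: "set X \<subseteq> {c} \<longleftrightarrow> X = replicate (length X) c"
  by (induction X) auto

lemma single_letter_mem: "set X \<subseteq> {c} \<Longrightarrow> X \<noteq> [] \<Longrightarrow> c \<in> set X"
  by (cases X) auto

lemma single_letter_append_commute:
  assumes "set X \<subseteq> {c}" "set Y \<subseteq> {c}"
  shows "X @ Y = Y @ X"
proof -
  obtain k l where "X = replicate k c" "Y = replicate l c" using assms single_letter by metis
  then show ?thesis by (simp add: replicate_add[symmetric] add.commute)
qed

lemma single_letter_ends: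
  assumes "set X \<subseteq> {c}" "X \<noteq> []"
  obtains X' where "X = c # X'" "X = X' @ [c]"
proof -
  obtain X' where X: "X = c # X'" using assms by (cases X) auto
  then have "[c] @ X' = X' @ [c]" using assms by (intro single_letter_append_commute[of _ c]) auto
  then show ?thesis using X that by simp
qed

lemma dup_lam':
  assumes "c \<in> set P" "set X \<subseteq> {c}" "set Y \<subseteq> {c}" "X \<noteq> []" "Y \<noteq> []"
  shows "P @ X @ Q \<sim> P @ Y @ Q"
  using dup_lam[of c P "length X" "length Y" Q] assms single_letter[of X c] single_letter[of Y c]
  by (metis One_nat_def Suc_leI length_greater_0_conv)

lemma satisfies_factorI:
  assumes "\<And>\<Phi> p q. p @ subst \<Phi> u @ q \<sim> w \<Longrightarrow> subst \<Phi> u \<sim> subst \<Phi> v"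
    and "\<And>\<Phi> p q. p @ subst \<Phi> v @ q \<sim> w \<Longrightarrow> subst \<Phi> u \<sim> subst \<Phi> v"
  shows "satisfies (Mw {w}) (u, v)"
  by (subst satisfies_Mw) (use assms in \<open>auto simp: fac_def\<close>)

lemma mul_of_square_factor: "p @ X @ q @ X @ r \<sim> w \<Longrightarrow> c \<in> set X \<Longrightarrow> c \<in> mul w"
proof (rule lam_mul)
  assume "c \<in> set X"
  then have "count_list X c \<noteq> 0" by (simp add: count_list_0_iff)
  then show "2 \<le> count_list (p @ X @ q @ X @ r) c" by simp
qed

lemma cnt2_adjacent:
  assumes "set X \<subseteq> {c}" "X \<noteq> []" "set Y \<subseteq> {d}" "Y \<noteq> []"
  shows "cnt2 c d (p @ X @ Y @ q) \<ge> 1"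
proof -
  obtain X' where X: "X = X' @ [c]" using assms single_letter_ends by metis
  obtain Y' where Y: "Y = d # Y'" using assms single_letter_ends by metis
  show ?thesis using cnt2_factor[of c d "[c, d]" "p @ X'" "Y' @ q"] X Y by simp
qed

text \<open>In the words of interest, after the first two occurrences of a letter \<open>c\<close>, no other letter
  precedes a later occurrence of \<open>c\<close>; this follows from \<open>revisit\<close>.\<close>

locale shape =
  fixes w :: word
  assumes once: "c \<noteq> d \<Longrightarrow> cnt2 c d w \<le> 1"
    and adjacent_multiple: "remdups_adj w = L @ [c, d] @ R \<Longrightarrow> c \<in> mul w \<Longrightarrow> d \<in> mul w \<Longrightarrow> c \<in> set R"
    and no_return: "c \<noteq> d \<Longrightarrow> c \<in> mul w \<Longrightarrow> d \<in> mul w \<Longrightarrow> cnt2 c d w = 0 \<or> cnt2 d c w = 0"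
    and revisit: "remdups_adj w = L @ [c] @ R \<Longrightarrow> c \<in> set R \<Longrightarrow> c \<notin> set L \<and> \<not> fta c w"
    and two_multiple: "c \<in> mul w \<Longrightarrow> d \<in> mul w \<Longrightarrow> e \<in> mul w \<Longrightarrow> d \<noteq> c \<Longrightarrow> e \<noteq> c \<Longrightarrow> d = e"
begin

text \<open>A border cd inside \<open>X\<close> would occur in both copies of \<open>X\<close>,
  against \<open>once\<close>.\<close>

lemma power_ex:
  assumes "p @ X @ q @ X @ r \<sim> w"
  shows "\<exists>c. set X \<subseteq> {c}"
proof -
  have False if "c \<noteq> d" "cnt2 c d X \<ge> 1" for c d
  proof -
    have "cnt2 c d (X @ (q @ X)) \<le> cnt2 c d (p @ (X @ q @ X) @ r)" using cnt2_factor[of c d "X @ q @ X"] by simp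
    moreover have "cnt2 c d X + cnt2 c d X \<le> cnt2 c d (X @ q @ X)"
      using cnt2_append[of c d X "q @ X"] cnt2_append[of c d q X] by linarith
    moreover have "cnt2 c d (p @ (X @ q @ X) @ r) = cnt2 c d w" using cnt2_lam[OF that(1) assms] by simp
    ultimately show False using once[OF that(1)] that(2) by linarith
  qed
  then obtain c k where "X = replicate k c" using power_or_cnt2[of X] by blast
  moreover have "set (replicate k c) \<subseteq> {c}" by auto
  ultimately show ?thesis by blast
qed

text \<open>The second \<open>X\<close> ends in a non-first \<open>c\<close>; if \<open>T2\<close>
  contained another letter, the third \<open>X\<close> would return to \<open>c\<close>, which
  \<open>revisit\<close> excludes.\<close>

lemma no_third_visit:
  assumes z: "p @ X @ T1 @ X @ T2 @ X @ q \<sim> w" and X: "set X \<subseteq> {c}" "X \<noteq> []"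
  shows "set T2 \<subseteq> {c}"
proof (rule ccontr)
  assume T2: "\<not> set T2 \<subseteq> {c}"
  obtain X' where X': "X = c # X'" "X = X' @ [c]" using single_letter_ends[OF X] .
  have eq: "(p @ X @ T1 @ X') @ [c] @ T2 @ ([c] @ X' @ q) = p @ X @ T1 @ (X' @ [c]) @ T2 @ (c # X') @ q" by simp
  have "(p @ X @ T1 @ X') @ [c] @ T2 @ ([c] @ X' @ q) \<sim> w"
    unfolding eq X'(1)[symmetric] X'(2)[symmetric] by (rule z)
  moreover have "c \<in> set (p @ X @ T1 @ X')" using X'(1) by simp
  ultimately obtain L d R where "remdups_adj w = L @ [c] @ (d # R)" "d \<noteq> c"
    "set ([c] @ X' @ q) \<subseteq> insert d (set R)" "c \<in> set L \<or> fta c w"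
    using late T2 by (metis append_Cons append_Nil)
  then show False using revisit[of L c "d # R"] by auto
qed

text \<open>With an earlier \<open>c\<close>, the border cd belongs to a later visit to
  \<open>c\<close> or to adjacent first occurrences. But \<open>adjacent_multiple\<close> makes
  \<open>c\<close> return after \<open>d\<close>, and \<open>revisit\<close> excludes this.\<close>

lemma first_before_adjacent:
  assumes z: "p @ X @ Y @ q \<sim> w" and X: "set X \<subseteq> {c}" "X \<noteq> []" and Y: "set Y \<subseteq> {d}" "Y \<noteq> []"
    and cd: "c \<noteq> d" "c \<in> mul w" "d \<in> mul w"
  shows "c \<notin> set p"
proof
  assume c: "c \<in> set p"
  obtain X' where X': "X = X' @ [c]" using single_letter_ends[OF X] .
  obtain Y' where Y': "Y = d # Y'" using single_letter_ends[OF Y] .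
  have "(p @ X') @ [c] @ [d] @ (Y' @ q) \<sim> w" using z X' Y' by simp
  moreover have "c \<in> set (p @ X')" "\<not> set [d] \<subseteq> {c}" using c cd by auto
  ultimately obtain L e R where "remdups_adj w = L @ [c, e] @ R" "e \<in> set [d]" "c \<in> set L \<or> fta c w"
    using late by metis
  then show False using revisit[of L c "d # R"] adjacent_multiple[of L c d R] cd by auto
qed

lemma no_return_factor:
  assumes z: "p @ u @ q \<sim> w" and cd: "c \<noteq> d" "c \<in> mul w" "d \<in> mul w" and "cnt2 c d u \<ge> 1" "cnt2 d c u \<ge> 1"
  shows False
  using no_return[OF cd] cnt2_lam[OF cd(1) z] cnt2_lam[OF cd(1)[symmetric] z] assms(5,6)
    cnt2_factor[of c d u p q] cnt2_factor[of d c u p q] by auto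

section \<open>The common identities hold in the models\<close>

lemma sat_id1: "satisfies (Mw {w}) ([Lx, Lt i, Lx], [Lx, Lt i, Lx, Lx])"
proof (rule satisfies_factorI)
  fix \<Phi> :: "letter \<Rightarrow> word" and p q
  let ?X = "\<Phi> Lx" and ?T = "\<Phi> (Lt i)"
  have *: "?X @ ?T @ ?X \<sim> ?X @ ?T @ ?X @ ?X" if "set ?X \<subseteq> {c}" for c
  proof (cases "?X = []")
    case False
    then show ?thesis using dup_lam'[of c "?X @ ?T" ?X "?X @ ?X" "[]"] that
      by (cases ?X) auto
  qed simp
  { assume "p @ subst \<Phi> [Lx, Lt i, Lx] @ q \<sim> w"
    then obtain c where "set ?X \<subseteq> {c}" using power_ex[of p ?X ?T q] by (simp; blast)
    then show "subst \<Phi> [Lx, Lt i, Lx] \<sim> subst \<Phi> [Lx, Lt i, Lx, Lx]" using * by simp }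
  { assume "p @ subst \<Phi> [Lx, Lt i, Lx, Lx] @ q \<sim> w"
    then obtain c where "set ?X \<subseteq> {c}" using power_ex[of p ?X ?T "?X @ q"] by (simp; blast)
    then show "subst \<Phi> [Lx, Lt i, Lx] \<sim> subst \<Phi> [Lx, Lt i, Lx, Lx]" using * by simp }
qed

lemma commute_or_distinct:
  assumes "set X \<subseteq> {c}" "set Y \<subseteq> {d}" "X \<noteq> [] \<Longrightarrow> Y \<noteq> [] \<Longrightarrow> c \<noteq> d \<Longrightarrow> False"
  shows "X @ Y = Y @ X"
  using assms single_letter_append_commute[of X c Y] by (cases "X = [] \<or> Y = []") auto

lemma squares_commute:
  assumes z: "p @ X @ X @ Y @ Y @ q \<sim> w"
  shows "X @ X @ Y @ Y = Y @ Y @ X @ X"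
proof -
  obtain c where X: "set X \<subseteq> {c}" using power_ex[of p X "[]" "Y @ Y @ q"] z by (simp; blast)
  obtain d where Y: "set Y \<subseteq> {d}" using power_ex[of "p @ X @ X" Y "[]" q] z by (simp; blast)
  have "X @ Y = Y @ X"
  proof (rule commute_or_distinct[OF X Y])
    assume ne: "X \<noteq> []" "Y \<noteq> []" "c \<noteq> d"
    then have m: "c \<in> set X" "d \<in> set Y" using X Y by (auto intro: single_letter_mem)
    have "c \<in> mul w" "d \<in> mul w"
      using mul_of_square_factor[of p X "[]" "Y @ Y @ q"] mul_of_square_factor[of "p @ X @ X" Y "[]" q] z m
      by simp_all
    then show False using first_before_adjacent[of "p @ X" X Y "Y @ q" c d] z X Y ne m by simp
  qed
  then show ?thesis by (metis append.assoc)
qed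

lemma sat_id2: "satisfies (Mw {w}) ([Lx, Lx, Ly i, Ly i], [Ly i, Ly i, Lx, Lx])"
proof (rule satisfies_factorI)
  fix \<Phi> :: "letter \<Rightarrow> word" and p q
  { assume "p @ subst \<Phi> [Lx, Lx, Ly i, Ly i] @ q \<sim> w"
    then show "subst \<Phi> [Lx, Lx, Ly i, Ly i] \<sim> subst \<Phi> [Ly i, Ly i, Lx, Lx]"
      using squares_commute[of p "\<Phi> Lx" "\<Phi> (Ly i)" q] by simp }
  { assume "p @ subst \<Phi> [Ly i, Ly i, Lx, Lx] @ q \<sim> w"
    then show "subst \<Phi> [Lx, Lx, Ly i, Ly i] \<sim> subst \<Phi> [Ly i, Ly i, Lx, Lx]"
      using squares_commute[of p "\<Phi> (Ly i)" "\<Phi> Lx" q] by simp }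
qed

text \<open>If one side of the following identities has a nonzero value, then the letters \<open>x\<close> and \<open>y\<close>
  are mapped to commuting powers of one letter, which makes both sides equal.\<close>

lemma no_return_powers:
  assumes z: "p @ Y @ X @ T @ q \<sim> w" and X: "set X \<subseteq> {c}" and Y: "set Y \<subseteq> {d}"
    and m: "c \<in> set X \<Longrightarrow> c \<in> mul w" "d \<in> set Y \<Longrightarrow> d \<in> mul w" and ret: "T = T1 @ X @ Y @ T2 \<or> T = Y @ T2"
  shows "X @ Y = Y @ X"
proof (rule commute_or_distinct[OF X Y])
  assume ne: "X \<noteq> []" "Y \<noteq> []" "c \<noteq> d"
  then have "c \<in> set X" "d \<in> set Y" using X Y by (auto intro: single_letter_mem)
  then have mw: "c \<in> mul w" "d \<in> mul w" using m by auto
  have "cnt2 d c (Y @ X @ T) \<ge> 1" using cnt2_adjacent[OF Y ne(2) X ne(1), of "[]" T] by simp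
  moreover have "cnt2 c d (Y @ X @ T) \<ge> 1"
    using ret cnt2_adjacent[OF X ne(1) Y ne(2), of "Y @ X @ T1" T2] cnt2_adjacent[OF X ne(1) Y ne(2), of Y T2]
    by auto
  ultimately show False using no_return_factor[of p "Y @ X @ T" q c d] z ne(3) mw by simp
qed

lemma sat_id3: "satisfies (Mw {w}) ([Lx, Ly i, Lt j, Lx, Ly i], [Ly i, Lx, Lt j, Lx, Ly i])"
proof (rule satisfies_factorI)
  fix \<Phi> :: "letter \<Rightarrow> word" and p q
  let ?X = "\<Phi> Lx" and ?Y = "\<Phi> (Ly i)" and ?T = "\<Phi> (Lt j)"
  have *: "subst \<Phi> [Lx, Ly i, Lt j, Lx, Ly i] \<sim> subst \<Phi> [Ly i, Lx, Lt j, Lx, Ly i]" if "?X @ ?Y = ?Y @ ?X"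
  proof -
    have "(?X @ ?Y) @ ?T @ ?X @ ?Y = (?Y @ ?X) @ ?T @ ?X @ ?Y" unfolding that ..
    then have "subst \<Phi> [Lx, Ly i, Lt j, Lx, Ly i] = subst \<Phi> [Ly i, Lx, Lt j, Lx, Ly i]" by simp
    then show ?thesis by (simp only: lam_refl)
  qed
  { assume "p @ subst \<Phi> [Lx, Ly i, Lt j, Lx, Ly i] @ q \<sim> w"
    then obtain c where "set (?X @ ?Y) \<subseteq> {c}" using power_ex[of p "?X @ ?Y" ?T q] by (simp; blast)
    then show "subst \<Phi> [Lx, Ly i, Lt j, Lx, Ly i] \<sim> subst \<Phi> [Ly i, Lx, Lt j, Lx, Ly i]"
      by (intro * single_letter_append_commute[of _ c]) auto }
  { assume z: "p @ subst \<Phi> [Ly i, Lx, Lt j, Lx, Ly i] @ q \<sim> w"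
    obtain c where X: "set ?X \<subseteq> {c}" using power_ex[of "p @ ?Y" ?X ?T "?Y @ q"] z by (simp; blast)
    obtain d where Y: "set ?Y \<subseteq> {d}" using power_ex[of p ?Y "?X @ ?T @ ?X" q] z by (simp; blast)
    show "subst \<Phi> [Lx, Ly i, Lt j, Lx, Ly i] \<sim> subst \<Phi> [Ly i, Lx, Lt j, Lx, Ly i]"
    proof (rule *, rule no_return_powers[OF _ X Y])
      show "p @ ?Y @ ?X @ (?T @ ?X @ ?Y) @ q \<sim> w" using z by simp
      show "c \<in> mul w" if "c \<in> set ?X" using mul_of_square_factor[of "p @ ?Y" ?X ?T "?Y @ q"] z that by simp
      show "d \<in> mul w" if "d \<in> set ?Y" using mul_of_square_factor[of p ?Y "?X @ ?T @ ?X" q] z that by simp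
      show "?T @ ?X @ ?Y = ?T @ ?X @ ?Y @ [] \<or> ?T @ ?X @ ?Y = ?Y @ []" by simp
    qed }
qed

lemma sat_id4: "satisfies (Mw {w}) ([Lx, Lt i, Lx, Lt j, Lt k, Lx], [Lx, Lt i, Lx, Lt j, Lx, Lt k, Lx])"
proof (rule satisfies_factorI)
  fix \<Phi> :: "letter \<Rightarrow> word" and p q
  let ?X = "\<Phi> Lx" and ?T1 = "\<Phi> (Lt i)" and ?T2 = "\<Phi> (Lt j)" and ?T3 = "\<Phi> (Lt k)"
  have *: "subst \<Phi> [Lx, Lt i, Lx, Lt j, Lt k, Lx] \<sim> subst \<Phi> [Lx, Lt i, Lx, Lt j, Lx, Lt k, Lx]"
    if "?X \<noteq> [] \<Longrightarrow> set (?T2 @ ?T3) \<subseteq> {c}" "set ?X \<subseteq> {c}" for c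
  proof (cases "?X = []")
    case False
    then have "c \<in> set ?X" using that by (cases ?X) auto
    then show ?thesis
      using dup_lam'[of c "?X @ ?T1" "?X @ ?T2 @ ?T3 @ ?X" "?X @ ?T2 @ ?X @ ?T3 @ ?X" "[]"] that False by simp
  qed simp
  { assume z: "p @ subst \<Phi> [Lx, Lt i, Lx, Lt j, Lt k, Lx] @ q \<sim> w"
    obtain c where X: "set ?X \<subseteq> {c}" using power_ex[of p ?X ?T1 "?T2 @ ?T3 @ ?X @ q"] z by (simp; blast)
    show "subst \<Phi> [Lx, Lt i, Lx, Lt j, Lt k, Lx] \<sim> subst \<Phi> [Lx, Lt i, Lx, Lt j, Lx, Lt k, Lx]"
      using no_third_visit[of p ?X ?T1 "?T2 @ ?T3" q, OF _ X] z X by (intro *[of c]) auto }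
  { assume z: "p @ subst \<Phi> [Lx, Lt i, Lx, Lt j, Lx, Lt k, Lx] @ q \<sim> w"
    obtain c where X: "set ?X \<subseteq> {c}" using power_ex[of p ?X ?T1 "?T2 @ ?X @ ?T3 @ ?X @ q"] z by (simp; blast)
    show "subst \<Phi> [Lx, Lt i, Lx, Lt j, Lt k, Lx] \<sim> subst \<Phi> [Lx, Lt i, Lx, Lt j, Lx, Lt k, Lx]"
      using no_third_visit[of p ?X ?T1 "?T2 @ ?X @ ?T3" q, OF _ X] z X by (intro *[of c]) auto }
qed

lemma sat_common: "e \<in> common_identities \<Longrightarrow> satisfies (Mw {w}) e"
  unfolding common_identities_def using sat_id1 sat_id2 sat_id3 sat_id4 by auto

text \<open>By \<open>no_late\<close>, a non-first occurrence of a letter is not followed by any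
  other letter; so the image of s is a power of the same letter as the image of x.\<close>

lemma sat_F:
  assumes no_late: "\<And>L c R. remdups_adj w = L @ [c] @ R \<Longrightarrow> R \<noteq> [] \<Longrightarrow> c \<notin> set L \<and> \<not> fta c w"
  shows "satisfies (Mw {w}) ([Lx, Lt i, Lx, Ls], [Lx, Lt i, Lx, Ls, Lx])"
proof (rule satisfies_factorI)
  fix \<Phi> :: "letter \<Rightarrow> word" and p q
  let ?X = "\<Phi> Lx" and ?T = "\<Phi> (Lt i)" and ?S = "\<Phi> Ls"
  have *: "subst \<Phi> [Lx, Lt i, Lx, Ls] \<sim> subst \<Phi> [Lx, Lt i, Lx, Ls, Lx]" if z: "p @ ?X @ ?T @ ?X @ ?S @ q \<sim> w" for q
  proof (cases "?X = []")
    case False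
    obtain c where X: "set ?X \<subseteq> {c}" using power_ex[OF z] by blast
    obtain X' where X': "?X = X' @ [c]" using single_letter_ends[OF X False] .
    have S: "set ?S \<subseteq> {c}"
    proof (rule ccontr)
      assume S: "\<not> set ?S \<subseteq> {c}"
      have eq: "(p @ ?X @ ?T @ X') @ [c] @ ?S @ q = p @ ?X @ ?T @ (X' @ [c]) @ ?S @ q" by simp
      have "(p @ ?X @ ?T @ X') @ [c] @ ?S @ q \<sim> w" unfolding eq X'[symmetric] by (rule z)
      moreover have "c \<in> set (p @ ?X @ ?T @ X')" using X' by simp
      ultimately obtain L d R where "remdups_adj w = L @ [c] @ (d # R)" "c \<in> set L \<or> fta c w"
        using late S by (metis append_Cons append_Nil)
      then show False using no_late by blast
    qed
    have "c \<in> set ?X" using X' by simp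
    then show ?thesis using dup_lam'[of c "?X @ ?T" "?X @ ?S" "?X @ ?S @ ?X" "[]"] X S False by simp
  qed simp
  { assume "p @ subst \<Phi> [Lx, Lt i, Lx, Ls] @ q \<sim> w"
    then show "subst \<Phi> [Lx, Lt i, Lx, Ls] \<sim> subst \<Phi> [Lx, Lt i, Lx, Ls, Lx]" using * by simp }
  { assume "p @ subst \<Phi> [Lx, Lt i, Lx, Ls, Lx] @ q \<sim> w"
    then show "subst \<Phi> [Lx, Lt i, Lx, Ls] \<sim> subst \<Phi> [Lx, Lt i, Lx, Ls, Lx]" using *[of "?X @ q"] by simp }
qed

lemma satisfies_if_commute:
  assumes "\<And>\<Phi> p q. p @ subst \<Phi> u @ q \<sim> w \<Longrightarrow> \<Phi> x @ \<Phi> y = \<Phi> y @ \<Phi> x"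
    and "\<And>\<Phi> p q. p @ subst \<Phi> v @ q \<sim> w \<Longrightarrow> \<Phi> x @ \<Phi> y = \<Phi> y @ \<Phi> x"
    and "\<And>\<Phi>. \<Phi> x @ \<Phi> y = \<Phi> y @ \<Phi> x \<Longrightarrow> subst \<Phi> u = subst \<Phi> v"
  shows "satisfies (Mw {w}) (u, v)"
  by (rule satisfies_factorI) (use assms in \<open>metis lam_refl\<close>)+

lemma commute_XXY:
  assumes z: "p @ X @ T @ X @ Y @ S @ Y @ q \<sim> w"
  shows "X @ Y = Y @ X"
proof -
  obtain c where X: "set X \<subseteq> {c}" using power_ex[OF z] by blast
  obtain d where Y: "set Y \<subseteq> {d}" using power_ex[of "p @ X @ T @ X" Y S q] z by (simp; blast)
  show ?thesis
  proof (rule commute_or_distinct[OF X Y])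
    assume ne: "X \<noteq> []" "Y \<noteq> []" "c \<noteq> d"
    then have m: "c \<in> set X" "d \<in> set Y" using X Y by (auto intro: single_letter_mem)
    have "c \<in> mul w" "d \<in> mul w"
      using mul_of_square_factor[OF z m(1)] mul_of_square_factor[of "p @ X @ T @ X" Y S q] z m by simp_all
    then show False using first_before_adjacent[of "p @ X @ T" X Y "S @ Y @ q" c d] z X Y ne m by simp
  qed
qed

text \<open>Each of the three words occurring here forces the images of x and y to commute. In
  yx^2ty a border dc would be followed by the first block of c, of length at least two, against
  \<open>second\<close>.\<close>

lemma sat_H:
  assumes second: "\<And>L d c R. remdups_adj w = L @ [d, c] @ R \<Longrightarrow> c \<in> mul w \<Longrightarrow> d \<in> mul w \<Longrightarrow> c \<notin> set L \<and> \<not> fta c w"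
  shows "satisfies (Mw {w}) ([Lx, Lx, Ly i, Lt j, Ly i], [Lx, Ly i, Lx, Lt j, Ly i])"
    "satisfies (Mw {w}) ([Lx, Ly i, Lx, Lt j, Ly i], [Ly i, Lx, Lx, Lt j, Ly i])"
proof -
  have 1: "\<Phi> Lx @ \<Phi> (Ly i) = \<Phi> (Ly i) @ \<Phi> Lx" if "p @ subst \<Phi> [Lx, Lx, Ly i, Lt j, Ly i] @ q \<sim> w" for p q \<Phi>
    using commute_XXY[of p "\<Phi> Lx" "[]" "\<Phi> (Ly i)" "\<Phi> (Lt j)" q] that by simp
  have 2: "\<Phi> Lx @ \<Phi> (Ly i) = \<Phi> (Ly i) @ \<Phi> Lx" if z: "p @ subst \<Phi> [Lx, Ly i, Lx, Lt j, Ly i] @ q \<sim> w" for p q \<Phi>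
  proof -
    let ?X = "\<Phi> Lx" and ?Y = "\<Phi> (Ly i)" and ?T = "\<Phi> (Lt j)"
    obtain c where X: "set ?X \<subseteq> {c}" using power_ex[of p ?X ?Y "?T @ ?Y @ q"] z by (simp; blast)
    obtain d where Y: "set ?Y \<subseteq> {d}" using power_ex[of "p @ ?X" ?Y "?X @ ?T" q] z by (simp; blast)
    have "?Y @ ?X = ?X @ ?Y"
    proof (rule no_return_powers[OF _ Y X])
      show "p @ ?X @ ?Y @ (?X @ ?T @ ?Y) @ q \<sim> w" using z by simp
      show "c \<in> mul w" if "c \<in> set ?X" using mul_of_square_factor[of p ?X ?Y "?T @ ?Y @ q"] z that by simp
      show "d \<in> mul w" if "d \<in> set ?Y" using mul_of_square_factor[of "p @ ?X" ?Y "?X @ ?T" q] z that by simp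
      show "?X @ ?T @ ?Y = [] @ ?Y @ ?X @ (?T @ ?Y) \<or> ?X @ ?T @ ?Y = ?X @ (?T @ ?Y)" by simp
    qed
    then show ?thesis by simp
  qed
  have 3: "\<Phi> Lx @ \<Phi> (Ly i) = \<Phi> (Ly i) @ \<Phi> Lx" if z: "p @ subst \<Phi> [Ly i, Lx, Lx, Lt j, Ly i] @ q \<sim> w" for p q \<Phi>
  proof -
    let ?X = "\<Phi> Lx" and ?Y = "\<Phi> (Ly i)" and ?T = "\<Phi> (Lt j)"
    obtain c where X: "set ?X \<subseteq> {c}" using power_ex[of "p @ ?Y" ?X "[]" "?T @ ?Y @ q"] z by (simp; blast)
    obtain d where Y: "set ?Y \<subseteq> {d}" using power_ex[of p ?Y "?X @ ?X @ ?T" q] z by (simp; blast)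
    show ?thesis
    proof (rule commute_or_distinct[OF X Y])
      assume ne: "?X \<noteq> []" "?Y \<noteq> []" "c \<noteq> d"
      then have m: "c \<in> set ?X" "d \<in> set ?Y" using X Y by (auto intro: single_letter_mem)
      have mw: "c \<in> mul w" "d \<in> mul w"
        using mul_of_square_factor[of "p @ ?Y" ?X "[]" "?T @ ?Y @ q"]
          mul_of_square_factor[of p ?Y "?X @ ?X @ ?T" q] z m by simp_all
      obtain X' where X': "?X = c # X'" using single_letter_ends[OF X ne(1)] .
      obtain Y' where Y': "?Y = Y' @ [d]" using single_letter_ends[OF Y ne(2)] .
      have z': "(p @ Y') @ [d, c] @ (X' @ ?X @ ?T @ ?Y @ q) \<sim> w"
        using z X' by (simp add: Y')
      obtain L R where L: "remdups_adj w = L @ [d, c] @ R" "insert d (set L) = insert d (set (p @ Y'))"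
        using split_adjacent[OF z'] ne(3) by metis
      have "c \<notin> set L" "\<not> fta c w" using second[OF L(1)] mw by auto
      then have "c \<notin> set (p @ Y')" using L(2) ne(3) by auto
      moreover have "set X' \<subseteq> {c}" using X X' by auto
      ultimately have "fta c ((p @ Y') @ [d, c] @ (X' @ ?X @ ?T @ ?Y @ q))"
        using ne(3) X' fta_append[of c "p @ Y' @ [d]" "c # X' @ ?X @ ?T @ ?Y @ q"] by (cases X') auto
      then show False using \<open>\<not> fta c w\<close> z' unfolding lam_iff by blast
    qed
  qed
  show "satisfies (Mw {w}) ([Lx, Lx, Ly i, Lt j, Ly i], [Lx, Ly i, Lx, Lt j, Ly i])"
    by (rule satisfies_if_commute[of _ Lx "Ly i", OF 1 2]) simp_all
  show "satisfies (Mw {w}) ([Lx, Ly i, Lx, Lt j, Ly i], [Ly i, Lx, Lx, Lt j, Ly i])"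
  proof (rule satisfies_if_commute[of _ Lx "Ly i", OF 2 3])
    fix \<Phi> :: "letter \<Rightarrow> word" assume c: "\<Phi> Lx @ \<Phi> (Ly i) = \<Phi> (Ly i) @ \<Phi> Lx"
    have "(\<Phi> Lx @ \<Phi> (Ly i)) @ \<Phi> Lx @ \<Phi> (Lt j) @ \<Phi> (Ly i) = (\<Phi> (Ly i) @ \<Phi> Lx) @ \<Phi> Lx @ \<Phi> (Lt j) @ \<Phi> (Ly i)"
      unfolding c ..
    then show "subst \<Phi> [Lx, Ly i, Lx, Lt j, Ly i] = subst \<Phi> [Ly i, Lx, Lx, Lt j, Ly i]" by simp
  qed
qed

text \<open>On the right-hand side an image of x already precedes the border dc, which
  \<open>first\<close> excludes.\<close>

lemma sat_I:
  assumes first: "\<And>L d c R. remdups_adj w = L @ [d, c] @ R \<Longrightarrow> c \<in> mul w \<Longrightarrow> d \<in> mul w \<Longrightarrow> c \<notin> set L"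
  shows "satisfies (Mw {w}) ([Lx, Lt j, Lx, Ly i, Ls, Ly i], [Lx, Lt j, Ly i, Lx, Ls, Ly i])"
proof (rule satisfies_if_commute[of _ Lx "Ly i"])
  fix \<Phi> :: "letter \<Rightarrow> word" and p q
  let ?X = "\<Phi> Lx" and ?Y = "\<Phi> (Ly i)" and ?T = "\<Phi> (Lt j)" and ?S = "\<Phi> Ls"
  show "?X @ ?Y = ?Y @ ?X" if "p @ subst \<Phi> [Lx, Lt j, Lx, Ly i, Ls, Ly i] @ q \<sim> w"
    using commute_XXY[of p ?X ?T ?Y ?S q] that by simp
  show "?X @ ?Y = ?Y @ ?X" if z: "p @ subst \<Phi> [Lx, Lt j, Ly i, Lx, Ls, Ly i] @ q \<sim> w"
  proof -
    obtain c where X: "set ?X \<subseteq> {c}" using power_ex[of p ?X "?T @ ?Y" "?S @ ?Y @ q"] z by (simp; blast)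
    obtain d where Y: "set ?Y \<subseteq> {d}" using power_ex[of "p @ ?X @ ?T" ?Y "?X @ ?S" q] z by (simp; blast)
    show ?thesis
    proof (rule commute_or_distinct[OF X Y])
      assume ne: "?X \<noteq> []" "?Y \<noteq> []" "c \<noteq> d"
      then have m: "c \<in> set ?X" "d \<in> set ?Y" using X Y by (auto intro: single_letter_mem)
      have mw: "c \<in> mul w" "d \<in> mul w"
        using mul_of_square_factor[of p ?X "?T @ ?Y" "?S @ ?Y @ q"]
          mul_of_square_factor[of "p @ ?X @ ?T" ?Y "?X @ ?S" q] z m by simp_all
      obtain X' where X': "?X = c # X'" using single_letter_ends[OF X ne(1)] .
      obtain Y' where Y': "?Y = Y' @ [d]" using single_letter_ends[OF Y ne(2)] .
      have z': "(p @ ?X @ ?T @ Y') @ [d, c] @ (X' @ ?S @ ?Y @ q) \<sim> w"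
        using z X' by (simp add: Y')
      obtain L R where L: "remdups_adj w = L @ [d, c] @ R"
        "insert d (set L) = insert d (set (p @ ?X @ ?T @ Y'))"
        using split_adjacent[OF z'] ne(3) by metis
      then have "c \<in> insert d (set L)" using m by auto
      then show False using first[OF L(1)] mw ne(3) by auto
    qed
  qed
qed simp

text \<open>As \<pi> is a permutation, every letter of the block \<open>Y\<close> recurs in
  \<open>R\<close> and is multiple, so by \<open>two_multiple\<close> at most one letter d differs
  from the letter c of \<open>X\<close>. If d occurs, the left side contains both borders cd and dc,
  and the right side a border cd after an earlier c; both are excluded.\<close>

lemma sat_J:
  assumes \<pi>: "\<pi> permutes {1..n}"
  shows "satisfies (Mw {w}) (w_word n \<pi>, w'_word n \<pi>)"
proof -
  have both: "subst \<Phi> (w_word n \<pi>) = subst \<Phi> (w'_word n \<pi>)"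
    if z: "p @ subst \<Phi> (w_word n \<pi>) @ q \<sim> w \<or> p @ subst \<Phi> (w'_word n \<pi>) @ q \<sim> w" for \<Phi> p q
  proof -
    define X where "X = \<Phi> Lx"
    define Y where "Y = subst \<Phi> (map (\<lambda>i. Ly (\<pi> i)) [1..<n + 1])"
    define R where "R = subst \<Phi> (concat (map (\<lambda>i. [Lt i, Ly i]) [1..<n + 1]))"
    have u: "subst \<Phi> (w_word n \<pi>) = X @ Y @ X @ R" and v: "subst \<Phi> (w'_word n \<pi>) = X @ X @ Y @ R"
      by (simp_all add: w_word_def w'_word_def X_def Y_def R_def)
    have YR: "d \<in> set R" if dY: "d \<in> set Y" for d
    proof -
      obtain i where "i \<in> set [1..<n + 1]" and d: "d \<in> set (\<Phi> (Ly (\<pi> i)))"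
        using dY by (auto simp: Y_def subst_def simp del: upt_Suc)
      then have i: "i \<in> {1..n}" by auto
      have "\<pi> i \<in> {1..n}" using permutes_in_image[OF \<pi>] i by blast
      then show ?thesis using d by (auto simp: R_def subst_def simp del: upt_Suc)
    qed
    have Ym: "d \<in> mul w" if "d \<in> set Y" for d
    proof -
      have "count_list Y d \<noteq> 0" "count_list R d \<noteq> 0" using that YR by (auto simp: count_list_0_iff)
      then have "count_list (subst \<Phi> (w_word n \<pi>)) d \<ge> 2" "count_list (subst \<Phi> (w'_word n \<pi>)) d \<ge> 2"
        unfolding u v by simp_all
      then show ?thesis using z lam_mul by (metis count_list_append trans_le_add1 trans_le_add2)
    qed
    obtain c where c: "set X \<subseteq> {c}"
      using z power_ex[of p X Y "R @ q"] power_ex[of p X "[]" "Y @ R @ q"] unfolding u v by (simp; blast)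
    show ?thesis
    proof (cases "X = [] \<or> set Y \<subseteq> {c}")
      case True
      then have "Y @ X = X @ Y" using c single_letter_append_commute by fastforce
      then have "X @ (Y @ X) @ R = X @ (X @ Y) @ R" by simp
      then show ?thesis unfolding u v by simp
    next
      case False
      then have X: "X \<noteq> []" by simp
      have cX: "c \<in> set X" using c X by (cases X) auto
      have cw: "c \<in> mul w"
        using z cX mul_of_square_factor[of p X Y "R @ q"] mul_of_square_factor[of p X "[]" "Y @ R @ q"]
        unfolding u v by auto
      obtain A d B where Y: "Y = A @ d # B" "d \<noteq> c" "\<forall>x\<in>set A. x = c"
        using split_list_first_prop[of Y "\<lambda>x. x \<noteq> c"] False by (metis singletonI subsetI singletonD)
      obtain A' e B' where Y': "Y = A' @ e # B'" "e \<noteq> c" "\<forall>x\<in>set B'. x = c"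
        using split_list_last_prop[of Y "\<lambda>x. x \<noteq> c"] Y by auto
      have "d \<in> set Y" using Y(1) by simp
      moreover have "e \<in> set Y" using Y'(1) by simp
      ultimately have "d \<in> mul w" "e \<in> mul w" using Ym by auto
      then have "d = e" using two_multiple[OF cw] Y(2) Y'(2) by metis
      have False using z
      proof
        assume z: "p @ subst \<Phi> (w_word n \<pi>) @ q \<sim> w"
        have "cnt2 c d (X @ Y @ X @ R) \<ge> 1"
          using cnt2_adjacent[of "X @ A" c "[d]" d "[]" "B @ X @ R"] c X Y by auto
        moreover have "cnt2 d c (X @ Y @ X @ R) \<ge> 1"
          using cnt2_adjacent[of "[d]" d "B' @ X" c "X @ A'" R] c X Y' \<open>d = e\<close> by auto
        ultimately show False
          using no_return_factor[OF z[unfolded u]] Y(2) cw \<open>d \<in> mul w\<close> by metis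
      next
        assume z: "p @ subst \<Phi> (w'_word n \<pi>) @ q \<sim> w"
        then have "(p @ X) @ (X @ A) @ [d] @ (B @ R @ q) \<sim> w" unfolding v Y by simp
        then have "c \<notin> set (p @ X)"
          by (rule first_before_adjacent[where c = c and d = d]) (use c X Y cw \<open>d \<in> mul w\<close> in auto)
        then show False using cX by simp
      qed
      then show ?thesis ..
    qed
  qed
  show ?thesis by (rule satisfies_factorI) (use both lam_refl in metis)+
qed


text \<open>No letter has two blocks, so in xyx the image of y is absorbed by the block of x; a
  multiple letter can only form the initial block, so the same happens in yx^2.\<close>

lemma sat_E:
  assumes no_repeat: "\<And>L c R. remdups_adj w = L @ [c] @ R \<Longrightarrow> c \<notin> set R"
    and initial: "\<And>L d c R. remdups_adj w = L @ [d, c] @ R \<Longrightarrow> c \<notin> mul w"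
  shows "satisfies (Mw {w}) ([Lx, Lx], [Lx, Lx, Lx])"
    "satisfies (Mw {w}) ([Lx, Ly i, Lx], [Ly i, Lx, Lx])"
proof -
  show "satisfies (Mw {w}) ([Lx, Lx], [Lx, Lx, Lx])"
  proof (rule satisfies_factorI)
    fix \<Phi> :: "letter \<Rightarrow> word" and p q
    let ?X = "\<Phi> Lx"
    have *: "?X @ ?X \<sim> ?X @ ?X @ ?X" if "set ?X \<subseteq> {c}" for c
    proof (cases "?X = []")
      case False
      then have "c \<in> set ?X" using that by (cases ?X) auto
      then show ?thesis using dup_lam'[of c ?X ?X "?X @ ?X" "[]"] that False by simp
    qed simp
    { assume "p @ subst \<Phi> [Lx, Lx] @ q \<sim> w"
      then obtain c where "set ?X \<subseteq> {c}" using power_ex[of p ?X "[]" q] by (simp; blast)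
      then show "subst \<Phi> [Lx, Lx] \<sim> subst \<Phi> [Lx, Lx, Lx]" using * by simp }
    { assume "p @ subst \<Phi> [Lx, Lx, Lx] @ q \<sim> w"
      then obtain c where "set ?X \<subseteq> {c}" using power_ex[of p ?X "[]" "?X @ q"] by (simp; blast)
      then show "subst \<Phi> [Lx, Lx] \<sim> subst \<Phi> [Lx, Lx, Lx]" using * by simp }
  qed
  show "satisfies (Mw {w}) ([Lx, Ly i, Lx], [Ly i, Lx, Lx])"
  proof (rule satisfies_if_commute[of _ Lx "Ly i"])
    fix \<Phi> :: "letter \<Rightarrow> word" and p q
    let ?X = "\<Phi> Lx" and ?Y = "\<Phi> (Ly i)"
    show "?X @ ?Y = ?Y @ ?X" if z: "p @ subst \<Phi> [Lx, Ly i, Lx] @ q \<sim> w"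
    proof (cases "?X = []")
      case False
      obtain c where X: "set ?X \<subseteq> {c}" using power_ex[of p ?X ?Y q] z by (simp; blast)
      obtain X' where X': "?X = c # X'" "?X = X' @ [c]" using single_letter_ends[OF X False] .
      have "set ?Y \<subseteq> {c}"
      proof (rule ccontr)
        assume "\<not> set ?Y \<subseteq> {c}"
        then obtain A d B where Y: "?Y = A @ d # B" "d \<noteq> c" "\<forall>x\<in>set A. x = c"
          using split_list_first_prop[of ?Y "\<lambda>x. x \<noteq> c"] by (metis singletonI subsetI singletonD)
        have "set (X' @ A) \<subseteq> {c}" using X X' Y by auto
        then have "(X' @ A) @ [c] = [c] @ X' @ A" using single_letter_append_commute[of "X' @ A" c "[c]"] by simp
        then have "(p @ X' @ A) @ [c, d] @ (B @ ?X @ q) = p @ (c # X') @ (A @ d # B) @ ?X @ q"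
          by (simp add: append_eq_append_conv2)
        also have "\<dots> = p @ ?X @ ?Y @ ?X @ q" unfolding X'(1)[symmetric] Y(1)[symmetric] ..
        finally have eq: "(p @ X' @ A) @ [c, d] @ (B @ ?X @ q) = p @ ?X @ ?Y @ ?X @ q" .
        have "(p @ X' @ A) @ [c, d] @ (B @ ?X @ q) \<sim> w" unfolding eq using z by simp
        then obtain L R where "remdups_adj w = L @ [c] @ (d # R)" "insert d (set R) = insert d (set (B @ ?X @ q))"
          using split_adjacent Y(2) by (metis append_Cons append_Nil)
        then show False using no_repeat[of L c "d # R"] X' Y(2) by auto
      qed
      then show ?thesis using X single_letter_append_commute by metis
    qed simp
    show "?X @ ?Y = ?Y @ ?X" if z: "p @ subst \<Phi> [Ly i, Lx, Lx] @ q \<sim> w"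
    proof (cases "?X = []")
      case False
      obtain c where X: "set ?X \<subseteq> {c}" using power_ex[of "p @ ?Y" ?X "[]" q] z by (simp; blast)
      obtain X' where X': "?X = c # X'" using single_letter_ends[OF X False] .
      have cw: "c \<in> mul w" using mul_of_square_factor[of "p @ ?Y" ?X "[]" q w c] z X' by simp
      have "set ?Y \<subseteq> {c}"
      proof (rule ccontr)
        assume "\<not> set ?Y \<subseteq> {c}"
        then obtain A d B where Y: "?Y = A @ d # B" "d \<noteq> c" "\<forall>x\<in>set B. x = c"
          using split_list_last_prop[of ?Y "\<lambda>x. x \<noteq> c"] by (metis singletonI subsetI singletonD)
        have "set (B @ ?X) \<subseteq> {c}" "B @ ?X \<noteq> []" using X X' Y by auto
        then obtain Z where "B @ ?X = c # Z" using single_letter_ends by metis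
        then have "(p @ A) @ [d, c] @ (Z @ ?X @ q) = p @ A @ [d] @ (B @ ?X) @ ?X @ q" by simp
        also have "\<dots> = p @ ?Y @ ?X @ ?X @ q" using Y(1) by simp
        finally have eq: "(p @ A) @ [d, c] @ (Z @ ?X @ q) = p @ ?Y @ ?X @ ?X @ q" .
        have "(p @ A) @ [d, c] @ (Z @ ?X @ q) \<sim> w" unfolding eq using z by simp
        then show False using split_adjacent Y(2) initial cw by metis
      qed
      then show ?thesis using X single_letter_append_commute by metis
    qed simp
    show "subst \<Phi> [Lx, Ly i, Lx] = subst \<Phi> [Ly i, Lx, Lx]" if "?X @ ?Y = ?Y @ ?X"
      using that by simp
  qed
qed

end


section \<open>Derivations\<close>

lemma deriv_instance:
  "(u, v) \<in> \<Sigma> \<Longrightarrow> subst \<Phi> u = u' \<Longrightarrow> subst \<Phi> v = v' \<Longrightarrow> deriv \<Sigma> (p @ u' @ q) (p @ v' @ q)"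
  using deriv_ax by metis

text \<open>Handles \<open>id1\<close> to \<open>id4\<close>; only \<open>id5\<close> depends on the
  system.\<close>

lemma base_deriv:
  assumes \<Sigma>: "common_identities \<subseteq> \<Sigma>"
    and 5: "\<And>p x y T q. deriv \<Sigma> (p @ [x, x, y] @ T @ [y] @ q) (p @ [x, y, x] @ T @ [y] @ q)"
  shows "base (deriv \<Sigma>)"
proof (unfold_locales)
  fix p q T T1 T2 T3 :: word and x y :: letter
  show "deriv \<Sigma> (p @ [x] @ T @ [x] @ q) (p @ [x] @ T @ [x, x] @ q)"
    using deriv_ax[of "[Lx, Lt 0, Lx]" "[Lx, Lt 0, Lx, Lx]" \<Sigma> p "(\<lambda>_. [])(Lx := [x], Lt 0 := T)" q] \<Sigma>
    by (auto simp: common_identities_def)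
  show "deriv \<Sigma> (p @ [x, x, y, y] @ q) (p @ [y, y, x, x] @ q)"
    using deriv_ax[of "[Lx, Lx, Ly 0, Ly 0]" "[Ly 0, Ly 0, Lx, Lx]" \<Sigma> p "(\<lambda>_. [])(Lx := [x], Ly 0 := [y])" q] \<Sigma>
    by (auto simp: common_identities_def)
  show "deriv \<Sigma> (p @ [x, y] @ T @ [x, y] @ q) (p @ [y, x] @ T @ [x, y] @ q)"
    using deriv_ax[of "[Lx, Ly 0, Lt 0, Lx, Ly 0]" "[Ly 0, Lx, Lt 0, Lx, Ly 0]" \<Sigma> p "(\<lambda>_. [])(Lx := [x], Ly 0 := [y], Lt 0 := T)" q] \<Sigma>
    by (auto simp: common_identities_def)
  show "deriv \<Sigma> (p @ [x] @ T1 @ [x] @ T2 @ T3 @ [x] @ q) (p @ [x] @ T1 @ [x] @ T2 @ [x] @ T3 @ [x] @ q)"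
    using deriv_ax[of "[Lx, Lt 1, Lx, Lt 2, Lt 3, Lx]" "[Lx, Lt 1, Lx, Lt 2, Lx, Lt 3, Lx]" \<Sigma> p "(\<lambda>_. [])(Lx := [x], Lt 1 := T1, Lt 2 := T2, Lt 3 := T3)" q] \<Sigma>
    by (auto simp: common_identities_def)
qed (use 5 deriv_refl deriv_sym deriv_trans in blast)+

definition ids_F :: "(word \<times> word) set" where
  "ids_F = {
     ([Lx, Lx, Ly 0, Ly 0], [Ly 0, Ly 0, Lx, Lx]),
     ([Lx, Ly 0, Lt 0, Lx, Ly 0], [Ly 0, Lx, Lt 0, Lx, Ly 0]),
     ([Lx, Lt 0, Lx, Ls], [Lx, Lt 0, Lx, Ls, Lx])}"

definition ids_H :: "(word \<times> word) set" where
  "ids_H = common_identities \<union> {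
     ([Lx, Lx, Ly 0, Lt 0, Ly 0], [Lx, Ly 0, Lx, Lt 0, Ly 0]),
     ([Lx, Ly 0, Lx, Lt 0, Ly 0], [Ly 0, Lx, Lx, Lt 0, Ly 0])}"

definition ids_I :: "(word \<times> word) set" where
  "ids_I = common_identities \<union> {
     ([Lx, Lt 0, Lx, Ly 0, Ls, Ly 0], [Lx, Lt 0, Ly 0, Lx, Ls, Ly 0])}"

definition ids_J :: "(word \<times> word) set" where
  "ids_J = common_identities \<union> {(w_word n \<pi>, w'_word n \<pi>) | n \<pi>. \<pi> permutes {1..n}}"

text \<open>The identities of \<open>E\<close> read backwards, oriented as reversal produces
  them.\<close>

definition ids_dual_E :: "(word \<times> word) set" where
  "ids_dual_E = {
     ([Lx, Lx], [Lx, Lx, Lx]),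
     ([Lx, Ly 0, Lx], [Ly 0, Lx, Lx]),
     ([Ly 0, Ly 0, Lx, Lx], [Lx, Lx, Ly 0, Ly 0])}"

lemma var_ids: "var_F = var ids_F" "var_H = var ids_H" "var_I = var ids_I" "var_J = var ids_J"
  by (simp_all add: var_F_def ids_F_def var_H_def ids_H_def var_I_def ids_I_def var_J_def ids_J_def)

section \<open>Derivations for \<open>F\<close> and for the dual of \<open>E\<close>\<close>

lemma deriv_F:
  "deriv ids_F (p @ [x] @ T @ [x] @ S @ q) (p @ [x] @ T @ [x] @ S @ [x] @ q)"
  using deriv_ax[of "[Lx, Lt 0, Lx, Ls]" "[Lx, Lt 0, Lx, Ls, Lx]" ids_F p "(\<lambda>_. [])(Lx := [x], Lt 0 := T, Ls := S)" q]
  by (auto simp: ids_F_def)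

lemma insert_F: "count_list p x \<ge> 2 \<Longrightarrow> deriv ids_F (p @ q) (p @ [x] @ q)"
proof -
  assume "count_list p x \<ge> 2"
  then obtain p1 p2 p3 where "p = p1 @ [x] @ p2 @ [x] @ p3" using count_ge2_split by metis
  then show ?thesis using deriv_F[of p1 x p2 p3 q] by simp
qed

lemma base_F: "base (deriv ids_F)"
proof (unfold_locales)
  fix p q T T1 T2 T3 :: word and x y :: letter
  show "deriv ids_F (p @ [x] @ T @ [x] @ q) (p @ [x] @ T @ [x, x] @ q)"
    using deriv_F[of p x T "[]" q] by simp
  show "deriv ids_F (p @ [x, x, y, y] @ q) (p @ [y, y, x, x] @ q)"
    using deriv_ax[of "[Lx, Lx, Ly 0, Ly 0]" "[Ly 0, Ly 0, Lx, Lx]" ids_F p "(\<lambda>_. [])(Lx := [x], Ly 0 := [y])" q]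
    by (auto simp: ids_F_def)
  show 3: "deriv ids_F (p @ [x, y] @ T @ [x, y] @ q) (p @ [y, x] @ T @ [x, y] @ q)" for p T
    using deriv_ax[of "[Lx, Ly 0, Lt 0, Lx, Ly 0]" "[Ly 0, Lx, Lt 0, Lx, Ly 0]" ids_F p "(\<lambda>_. [])(Lx := [x], Ly 0 := [y], Lt 0 := T)" q]
    by (auto simp: ids_F_def)
  show "deriv ids_F (p @ [x] @ T1 @ [x] @ T2 @ T3 @ [x] @ q) (p @ [x] @ T1 @ [x] @ T2 @ [x] @ T3 @ [x] @ q)"
    using deriv_F[of p x T1 T2 "T3 @ [x] @ q"] by simp
  \<comment> \<open>For \<open>id5\<close>, a third \<open>x\<close> is inserted before the last
    \<open>y\<close>; xytxy = yxtxy then exchanges the inner letters, and the inserted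
    \<open>x\<close> is removed.\<close>
  have 1: "deriv ids_F (p @ [x, x, y] @ T @ [y] @ q) (p @ [x, x, y] @ T @ [x, y] @ q)"
    using deriv_F[of p x "[]" "[y] @ T" "[y] @ q"] by simp
  have 2: "deriv ids_F (p @ [x, x, y] @ T @ [x, y] @ q) (p @ [x, y, x] @ T @ [x, y] @ q)"
    using 3[of "p @ [x]" T] by simp
  have "deriv ids_F (p @ [x, y, x] @ T @ [y] @ q) (p @ [x, y, x] @ T @ [x, y] @ q)"
    using deriv_F[of p x "[y]" "T" "[y] @ q"] by simp
  then show "deriv ids_F (p @ [x, x, y] @ T @ [y] @ q) (p @ [x, y, x] @ T @ [y] @ q)"
    using 1 2 deriv_trans deriv_sym by blast
qed (use deriv_refl deriv_sym deriv_trans in blast)+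

text \<open>In both words the first of the two displayed positions of \<open>x\<close> is merged
  into its next occurrence, with the same result.\<close>

lemma move_dual_E:
  assumes "x \<in> set q"
  shows "deriv ids_dual_E (p @ [x, c] @ q) (p @ [c, x] @ q)"
proof -
  obtain q1 q2 where q: "q = q1 @ [x] @ q2" using count_list_conv_split[OF assms] by blast
  have *: "deriv ids_dual_E (p @ [x] @ T @ [x] @ q2) (p @ T @ [x, x] @ q2)" for p T
    using deriv_ax[of "[Lx, Ly 0, Lx]" "[Ly 0, Lx, Lx]" ids_dual_E p "(\<lambda>_. [])(Lx := [x], Ly 0 := T)" q2]
    by (auto simp: ids_dual_E_def)
  have "deriv ids_dual_E (p @ [x, c] @ q) (p @ ([c] @ q1) @ [x, x] @ q2)"
    using *[of p "[c] @ q1"] q by simp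
  moreover have "deriv ids_dual_E (p @ [c, x] @ q) (p @ ([c] @ q1) @ [x, x] @ q2)"
    using *[of "p @ [c]" q1] q by simp
  ultimately show ?thesis using deriv_trans deriv_sym by blast
qed

lemma base_dual_E: "base (deriv ids_dual_E)"
proof -
  have e1: "deriv ids_dual_E (p @ [x] @ T @ [x] @ q) (p @ T @ [x, x] @ q)" for p x T q
    using deriv_ax[of "[Lx, Ly 0, Lx]" "[Ly 0, Lx, Lx]" ids_dual_E p "(\<lambda>_. [])(Lx := [x], Ly 0 := T)" q]
    by (auto simp: ids_dual_E_def)
  have e2: "deriv ids_dual_E (p @ [x, x] @ q) (p @ [x, x, x] @ q)" for p x q
    using deriv_ax[of "[Lx, Lx]" "[Lx, Lx, Lx]" ids_dual_E p "(\<lambda>_. [])(Lx := [x])" q]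
    by (auto simp: ids_dual_E_def)
  show ?thesis
  proof (unfold_locales)
    fix p q T T1 T2 T3 :: word and x y :: letter
    have "deriv ids_dual_E (p @ [x] @ T @ [x, x] @ q) (p @ T @ [x, x, x] @ q)"
      using e1[of p x T "[x] @ q"] by simp
    moreover have "deriv ids_dual_E (p @ T @ [x, x] @ q) (p @ T @ [x, x, x] @ q)"
      using e2[of "p @ T" x q] by simp
    ultimately show "deriv ids_dual_E (p @ [x] @ T @ [x] @ q) (p @ [x] @ T @ [x, x] @ q)"
      using e1[of p x T q] deriv_trans deriv_sym by meson
    show "deriv ids_dual_E (p @ [x, x, y, y] @ q) (p @ [y, y, x, x] @ q)"
      using deriv_sym[OF deriv_ax[of "[Ly 0, Ly 0, Lx, Lx]" "[Lx, Lx, Ly 0, Ly 0]" ids_dual_E p "(\<lambda>_. [])(Lx := [x], Ly 0 := [y])" q]]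
      by (auto simp: ids_dual_E_def)
    show "deriv ids_dual_E (p @ [x, y] @ T @ [x, y] @ q) (p @ [y, x] @ T @ [x, y] @ q)"
      using move_dual_E[of x "T @ [x, y] @ q" p y] by simp
    have "deriv ids_dual_E (p @ [x] @ T1 @ [x] @ T2 @ [x] @ T3 @ [x] @ q) (p @ [x] @ T1 @ [x] @ T2 @ T3 @ [x, x] @ q)"
      using e1[of "p @ [x] @ T1 @ [x] @ T2" x T3 q] by simp
    moreover have "deriv ids_dual_E (p @ [x] @ T1 @ [x] @ T2 @ T3 @ [x] @ q) (p @ [x] @ T1 @ T2 @ T3 @ [x, x] @ q)"
      using e1[of "p @ [x] @ T1" x "T2 @ T3" q] by simp
    moreover have "deriv ids_dual_E (p @ [x] @ T1 @ [x] @ T2 @ T3 @ [x, x] @ q) (p @ [x] @ T1 @ T2 @ T3 @ [x, x, x] @ q)"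
      using e1[of "p @ [x] @ T1" x "T2 @ T3" "[x] @ q"] by simp
    moreover have "deriv ids_dual_E (p @ [x] @ T1 @ T2 @ T3 @ [x, x] @ q) (p @ [x] @ T1 @ T2 @ T3 @ [x, x, x] @ q)"
      using e2[of "p @ [x] @ T1 @ T2 @ T3" x q] by simp
    ultimately show "deriv ids_dual_E (p @ [x] @ T1 @ [x] @ T2 @ T3 @ [x] @ q) (p @ [x] @ T1 @ [x] @ T2 @ [x] @ T3 @ [x] @ q)"
      using deriv_trans deriv_sym by meson
    show "deriv ids_dual_E (p @ [x, x, y] @ T @ [y] @ q) (p @ [x, y, x] @ T @ [y] @ q)"
      using deriv_sym[OF move_dual_E[of y "T @ [y] @ q" "p @ [x]" x]] by simp
  qed (use deriv_refl deriv_sym deriv_trans in blast)+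
qed

section \<open>Derivations for \<open>H\<close>, \<open>I\<close> and \<open>J\<close>\<close>

lemma deriv_H:
  "deriv ids_H (p @ [x, x, y] @ T @ [y] @ q) (p @ [x, y, x] @ T @ [y] @ q)"
  "deriv ids_H (p @ [x, y, x] @ T @ [y] @ q) (p @ [y, x, x] @ T @ [y] @ q)"
  using deriv_ax[of "[Lx, Lx, Ly 0, Lt 0, Ly 0]" "[Lx, Ly 0, Lx, Lt 0, Ly 0]" ids_H p "(\<lambda>_. [])(Lx := [x], Ly 0 := [y], Lt 0 := T)" q]
    deriv_ax[of "[Lx, Ly 0, Lx, Lt 0, Ly 0]" "[Ly 0, Lx, Lx, Lt 0, Ly 0]" ids_H p "(\<lambda>_. [])(Lx := [x], Ly 0 := [y], Lt 0 := T)" q]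
  by (auto simp: ids_H_def)

lemma base_H: "base (deriv ids_H)"
proof (rule base_deriv)
  show "common_identities \<subseteq> ids_H" unfolding ids_H_def by blast
qed (rule deriv_H(1))

lemma deriv_I:
  "deriv ids_I (p @ [x] @ T @ [x, y] @ S @ [y] @ q) (p @ [x] @ T @ [y, x] @ S @ [y] @ q)"
  using deriv_ax[of "[Lx, Lt 0, Lx, Ly 0, Ls, Ly 0]" "[Lx, Lt 0, Ly 0, Lx, Ls, Ly 0]" ids_I p "(\<lambda>_. [])(Lx := [x], Ly 0 := [y], Lt 0 := T, Ls := S)" q]
  by (auto simp: ids_I_def)

lemma base_I: "base (deriv ids_I)"
proof (rule base_deriv)
  show "deriv ids_I (p @ [x, x, y] @ T @ [y] @ q) (p @ [x, y, x] @ T @ [y] @ q)" for p x y T q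
    using deriv_I[of p x "[]" y T q] by simp
qed (auto simp: ids_I_def)

lemma base_J: "base (deriv ids_J)"
proof (rule base_deriv)
  fix p q T x y
  \<comment> \<open>\<open>id5\<close> is the case n = 1 of the family, read from right to
    left.\<close>
  have "id permutes {1..(1::nat)}" by (rule permutes_id)
  then have "(w_word 1 id, w'_word 1 id) \<in> ids_J" unfolding ids_J_def by blast
  from deriv_ax[OF this, of p "(\<lambda>_. [])(Lx := [x], Ly 1 := [y], Lt 1 := T)" q]
  show "deriv ids_J (p @ [x, x, y] @ T @ [y] @ q) (p @ [x, y, x] @ T @ [y] @ q)"
    using deriv_sym by (simp add: w_word_def w'_word_def)
qed (auto simp: ids_J_def)

text \<open>In \<open>y c\<^sub>1 \<dots> c\<^sub>n y r\<close>, where all \<open>c\<^sub>i\<close> occur in \<open>r\<close>, these later occurrences are first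
  multiplied such that \<open>r\<close> provides one occurrence for every \<open>c\<^sub>i\<close>; then one of the identities
  \<open>w\<^sub>n(\<pi>) = w\<^sub>n'(\<pi>)\<close> applies.\<close>

lemma (in base) dup_many:
  assumes "x \<in> set p"
  shows "p @ [x] @ q \<doteq> p @ replicate (Suc n) x @ q"
  using assms
proof (induction n arbitrary: p)
  case 0
  then show ?case by (simp add: E_refl)
next
  case (Suc n)
  have "p @ [x] @ q \<doteq> p @ [x, x] @ q" using Suc.prems by (rule dup)
  moreover have "(p @ [x]) @ [x] @ q \<doteq> (p @ [x]) @ replicate (Suc n) x @ q" by (rule Suc.IH) simp
  then have "p @ [x, x] @ q \<doteq> p @ replicate (Suc (Suc n)) x @ q" by simp
  ultimately show ?case by (rule E_trans)
qed

text \<open>The list \<open>ds\<close> selects occurrences in \<open>r\<close>; as its letters occur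
  in \<open>g\<close>, each selected one is non-first and can be replaced by \<open>f d\<close>
  copies. The new \<open>r'\<close> does not depend on \<open>g\<close>, since it has to serve both
  sides of an identity.\<close>

lemma (in base) multiply:
  assumes "subseq ds r" "\<And>d. d \<in> set ds \<Longrightarrow> f d \<ge> 1"
  shows "\<exists>r'. subseq (concat (map (\<lambda>d. replicate (f d) d) ds)) r' \<and> (\<forall>g. set ds \<subseteq> set g \<longrightarrow> g @ r \<doteq> g @ r')"
  using assms
proof (induction r arbitrary: ds rule: list.induct)
  case Nil
  then have "ds = []" by (auto dest: list_emb_Nil2)
  then show ?case using E_refl by (intro exI[of _ "[]"]) simp
next
  case (Cons c r)
  show ?case
  proof (cases "ds = [] \<or> hd ds \<noteq> c")
    case True
    then have "subseq ds r" using Cons.prems(1) by (cases ds) auto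
    from Cons.IH[OF this Cons.prems(2)] obtain r' where
      r': "subseq (concat (map (\<lambda>d. replicate (f d) d) ds)) r'"
        "\<And>g. set ds \<subseteq> set g \<Longrightarrow> g @ r \<doteq> g @ r'" by blast
    have "g @ c # r \<doteq> g @ c # r'" if "set ds \<subseteq> set g" for g
      using r'(2)[of "g @ [c]"] that by auto
    then show ?thesis using r'(1) by (intro exI[of _ "c # r'"]) (auto simp: list_emb_Cons)
  next
    case False
    then obtain ds' where ds: "ds = c # ds'" by (cases ds) auto
    then have s: "subseq ds' r" using Cons.prems(1) by simp
    obtain n where n: "f c = Suc n" using Cons.prems(2)[of c] ds by (cases "f c") auto
    from Cons.IH[OF s] Cons.prems(2) ds obtain r' where
      r': "subseq (concat (map (\<lambda>d. replicate (f d) d) ds')) r'"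
        "\<And>g. set ds' \<subseteq> set g \<Longrightarrow> g @ r \<doteq> g @ r'"
      by auto
    have "g @ (c # r) \<doteq> g @ (replicate (Suc n) c @ r')" if g: "set ds \<subseteq> set g" for g
    proof -
      have d: "g @ [c] @ r \<doteq> g @ replicate (Suc n) c @ r" using g ds by (intro dup_many) auto
      have "(g @ replicate (Suc n) c) @ r \<doteq> (g @ replicate (Suc n) c) @ r'"
        using g ds by (intro r'(2)) auto
      then have "g @ replicate (Suc n) c @ r \<doteq> g @ replicate (Suc n) c @ r'" by simp
      from E_trans[OF d this] show ?thesis by simp
    qed
    moreover have "subseq (concat (map (\<lambda>d. replicate (f d) d) ds)) (replicate (Suc n) c @ r')"
      unfolding ds using r'(1) by (simp add: n list_emb_append_mono)
    ultimately show ?thesis by blast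
  qed
qed

text \<open>Gives \<open>r\<close> the shape t_1 y_1 t_2 y_2 ... of the tail of w_n, followed by a
  rest.\<close>

lemma subseq_interleave:
  "subseq es r \<Longrightarrow> \<exists>Ts R. length Ts = length es \<and> r = concat (map (\<lambda>i. Ts ! i @ [es ! i]) [0..<length es]) @ R"
proof (induction r arbitrary: es)
  case (Cons c r)
  show ?case
  proof (cases es)
    case Nil
    then show ?thesis by auto
  next
    case es: (Cons e es')
    show ?thesis
    proof (cases "e = c \<and> subseq es' r")
      case True
      then obtain Ts R where "length Ts = length es'" "r = concat (map (\<lambda>i. Ts ! i @ [es' ! i]) [0..<length es']) @ R"
        using Cons.IH by blast
      then show ?thesis using True
        by (intro exI[of _ "[] # Ts"] exI[of _ R]) (simp add: es map_upt_Suc del: upt_Suc)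
    next
      case False
      then have "subseq es r" using Cons.prems es by (auto split: if_splits)
      then obtain Ts R where T: "length Ts = length es" "r = concat (map (\<lambda>i. Ts ! i @ [es ! i]) [0..<length es]) @ R"
        using Cons.IH by blast
      then obtain T0 Ts' where "Ts = T0 # Ts'" using es by (cases Ts) auto
      then show ?thesis using T
        by (intro exI[of _ "(c # T0) # Ts'"] exI[of _ R]) (simp add: es map_upt_Suc del: upt_Suc)
    qed
  qed
qed (auto dest!: list_emb_Nil2)

text \<open>A substitution instance of w_n(\<pi>) = w'_n(\<pi>): y_i is the i-th letter of
  \<open>es\<close>, t_i the word in front of it, and \<pi> arranges these letters as
  \<open>cs\<close>.\<close>

lemma deriv_J_permutation:
  assumes "mset es = mset cs" "subseq es r"
  shows "deriv ids_J (p @ [y] @ cs @ [y] @ r) (p @ [y, y] @ cs @ r)"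
proof -
  define n where "n = length cs"
  have n: "length es = n" using assms(1) n_def by (metis size_mset)
  obtain \<sigma> where \<sigma>: "\<sigma> permutes {..<n}" "permute_list \<sigma> es = cs"
    using mset_eq_permutation[of cs es] assms(1) n by metis
  have cs: "cs ! i = es ! \<sigma> i" if "i < n" for i
    using \<sigma> that n permute_list_nth by metis
  obtain Ts R where r: "length Ts = n" "r = concat (map (\<lambda>i. Ts ! i @ [es ! i]) [0..<n]) @ R"
    using subseq_interleave[OF assms(2)] n by auto
  \<comment> \<open>List indices start at 0 and those of the identities at 1, hence the shift of
    \<sigma>.\<close>
  define \<pi> where "\<pi> i = (if i \<in> {1..n} then Suc (\<sigma> (i - 1)) else i)" for i
  have "bij_betw \<pi> {1..n} {1..n}"
  proof -
    have "bij_betw \<sigma> {..<n} {..<n}" using \<sigma>(1) by (rule permutes_imp_bij)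
    moreover have "bij_betw Suc {..<n} {1..n}"
      by (rule bij_betw_byWitness[where f' = "\<lambda>i. i - 1"]) auto
    moreover have "bij_betw (\<lambda>i. i - 1) {1..n} {..<n}"
      by (rule bij_betw_byWitness[where f' = Suc]) auto
    ultimately have "bij_betw (Suc \<circ> \<sigma> \<circ> (\<lambda>i. i - 1)) {1..n} {1..n}"
      using bij_betw_trans by blast
    then show ?thesis by (rule bij_betw_cong[THEN iffD1, rotated]) (simp add: \<pi>_def)
  qed
  then have "\<pi> permutes {1..n}" by (intro bij_imp_permutes) (auto simp: \<pi>_def)
  then have id: "(w_word n \<pi>, w'_word n \<pi>) \<in> ids_J" unfolding ids_J_def by blast
  define \<Phi> where "\<Phi> c = (case c of Lx \<Rightarrow> [y] | Ly i \<Rightarrow> [es ! (i - 1)] | Lt i \<Rightarrow> Ts ! (i - 1) | Ls \<Rightarrow> [])" for c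
  have up: "map F [1..<n + 1] = map (\<lambda>i. F (Suc i)) [0..<n]" for F :: "nat \<Rightarrow> 'z"
    by (simp add: map_Suc_upt[symmetric] comp_def del: upt_Suc)
  have "subst \<Phi> (map (\<lambda>i. Ly (\<pi> i)) [1..<n + 1]) = concat (map (\<lambda>i. [es ! \<sigma> i]) [0..<n])"
    unfolding up subst_def map_map by (intro arg_cong[of _ _ concat] map_cong) (auto simp: \<Phi>_def \<pi>_def)
  also have "\<dots> = map (\<lambda>i. cs ! i) [0..<n]" using cs by (simp add: concat_map_singleton)
  also have "\<dots> = cs" unfolding n_def by (rule map_nth)
  finally have Y: "subst \<Phi> (map (\<lambda>i. Ly (\<pi> i)) [1..<n + 1]) = cs" .
  have "subst \<Phi> (concat (map F is)) = concat (map (\<lambda>i. subst \<Phi> (F i)) is)" for F and "is" :: "nat list"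
    by (induction "is") auto
  then have T: "subst \<Phi> (concat (map (\<lambda>i. [Lt i, Ly i]) [1..<n + 1])) = concat (map (\<lambda>i. Ts ! i @ [es ! i]) [0..<n])"
    unfolding up by (simp add: \<Phi>_def)
  have "deriv ids_J (p @ ([y] @ cs @ [y] @ concat (map (\<lambda>i. Ts ! i @ [es ! i]) [0..<n])) @ R)
      (p @ ([y, y] @ cs @ concat (map (\<lambda>i. Ts ! i @ [es ! i]) [0..<n])) @ R)"
  proof (rule deriv_instance[OF id])
    show "subst \<Phi> (w_word n \<pi>) = [y] @ cs @ [y] @ concat (map (\<lambda>i. Ts ! i @ [es ! i]) [0..<n])"
      unfolding w_word_def subst_simps Y T by (simp add: \<Phi>_def)
    show "subst \<Phi> (w'_word n \<pi>) = [y, y] @ cs @ concat (map (\<lambda>i. Ts ! i @ [es ! i]) [0..<n])"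
      unfolding w'_word_def subst_simps Y T by (simp add: \<Phi>_def)
  qed
  then show ?thesis using r by simp
qed

lemma deriv_J:
  assumes "set cs \<subseteq> set r"
  shows "deriv ids_J (p @ [y] @ cs @ [y] @ r) (p @ [y, y] @ cs @ r)"
proof -
  interpret base "deriv ids_J" by (rule base_J)
  define ds where "ds = filter (\<lambda>d. d \<in> set cs) (remdups r)"
  have ds: "distinct ds" "set ds = set cs" using assms by (auto simp: ds_def)
  have "subseq (remdups r) r" by (induction r) auto
  then have sub: "subseq ds r" unfolding ds_def using subseq_filter_left subseq_order.trans by blast
  \<comment> \<open>Each letter gets as many later occurrences as it has in \<open>cs\<close>, so
    that \<open>es\<close> is a rearrangement of \<open>cs\<close>.\<close>
  define es where "es = concat (map (\<lambda>d. replicate (count_list cs d) d) ds)"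
  have "count (mset es) c = count (mset cs) c" for c
  proof -
    have "count (mset (concat (map (\<lambda>d. replicate (count_list cs d) d) xs))) c = (if c \<in> set xs then count_list cs c else 0)"
      if "distinct xs" for xs using that by (induction xs) auto
    then have "count (mset es) c = (if c \<in> set cs then count_list cs c else 0)"
      using ds es_def by simp
    then show ?thesis by (auto simp: count_mset count_list_0_iff)
  qed
  then have ms: "mset es = mset cs" by (rule multiset_eqI)
  have ge: "count_list cs d \<ge> 1" if "d \<in> set ds" for d
    using that ds(2) count_list_0_iff[of cs d] by (metis One_nat_def Suc_leI gr0I)
  obtain r' where r': "subseq es r'" "\<And>g. set cs \<subseteq> set g \<Longrightarrow> deriv ids_J (g @ r) (g @ r')"
    using multiply[of ds r "count_list cs", OF sub ge] ds(2) unfolding es_def by auto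
  have 1: "deriv ids_J (p @ [y] @ cs @ [y] @ r) (p @ [y] @ cs @ [y] @ r')"
    using r'(2)[of "p @ [y] @ cs @ [y]"] by auto
  have 2: "deriv ids_J (p @ [y, y] @ cs @ r) (p @ [y, y] @ cs @ r')"
    using r'(2)[of "p @ [y, y] @ cs"] by auto
  show ?thesis
    by (rule deriv_trans[OF deriv_trans[OF 1 deriv_J_permutation[OF ms r'(1)]] deriv_sym[OF 2]])
qed


section \<open>The generating monoids\<close>

lemma var_eq_generated_variety:
  assumes A: "monoid A" "\<forall>e\<in>\<Sigma>. satisfies A e"
    and complete: "\<And>u v. satisfies A (u, v) \<Longrightarrow> deriv \<Sigma> u v"
  shows "var \<Sigma> = generated_variety {A}"
proof -
  have "(\<forall>e\<in>\<Sigma>. satisfies M e) \<longleftrightarrow> (\<forall>u v. satisfies A (u, v) \<longrightarrow> satisfies M (u, v))"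
    if "monoid M" for M :: "'m monoid"
  proof
    assume "\<forall>e\<in>\<Sigma>. satisfies M e"
    then show "\<forall>u v. satisfies A (u, v) \<longrightarrow> satisfies M (u, v)"
      using complete deriv_sound that by blast
  next
    assume *: "\<forall>u v. satisfies A (u, v) \<longrightarrow> satisfies M (u, v)"
    show "\<forall>e\<in>\<Sigma>. satisfies M e"
    proof
      fix e assume "e \<in> \<Sigma>"
      then show "satisfies M e" using A(2) * by (cases e) auto
    qed
  qed
  then show ?thesis using generated_variety_eq[of "{A}"] A(1) unfolding var_def by auto
qed

lemma isolates_1_1: "fac W (X @ Y) \<Longrightarrow> \<not> X @ Y \<sim> Y @ X \<Longrightarrow> isolates W 1 1"
  unfolding isolates_def around_def pow_def
  by (intro exI[of _ X] exI[of _ Y]) (auto simp: le_Suc_eq)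

text \<open>The four values are listed separately so that each case becomes a comparison of concrete
  words.\<close>

lemma isolates_3:
  defines "A k X Y \<equiv> concat (replicate k X) @ Y @ concat (replicate (3 - k) X)"
  assumes "k \<le> 3" "fac W (A k X Y)" "k = 0 \<or> \<not> A k X Y \<sim> A 0 X Y" "k = 1 \<or> \<not> A k X Y \<sim> A 1 X Y"
    "k = 2 \<or> \<not> A k X Y \<sim> A 2 X Y" "k = 3 \<or> \<not> A k X Y \<sim> A 3 X Y"
  shows "isolates W 3 k"
proof -
  have "\<not> A k X Y \<sim> A l X Y" if "l \<le> 3" "l \<noteq> k" for l
  proof -
    have "l = 0 \<or> l = 1 \<or> l = 2 \<or> l = 3" using that(1) by auto
    then show ?thesis using assms(4-7) that(2) by auto
  qed
  then show ?thesis using assms(3) unfolding isolates_def around_def pow_def A_def by blast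
qed

locale four_letters =
  fixes a b t s :: letter
  assumes distinct: "distinct [a, b, t, s]"
begin

lemma neq: "a \<noteq> b" "a \<noteq> t" "a \<noteq> s" "b \<noteq> t" "b \<noteq> s" "t \<noteq> s"
    "b \<noteq> a" "t \<noteq> a" "s \<noteq> a" "t \<noteq> b" "s \<noteq> b" "s \<noteq> t"
  using distinct by auto

text \<open>Representatives of the generating classes, with aa for a^+ and bb for b^+.\<close>

definition "wF = [a, t, a, a]"
definition "wE = [a, a, t]"
definition "wH = [a, b, t, a, a, s, b, b]"
definition "wI = [b, a, a, s, b, b]"
definition "wJ = [a, t, b, a, a, s, b, b]"

lemmas w_defs = wF_def wE_def wH_def wI_def wJ_def

section \<open>Combinatorics of the concrete words\<close>

lemma mul_words:
  "mul wF = {a}" "mul wE = {a}" "mul wH = {a, b}" "mul wI = {a, b}" "mul wJ = {a, b}"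
  using neq by (auto simp: mul_def w_defs split: if_splits)

lemma remdups_words:
  "remdups_adj wF = [a, t, a]" "remdups_adj wE = [a, t]" "remdups_adj wH = [a, b, t, a, s, b]"
  "remdups_adj wI = [b, a, s, b]" "remdups_adj wJ = [a, t, b, a, s, b]"
  using neq by (simp_all add: w_defs)

lemmas split_simps = append_eq_Cons_conv Cons_eq_append_conv

lemma shape_F: "shape wF"
proof
  show "c \<noteq> d \<Longrightarrow> cnt2 c d wF \<le> 1" for c d using neq by (auto simp: w_defs)
  show "c \<notin> set L \<and> \<not> fta c wF" if "remdups_adj wF = L @ [c] @ R" "c \<in> set R" for L c R
    using that neq unfolding remdups_words by (auto simp: split_simps w_defs)
qed (auto simp del: mem_mul simp: mul_words remdups_words split_simps neq)

lemma shape_E: "shape wE"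
proof
  show "c \<noteq> d \<Longrightarrow> cnt2 c d wE \<le> 1" for c d using neq by (auto simp: w_defs)
  show "c \<notin> set L \<and> \<not> fta c wE" if "remdups_adj wE = L @ [c] @ R" "c \<in> set R" for L c R
    using that neq unfolding remdups_words by (auto simp: split_simps w_defs)
qed (auto simp del: mem_mul simp: mul_words remdups_words split_simps neq)

lemma shape_H: "shape wH"
proof
  show "c \<noteq> d \<Longrightarrow> cnt2 c d wH \<le> 1" for c d using neq by (auto simp: w_defs)
  show "c \<notin> set L \<and> \<not> fta c wH" if "remdups_adj wH = L @ [c] @ R" "c \<in> set R" for L c R
    using that neq unfolding remdups_words by (auto simp: split_simps w_defs)
  show "c \<in> set R" if "remdups_adj wH = L @ [c, d] @ R" "c \<in> mul wH" "d \<in> mul wH" for L c d R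
    using that neq unfolding remdups_words mul_words by (auto simp: split_simps)
  show "cnt2 c d wH = 0 \<or> cnt2 d c wH = 0" if "c \<noteq> d" "c \<in> mul wH" "d \<in> mul wH" for c d
    using that neq unfolding mul_words by (auto simp: w_defs)
qed (auto simp del: mem_mul simp: mul_words remdups_words split_simps neq)

lemma shape_I: "shape wI"
proof
  show "c \<noteq> d \<Longrightarrow> cnt2 c d wI \<le> 1" for c d using neq by (auto simp: w_defs)
  show "c \<notin> set L \<and> \<not> fta c wI" if "remdups_adj wI = L @ [c] @ R" "c \<in> set R" for L c R
    using that neq unfolding remdups_words by (auto simp: split_simps w_defs)
  show "c \<in> set R" if "remdups_adj wI = L @ [c, d] @ R" "c \<in> mul wI" "d \<in> mul wI" for L c d R
    using that neq unfolding remdups_words mul_words by (auto simp: split_simps)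
  show "cnt2 c d wI = 0 \<or> cnt2 d c wI = 0" if "c \<noteq> d" "c \<in> mul wI" "d \<in> mul wI" for c d
    using that neq unfolding mul_words by (auto simp: w_defs)
qed (auto simp del: mem_mul simp: mul_words remdups_words split_simps neq)

lemma shape_J: "shape wJ"
proof
  show "c \<noteq> d \<Longrightarrow> cnt2 c d wJ \<le> 1" for c d using neq by (auto simp: w_defs)
  show "c \<notin> set L \<and> \<not> fta c wJ" if "remdups_adj wJ = L @ [c] @ R" "c \<in> set R" for L c R
    using that neq unfolding remdups_words by (auto simp: split_simps w_defs)
  show "c \<in> set R" if "remdups_adj wJ = L @ [c, d] @ R" "c \<in> mul wJ" "d \<in> mul wJ" for L c d R
    using that neq unfolding remdups_words mul_words by (auto simp: split_simps)
  show "cnt2 c d wJ = 0 \<or> cnt2 d c wJ = 0" if "c \<noteq> d" "c \<in> mul wJ" "d \<in> mul wJ" for c d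
    using that neq unfolding mul_words by (auto simp: w_defs)
qed (auto simp del: mem_mul simp: mul_words remdups_words split_simps neq)

text \<open>The witnesses at, taaa and ataa are factors of ata^+ up to \<lambda>.\<close>

lemma iso_F: "isolates {wF} 1 1" "isolates {wF} 3 0" "isolates {wF} 3 1"
  subgoal by (rule isolates_1_1[of _ "[a]" "[t]"], rule fac1I[of "[]" _ "[a, a]"]) (simp_all add: neq w_defs lam_iff_set)
  subgoal by (rule isolates_3[of _ _ "[a]" "[t]"], simp, rule fac1I[of "[a]" _ "[]"])
      (simp_all add: neq w_defs lam_iff_set numeral_2_eq_2 numeral_3_eq_3)
  subgoal by (rule isolates_3[of _ _ "[a]" "[t]"], simp, rule fac1I[of "[]" _ "[]"])
      (simp_all add: neq w_defs lam_iff_set numeral_2_eq_2 numeral_3_eq_3)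
  done

lemma iso_E: "isolates {wE} 1 1" "isolates {wE} 3 3"
  subgoal by (rule isolates_1_1[of _ "[a]" "[t]"], rule fac1I[of "[a]" _ "[]"]) (simp_all add: neq w_defs lam_iff_set)
  subgoal by (rule isolates_3[of _ _ "[a]" "[t]"], simp, rule fac1I[of "[]" _ "[]"])
      (simp_all add: neq w_defs lam_iff_set numeral_2_eq_2 numeral_3_eq_3)
  done

text \<open>For three occurrences, b is tested against the separator taas (taasbbb for the value 0,
  btaasbb for 1), and a against s (aaas for 3). For one occurrence ab is used.\<close>

lemma iso_H: "full_iso {wH}"
  unfolding full_iso_def
  apply (intro conjI)
  subgoal by (rule isolates_1_1[of _ "[a]" "[b]"], rule fac1I[of "[]" _ "[t, a, a, s, b, b]"]) (simp_all add: neq w_defs lam_iff_set)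
  subgoal by (rule isolates_3[of _ _ "[b]" "[t, a, a, s]"], simp, rule fac1I[of "[a, b]" _ "[]"])
      (simp_all add: neq w_defs lam_iff_set numeral_2_eq_2 numeral_3_eq_3)
  subgoal by (rule isolates_3[of _ _ "[b]" "[t, a, a, s]"], simp, rule fac1I[of "[a]" _ "[]"])
      (simp_all add: neq w_defs lam_iff_set numeral_2_eq_2 numeral_3_eq_3)
  subgoal by (rule isolates_3[of _ _ "[a]" "[s]"], simp, rule fac1I[of "[a, b, t]" _ "[b, b]"])
      (simp_all add: neq w_defs lam_iff_set numeral_2_eq_2 numeral_3_eq_3)
  done

lemma iso_I: "full_iso {wI}"
  unfolding full_iso_def
  apply (intro conjI)
  subgoal by (rule isolates_1_1[of _ "[b]" "[a]"], rule fac1I[of "[]" _ "[a, s, b, b]"]) (simp_all add: neq w_defs lam_iff_set)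
  subgoal by (rule isolates_3[of _ _ "[b]" "[a, a, s]"], simp, rule fac1I[of "[b]" _ "[]"])
      (simp_all add: neq w_defs lam_iff_set numeral_2_eq_2 numeral_3_eq_3)
  subgoal by (rule isolates_3[of _ _ "[b]" "[a, a, s]"], simp, rule fac1I[of "[]" _ "[]"])
      (simp_all add: neq w_defs lam_iff_set numeral_2_eq_2 numeral_3_eq_3)
  subgoal by (rule isolates_3[of _ _ "[a]" "[s]"], simp, rule fac1I[of "[b]" _ "[b, b]"])
      (simp_all add: neq w_defs lam_iff_set numeral_2_eq_2 numeral_3_eq_3)
  done

lemma iso_J: "full_iso {wJ}"
  unfolding full_iso_def
  apply (intro conjI)
  subgoal by (rule isolates_1_1[of _ "[b]" "[a]"], rule fac1I[of "[a, t]" _ "[a, s, b, b]"]) (simp_all add: neq w_defs lam_iff_set)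
  subgoal by (rule isolates_3[of _ _ "[b]" "[a, a, s]"], simp, rule fac1I[of "[a, t, b]" _ "[]"])
      (simp_all add: neq w_defs lam_iff_set numeral_2_eq_2 numeral_3_eq_3)
  subgoal by (rule isolates_3[of _ _ "[b]" "[a, a, s]"], simp, rule fac1I[of "[a, t]" _ "[]"])
      (simp_all add: neq w_defs lam_iff_set numeral_2_eq_2 numeral_3_eq_3)
  subgoal by (rule isolates_3[of _ _ "[a]" "[s]"], simp, rule fac1I[of "[a, t, b]" _ "[b, b]"])
      (simp_all add: neq w_defs lam_iff_set numeral_2_eq_2 numeral_3_eq_3)
  done

lemma fac_words:
  "fac {wF} [a, a, a]" "fac {wE} [a, a, a]" "fac {wH} [a, a, a]" "fac {wI} [a, a, a]" "fac {wJ} [a, a, a]"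
  "fac {wH} [a, b, t, a, a, s, b, b]" "fac {wI} [b, a, a, a, s, b, b]" "fac {wJ} [b, a, a, a, s, b, b]"
  "fac {wJ} [a, t, b, a, a, s, b, b]"
  subgoal by (rule fac1I[of "[a, t]" _ "[]"]) (simp add: neq w_defs lam_iff_set)
  subgoal by (rule fac1I[of "[]" _ "[t]"]) (simp add: neq w_defs lam_iff_set)
  subgoal by (rule fac1I[of "[a, b, t]" _ "[s, b, b]"]) (simp add: neq w_defs lam_iff_set)
  subgoal by (rule fac1I[of "[b]" _ "[s, b, b]"]) (simp add: neq w_defs lam_iff_set)
  subgoal by (rule fac1I[of "[a, t, b]" _ "[s, b, b]"]) (simp add: neq w_defs lam_iff_set)
  subgoal by (rule fac1I[of "[]" _ "[]"]) (simp add: w_defs)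
  subgoal by (rule fac1I[of "[]" _ "[]"]) (simp add: neq w_defs lam_iff_set)
  subgoal by (rule fac1I[of "[a, t]" _ "[]"]) (simp add: neq w_defs lam_iff_set)
  subgoal by (rule fac1I[of "[]" _ "[]"]) (simp add: w_defs)
  done

section \<open>Soundness and completeness for the concrete words\<close>

lemma base_modelI:
  assumes "base (deriv \<Sigma>)" "fac {w} [a, a, a]" "\<forall>e\<in>\<Sigma>. satisfies (Mw {w}) e"
  shows "base_model (deriv \<Sigma>) {w} a b t s"
proof -
  have "satisfies (Mw {w}) (u, v)" if "deriv \<Sigma> u v" for u v
    using deriv_sound[OF that monoid_Mw assms(3)] by simp
  then show ?thesis
    using assms(1,2) distinct by (simp add: base_model_def base_model_axioms_def)
qed

lemma sat_ids_F: "\<forall>e\<in>ids_F. satisfies (Mw {wF}) e"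
proof -
  interpret shape wF by (rule shape_F)
  have "c \<notin> set L \<and> \<not> fta c wF" if "remdups_adj wF = L @ [c] @ R" "R \<noteq> []" for L c R
    using that neq unfolding remdups_words by (auto simp: split_simps w_defs)
  then show ?thesis using sat_id2 sat_id3 sat_F by (auto simp: ids_F_def)
qed

lemma sat_ids_dual_E: "\<forall>e\<in>ids_dual_E. satisfies (Mw {wE}) e"
proof -
  interpret shape wE by (rule shape_E)
  have "c \<notin> set R" if "remdups_adj wE = L @ [c] @ R" for L c R
    using that neq unfolding remdups_words by (auto simp: split_simps w_defs)
  moreover have "c \<notin> mul wE" if "remdups_adj wE = L @ [d, c] @ R" for L d c R
    using that neq unfolding remdups_words mul_words by (auto simp: split_simps w_defs)
  ultimately show ?thesis
    using sat_E satisfies_sym[OF sat_id2] by (auto simp del: mem_mul simp: ids_dual_E_def)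
qed

lemma sat_ids_H: "\<forall>e\<in>ids_H. satisfies (Mw {wH}) e"
proof -
  interpret shape wH by (rule shape_H)
  have "c \<notin> set L \<and> \<not> fta c wH" if "remdups_adj wH = L @ [d, c] @ R" "c \<in> mul wH" "d \<in> mul wH" for L c d R
    using that neq unfolding remdups_words mul_words by (auto simp: split_simps w_defs)
  then show ?thesis using sat_common sat_H by (auto simp del: mem_mul simp: ids_H_def)
qed

lemma sat_ids_I: "\<forall>e\<in>ids_I. satisfies (Mw {wI}) e"
proof -
  interpret shape wI by (rule shape_I)
  have "c \<notin> set L" if "remdups_adj wI = L @ [d, c] @ R" "c \<in> mul wI" "d \<in> mul wI" for L c d R
    using that neq unfolding remdups_words mul_words by (auto simp: split_simps w_defs)
  then show ?thesis using sat_common sat_I by (auto simp del: mem_mul simp: ids_I_def)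
qed

lemma sat_ids_J: "\<forall>e\<in>ids_J. satisfies (Mw {wJ}) e"
proof -
  interpret shape wJ by (rule shape_J)
  show ?thesis using sat_common sat_J by (auto simp: ids_J_def)
qed

theorem var_F_eq: "var_F = generated_variety {Mw {wF}}"
proof -
  have "base_model (deriv ids_F) {wF} a b t s" by (rule base_modelI[OF base_F fac_words(1) sat_ids_F])
  then have "F_model (deriv ids_F) {wF} a b t s"
    using insert_F by (simp add: F_model_def F_model_axioms_def)
  from F_model.complete_F[OF this iso_F] show ?thesis
    unfolding var_ids by (intro var_eq_generated_variety monoid_Mw sat_ids_F) auto
qed

theorem var_H_eq: "var_H = generated_variety {Mw {wH}}"
proof -
  have m: "base_model (deriv ids_H) {wH} a b t s" by (rule base_modelI[OF base_H fac_words(3) sat_ids_H])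
  interpret base "deriv ids_H" by (rule base_H)
  have "deriv ids_H (p @ [x, y] @ q) (p @ [y, x] @ q)" if x: "x \<in> set p" "y \<in> set q" for x y p q
  proof -
    obtain q1 q2 where q: "q = q1 @ [y] @ q2" using count_list_conv_split x(2) by metis
    \<comment> \<open>The non-first \<open>x\<close> is doubled, the square crosses \<open>y\<close>
      by the two identities of \<open>H\<close>, and one copy is removed again.\<close>
    have 1: "deriv ids_H (p @ [x] @ [y] @ q) (p @ [x, x] @ [y] @ q)" using x by (intro dup)
    have 2: "deriv ids_H (p @ [x, x, y] @ q) (p @ [y, x, x] @ q)"
      using deriv_trans[OF deriv_H(1) deriv_H(2)] q by simp
    have 3: "deriv ids_H ((p @ [y]) @ [x] @ q) ((p @ [y]) @ [x, x] @ q)" using x by (intro dup) simp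
    show ?thesis using deriv_trans[OF 1] 2 deriv_sym[OF 3] deriv_trans by simp
  qed
  then have "H_model (deriv ids_H) {wH} a b t s"
    using m deriv_H(2)
    by (simp add: H_model_def H_model_axioms_def nf_model_def nf_model_axioms_def)
  from H_model.complete_H[OF this iso_H fac_words(6)] show ?thesis
    unfolding var_ids by (intro var_eq_generated_variety monoid_Mw sat_ids_H) auto
qed

theorem var_I_eq: "var_I = generated_variety {Mw {wI}}"
proof -
  have m: "base_model (deriv ids_I) {wI} a b t s" by (rule base_modelI[OF base_I fac_words(4) sat_ids_I])
  have "deriv ids_I (p @ [x, y] @ q) (p @ [y, x] @ q)" if x: "x \<in> set p" "y \<in> set q" for x y p q
  proof -
    obtain q1 q2 where q: "q = q1 @ [y] @ q2" using count_list_conv_split x(2) by metis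
    obtain p1 p2 where p: "p = p1 @ [x] @ p2" using count_list_conv_split x(1) by metis
    show ?thesis using deriv_I[of p1 x p2 y q1 q2] p q by simp
  qed
  then have "nf_model (deriv ids_I) {wI} a b t s"
    using m by (simp add: nf_model_def nf_model_axioms_def)
  from nf_model.complete_I[OF this iso_I fac_words(7)] show ?thesis
    unfolding var_ids by (intro var_eq_generated_variety monoid_Mw sat_ids_I) auto
qed

theorem var_J_eq: "var_J = generated_variety {Mw {wJ}}"
proof -
  have "base_model (deriv ids_J) {wJ} a b t s" by (rule base_modelI[OF base_J fac_words(5) sat_ids_J])
  then have "J_model (deriv ids_J) {wJ} a b t s"
    using deriv_J by (simp add: J_model_def J_model_axioms_def)
  from J_model.complete_J[OF this iso_J fac_words(8,9)] show ?thesis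
    unfolding var_ids by (intro var_eq_generated_variety monoid_Mw sat_ids_J) auto
qed

lemma complete_dual_E: "satisfies (Mw {wE}) (u, v) \<Longrightarrow> deriv ids_dual_E u v"
proof -
  have "base_model (deriv ids_dual_E) {wE} a b t s"
    by (rule base_modelI[OF base_dual_E fac_words(2) sat_ids_dual_E])
  then have "E_model (deriv ids_dual_E) {wE} a b t s"
    using move_dual_E by (simp add: E_model_def E_model_axioms_def)
  from E_model.complete_E[OF this iso_E]
  show "satisfies (Mw {wE}) (u, v) \<Longrightarrow> deriv ids_dual_E u v" .
qed

end


section \<open>The cardinalities\<close>

text \<open>Each class of factors has a member inside a cube-free word, which leaves only finitely
  many candidates to count.\<close>

definition cube_free :: "word \<Rightarrow> bool" where
  "cube_free u \<longleftrightarrow> (\<nexists>A c B. u = A @ [c, c, c] @ B)"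

lemma cube_lam: "A @ [c, c, c] @ B \<sim> A @ [c, c] @ B"
  using lam_append3[OF powers_lam[of 3 2 c]] by (simp add: numeral_2_eq_2 numeral_3_eq_3)

lemma shorten_tail:
  assumes "x @ q = us @ [c, c, c] @ B"
  shows "\<exists>x' q'. x' \<sim> x \<and> x' @ q' = us @ [c, c] @ B"
proof -
  from assms consider vs where "us = x @ vs" "q = vs @ [c, c, c] @ B"
    | vs where "x = us @ vs" "vs @ q = [c, c, c] @ B"
    by (auto simp: append_eq_append_conv2)
  then show ?thesis
  proof cases
    case 1
    then show ?thesis by (intro exI[of _ x] exI[of _ "vs @ [c, c] @ B"]) simp
  next
    case 2
    consider "vs = []" "q = [c, c, c] @ B" | "vs = [c]" "q = [c, c] @ B" | "vs = [c, c]" "q = [c] @ B"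
      | vs' where "vs = [c, c, c] @ vs'" "vs' @ q = B"
      using 2(2) by (auto simp: append_eq_Cons_conv)
    then show ?thesis
    proof cases
      case 1
      then show ?thesis using 2 by (intro exI[of _ x] exI[of _ "[c, c] @ B"]) simp
    next
      case b: 2
      then show ?thesis using 2 by (intro exI[of _ x] exI[of _ "[c] @ B"]) simp
    next
      case 3
      then show ?thesis using 2 by (intro exI[of _ x] exI[of _ B]) simp
    next
      case 4
      then show ?thesis using 2 cube_lam[of us c vs'] lam_sym
        by (intro exI[of _ "us @ [c, c] @ vs'"] exI[of _ q]) auto
    qed
  qed
qed

text \<open>One letter of the cube is deleted, outside \<open>x\<close> unless the whole cube lies
  in \<open>x\<close>; in the latter case the \<lambda>-class of \<open>x\<close> is kept.\<close>

lemma shorten_factor: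
  assumes "p @ x @ q = A @ [c, c, c] @ B"
  shows "\<exists>p' x' q'. x' \<sim> x \<and> p' @ x' @ q' = A @ [c, c] @ B"
proof -
  from assms consider us where "p = A @ us" "us @ x @ q = [c, c, c] @ B"
    | us where "x @ q = us @ [c, c, c] @ B" "A = p @ us"
    by (auto simp: append_eq_append_conv2)
  then show ?thesis
  proof cases
    case 1
    show ?thesis
    proof (cases us)
      case Nil
      then obtain x' q' where "x' \<sim> x" "x' @ q' = [] @ [c, c] @ B"
        using 1(2) shorten_tail[of x q "[]" c B] by auto
      then show ?thesis by (intro exI[of _ A] exI[of _ x'] exI[of _ q']) simp
    next
      case (Cons d us')
      then show ?thesis using 1 by (intro exI[of _ "A @ us'"] exI[of _ x] exI[of _ q]) simp
    qed
  next
    case 2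
    from shorten_tail[OF 2(1)] obtain x' q' where "x' \<sim> x" "x' @ q' = us @ [c, c] @ B" by blast
    then show ?thesis using 2(2) by (intro exI[of _ p] exI[of _ x'] exI[of _ q']) simp
  qed
qed

lemma factor_of_cube_free:
  assumes "p @ x @ q \<sim> w"
  shows "\<exists>p' x' q'. x' \<sim> x \<and> p' @ x' @ q' \<sim> w \<and> cube_free (p' @ x' @ q')"
  using assms
proof (induction "length (p @ x @ q)" arbitrary: p x q rule: less_induct)
  case less
  show ?case
  proof (cases "cube_free (p @ x @ q)")
    case True
    then show ?thesis using less.prems by (intro exI[of _ p] exI[of _ x] exI[of _ q]) simp
  next
    case False
    then obtain A c B where z: "p @ x @ q = A @ [c, c, c] @ B" unfolding cube_free_def by blast
    from shorten_factor[OF z] obtain p' x' q' where x': "x' \<sim> x" "p' @ x' @ q' = A @ [c, c] @ B" by blast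
    have "length (p' @ x' @ q') < length (p @ x @ q)" unfolding z x'(2) by simp
    moreover have "p' @ x' @ q' \<sim> w"
      using less.prems lam_trans[OF lam_sym[OF cube_lam]] unfolding z x'(2) by blast
    ultimately show ?thesis using less.hyps x'(1) lam_trans by meson
  qed
qed

lemma cube_free_Cons: "cube_free (c # u) \<Longrightarrow> cube_free u"
  unfolding cube_free_def by (metis append_Cons)

text \<open>Unfolds a cube-free word block by block, each block having one or two letters.\<close>

lemma cube_free_remdups_Cons:
  assumes "remdups_adj z = c # cs" "cube_free z"
  shows "\<exists>z'. (z = c # z' \<or> z = c # c # z') \<and> remdups_adj z' = cs \<and> cube_free z'"
proof -
  obtain z1 where z: "z = c # z1" using assms(1)
    by (metis hd_remdups_adj list.collapse list.sel(1) list.distinct(1) remdups_adj_Nil_iff)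
  show ?thesis
  proof (cases "z1 = [] \<or> hd z1 \<noteq> c")
    case True
    then have "remdups_adj z1 = cs" using assms(1) z by (cases z1) auto
    then show ?thesis using z assms(2) cube_free_Cons by blast
  next
    case False
    then obtain z2 where z2: "z1 = c # z2" by (cases z1) auto
    show ?thesis
    proof (cases "z2 = [] \<or> hd z2 \<noteq> c")
      case True
      then have "remdups_adj z2 = cs" using assms(1) z z2 by (cases z2) auto
      then show ?thesis using z z2 assms(2) cube_free_Cons by blast
    next
      case False
      then obtain z3 where "z2 = c # z3" by (cases z2) auto
      then have "z = [] @ [c, c, c] @ z3" using z z2 by simp
      then show ?thesis using assms(2) unfolding cube_free_def by blast
    qed
  qed
qed

text \<open>The factors of the words in \<open>rs\<close> represent all nonzero elements,
  \<open>K\<close> is a complete invariant for them, and the successor accounts for the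
  zero.\<close>

lemma card_Mw:
  assumes reps: "\<And>z. z \<sim> w \<Longrightarrow> cube_free z \<Longrightarrow> \<exists>r\<in>set rs. sublist z r" "\<And>r. r \<in> set rs \<Longrightarrow> r \<sim> w"
    and K: "\<And>u v. u \<in> set L \<Longrightarrow> v \<in> set L \<Longrightarrow> u \<sim> v \<longleftrightarrow> K u = K v"
    and L: "L = concat (map sublists rs)"
  shows "card (carrier (Mw {w})) = Suc (card (set (map K L)))"
proof -
  have "down_set lam (cls ` {w}) = cls ` set L"
  proof -
    have "\<exists>y\<in>set L. cls x = cls y" if x: "fac {w} x" for x
    proof -
      obtain p q where "p @ x @ q \<sim> w" using x by (auto simp: fac_def)
      from factor_of_cube_free[OF this] obtain p' x' q' where
        x': "x' \<sim> x" "p' @ x' @ q' \<sim> w" "cube_free (p' @ x' @ q')" by blast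
      then obtain r where r: "r \<in> set rs" "sublist (p' @ x' @ q') r" using reps(1) by blast
      then have "sublist x' r" using sublist_appendI sublist_order.order_trans by metis
      then have "x' \<in> set L" using r(1) L by auto
      then show ?thesis using x'(1) lam_sym by (auto simp only: cls_eq_iff)
    qed
    moreover have "fac {w} y" if y: "y \<in> set L" for y
    proof -
      obtain r where r: "r \<in> set rs" "sublist y r" using y L by auto
      then obtain p q where "r = p @ y @ q" by (auto simp: sublist_def)
      then show ?thesis using reps(2)[OF r(1)] by (auto simp: fac_def)
    qed
    ultimately have "A \<in> down_set lam (cls ` {w}) \<longleftrightarrow> A \<in> cls ` set L" for A
      unfolding fac_down_set by (auto simp only: image_iff)
    then show ?thesis by blast
  qed
  moreover have "carrier (Mw {w}) = insert None (Some ` down_set lam (cls ` {w}))"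
    by (simp add: M_monoid_def)
  ultimately have "card (carrier (Mw {w})) = Suc (card (cls ` set L))"
    by (simp add: card_image image_iff)
  also have "card (cls ` set L) = card (K ` set L)"
  proof (rule bij_betw_same_card)
    show "bij_betw (\<lambda>A. K (SOME u. u \<in> set L \<and> cls u = A)) (cls ` set L) (K ` set L)"
    proof -
      have k: "K (SOME v. v \<in> set L \<and> cls v = cls u) = K u" if "u \<in> set L" for u
      proof -
        have "\<exists>v. v \<in> set L \<and> cls v = cls u" using that by blast
        from someI_ex[OF this] show ?thesis using K that unfolding cls_eq_iff by blast
      qed
      have "inj_on (\<lambda>A. K (SOME u. u \<in> set L \<and> cls u = A)) (cls ` set L)"
      proof (rule inj_onI)
        fix A B
        assume "A \<in> cls ` set L" "B \<in> cls ` set L"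
          and eq: "K (SOME u. u \<in> set L \<and> cls u = A) = K (SOME u. u \<in> set L \<and> cls u = B)"
        then obtain u v where uv: "A = cls u" "u \<in> set L" "B = cls v" "v \<in> set L" by blast
        have "K u = K v" using eq unfolding uv(1,3) k[OF uv(2)] k[OF uv(4)] .
        then show "A = B" unfolding uv(1,3) cls_eq_iff using K uv(2,4) by blast
      qed
      moreover have "(\<lambda>A. K (SOME u. u \<in> set L \<and> cls u = A)) ` cls ` set L = K ` set L"
        unfolding image_image by (rule image_cong) (simp_all add: k)
      ultimately show ?thesis by (simp add: bij_betw_def)
    qed
  qed
  finally show ?thesis by simp
qed

context four_letters
begin

text \<open>A numerical complete invariant of the \<open>\<lambda>\<close>-classes of words over the four letters: the
  words involved are encoded in base 5, because numerals are compared faster than words.\<close>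

fun code :: "word \<Rightarrow> nat" where
  "code [] = 0"
| "code (c # w) = (if c = a then 1 else if c = b then 2 else if c = t then 3 else 4) + 5 * code w"

lemma code_inj: "set u \<subseteq> {a, b, t, s} \<Longrightarrow> set v \<subseteq> {a, b, t, s} \<Longrightarrow> code u = code v \<Longrightarrow> u = v"
proof (induction u arbitrary: v)
  case Nil
  then show ?case by (cases v) (simp_all split: if_splits)
next
  case (Cons c u)
  define dig where "dig c = (if c = a then 1 else if c = b then 2 else if c = t then 3 else (4::nat))" for c
  have code: "code (c # u) = dig c + 5 * code u" for c u by (simp add: dig_def)
  have d: "0 < dig c" "dig c < 5" for c by (auto simp: dig_def)
  from Cons.prems(3) d[of c] obtain c' v' where v: "v = c' # v'" by (cases v) (auto simp: code simp del: code.simps(2))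
  have eq: "dig c + 5 * code u = dig c' + 5 * code v'" using Cons.prems(3) unfolding v code .
  then have "dig c = dig c'" "code u = code v'" using d[of c] d[of c'] by presburger+
  moreover have "c = c'" using \<open>dig c = dig c'\<close> Cons.prems(1,2) v neq by (auto simp: dig_def split: if_splits)
  ultimately show ?case using Cons.IH[of v'] Cons.prems(1,2) v by auto
qed

definition key :: "word \<Rightarrow> nat \<times> nat \<times> nat" where
  "key u = (code (remdups_adj u), code (filter (\<lambda>c. count_list u c \<ge> 2) [a, b, t, s]),
    code (filter (\<lambda>c. fta c u) [a, b, t, s]))"

lemma key_iff:
  assumes "set u \<subseteq> {a, b, t, s}" "set v \<subseteq> {a, b, t, s}"
  shows "u \<sim> v \<longleftrightarrow> key u = key v"
proof -
  have f: "filter P [a, b, t, s] = filter Q [a, b, t, s] \<longleftrightarrow> (\<forall>c\<in>{a, b, t, s}. P c \<longleftrightarrow> Q c)" for P Q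
    using neq by auto
  have cf: "code (filter P [a, b, t, s]) = code (filter Q [a, b, t, s]) \<longleftrightarrow> (\<forall>c\<in>{a, b, t, s}. P c \<longleftrightarrow> Q c)" for P Q
    unfolding f[symmetric] by (rule iffI, rule code_inj) auto
  have cr: "code (remdups_adj u) = code (remdups_adj v) \<longleftrightarrow> remdups_adj u = remdups_adj v"
    using code_inj[of "remdups_adj u" "remdups_adj v"] assms by auto
  have n: "fta c w \<Longrightarrow> c \<in> set w" "count_list w c \<ge> 2 \<Longrightarrow> c \<in> set w" for c w
    using count_list_0_iff[of w c] by (induction w) (auto split: if_splits)
  show ?thesis
    unfolding lam_iff_set key_def prod.inject cf cr using assms n by blast
qed

lemma card_I: "card (carrier (Mw {wI})) = 19"
proof -
  have 1: "\<exists>r\<in>set [wI]. sublist z r" if "z \<sim> wI" "cube_free z" for z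
  proof -
    have "remdups_adj z = [b, a, s, b]" using that(1) remdups_words by (simp add: lam_iff)
    from cube_free_remdups_Cons[OF this that(2)] obtain z1 where z1: "z = b # z1 \<or> z = b # b # z1"
      "remdups_adj z1 = [a, s, b]" "cube_free z1" by blast
    from cube_free_remdups_Cons[OF z1(2,3)] obtain z2 where z2: "z1 = a # z2 \<or> z1 = a # a # z2"
      "remdups_adj z2 = [s, b]" "cube_free z2" by blast
    from cube_free_remdups_Cons[OF z2(2,3)] obtain z3 where z3: "z2 = s # z3 \<or> z2 = s # s # z3"
      "remdups_adj z3 = [b]" "cube_free z3" by blast
    from cube_free_remdups_Cons[OF z3(2,3)] obtain z4 where z4: "z3 = b # z4 \<or> z3 = b # b # z4"
      "remdups_adj z4 = []" by blast
    \<comment> \<open>Only the length of the last block is free: the first two b are not adjacent, a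
      is multiple, and s is simple.\<close>
    have z: "z \<in> {[b, a, a, s, b], [b, a, a, s, b, b]}"
      using that(1) z1(1) z2(1) z3(1) z4 by (elim disjE) (simp_all add: lam_iff_set w_defs neq)
    have "sublist [b, a, a, s, b] ([b, a, a, s, b] @ [b])" by (rule sublist_append_rightI)
    then show ?thesis using z by (auto simp: w_defs)
  qed
  have "card (carrier (Mw {wI})) = Suc (card (set (map key (concat (map sublists [wI])))))"
  proof (rule card_Mw[OF 1 _ key_iff refl])
    show "set u \<subseteq> {a, b, t, s}" if "u \<in> set (concat (map sublists [wI]))" for u
      using that set_mono_sublist[of u wI] by (auto simp: w_defs)
    then show "set u \<subseteq> {a, b, t, s}" if "u \<in> set (concat (map sublists [wI]))" for u
      using that .
  qed simp_all
  also have "card (set (map key (concat (map sublists [wI])))) = 18"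
    by (simp add: w_defs key_def neq card_insert_if)
  finally show ?thesis by simp
qed

text \<open>The first two a are not adjacent in the generating word, so its second block of a may
  have one or two letters; two representatives are taken because their factors ba and baa are
  different classes. By length of the collapse there are 1, 6, 8, 9, 5, 3 and 1 nonzero classes, 33
  in all.\<close>

lemma card_J: "card (carrier (Mw {wJ})) = 34"
proof -
  let ?rs = "[[a, t, b, a, s, b, b], [a, t, b, a, a, s, b, b]]"
  have 1: "\<exists>r\<in>set ?rs. sublist z r" if "z \<sim> wJ" "cube_free z" for z
  proof -
    have "remdups_adj z = [a, t, b, a, s, b]" using that(1) remdups_words by (simp add: lam_iff)
    from cube_free_remdups_Cons[OF this that(2)] obtain z1 where z1: "z = a # z1 \<or> z = a # a # z1"
      "remdups_adj z1 = [t, b, a, s, b]" "cube_free z1" by blast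
    from cube_free_remdups_Cons[OF z1(2,3)] obtain z2 where z2: "z1 = t # z2 \<or> z1 = t # t # z2"
      "remdups_adj z2 = [b, a, s, b]" "cube_free z2" by blast
    from cube_free_remdups_Cons[OF z2(2,3)] obtain z3 where z3: "z2 = b # z3 \<or> z2 = b # b # z3"
      "remdups_adj z3 = [a, s, b]" "cube_free z3" by blast
    from cube_free_remdups_Cons[OF z3(2,3)] obtain z4 where z4: "z3 = a # z4 \<or> z3 = a # a # z4"
      "remdups_adj z4 = [s, b]" "cube_free z4" by blast
    from cube_free_remdups_Cons[OF z4(2,3)] obtain z5 where z5: "z4 = s # z5 \<or> z4 = s # s # z5"
      "remdups_adj z5 = [b]" "cube_free z5" by blast
    from cube_free_remdups_Cons[OF z5(2,3)] obtain z6 where z6: "z5 = b # z6 \<or> z5 = b # b # z6"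
      "remdups_adj z6 = []" by blast
    have a1: "\<not> fta a z" and b1: "\<not> fta b z" and t1: "count_list z t < 2" and s1: "count_list z s < 2"
    proof -
      have "fta c z = fta c wJ" "c \<in> mul z \<longleftrightarrow> c \<in> mul wJ" for c using that(1) unfolding lam_iff by blast+
      note m = this
      have "t \<notin> mul z" "s \<notin> mul z" unfolding m(2) mul_words using neq by auto
      moreover have "\<not> fta a z" "\<not> fta b z" unfolding m(1) using neq by (simp_all add: wJ_def)
      ultimately have "\<not> fta a z" "\<not> fta b z" "t \<notin> mul z" "s \<notin> mul z" by auto
      then show "\<not> fta a z" "\<not> fta b z" "count_list z t < 2" "count_list z s < 2"
        by simp_all
    qed
    have z1': "z = a # z1" using z1(1) a1 by auto
    have z2': "z1 = t # z2" using z2(1) t1 z1' neq by auto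
    have z3': "z2 = b # z3" using z3(1) b1 z1' z2' neq by auto
    have z5': "z4 = s # z5" using z5(1) s1 z1' z2' z3' z4(1) neq by auto
    have z: "z = [a, t, b] @ ([a] @ [s] @ [b]) \<or> z = [a, t, b] @ ([a, a] @ [s] @ [b]) \<or> z \<in> set ?rs"
      using z1' z2' z3' z4(1) z5' z6 by auto
    have "sublist [a, t, b, a, s, b] ([a, t, b, a, s, b] @ [b])"
      "sublist [a, t, b, a, a, s, b] ([a, t, b, a, a, s, b] @ [b])" by (rule sublist_append_rightI)+
    then show ?thesis using z by auto
  qed
  have "card (carrier (Mw {wJ})) = Suc (card (set (map key (concat (map sublists ?rs)))))"
  proof (rule card_Mw[OF 1 _ key_iff refl])
    have rs: "set r \<subseteq> {a, b, t, s}" if "r \<in> set ?rs" for r using that by auto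
    show *: "set u \<subseteq> {a, b, t, s}" if u: "u \<in> set (concat (map sublists ?rs))" for u
    proof -
      obtain r where "r \<in> set ?rs" "u \<in> set (sublists r)"
        using u unfolding set_concat set_map by blast
      then show ?thesis using rs[of r] set_mono_sublist[of u r] unfolding set_sublists_eq by blast
    qed
    show "set u \<subseteq> {a, b, t, s}" if "u \<in> set (concat (map sublists ?rs))" for u using *[OF that] .
    fix r assume "r \<in> set ?rs"
    then have "r = [a, t, b, a, s, b, b] \<or> r = [a, t, b, a, a, s, b, b]" by simp
    then show "r \<sim> wJ" by (elim disjE) (simp_all add: lam_iff_set w_defs neq)
  qed
  also have "card (set (map key (concat (map sublists ?rs)))) = 33"
    by (simp add: key_def neq card_insert_if)
  finally show ?thesis by simp
qed

end


section \<open>Joins and duals\<close>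

lemma generated_variety_single:
  "monoid A \<Longrightarrow> generated_variety {A} =
    {M. monoid M \<and> (\<forall>u v. satisfies A (u, v) \<longrightarrow> satisfies M (u, v))}"
  using generated_variety_eq[of "{A}"] by simp

lemma satisfies_union:
  assumes "finite W" "W \<noteq> {}" "finite W'" "W' \<noteq> {}"
  shows "satisfies (Mw (W \<union> W')) (u, v) \<longleftrightarrow> satisfies (Mw W) (u, v) \<and> satisfies (Mw W') (u, v)"
proof -
  have "fac (W \<union> W') x \<longleftrightarrow> fac W x \<or> fac W' x" for x by (auto simp: fac_def)
  then show ?thesis using assms by (subst (1 2 3) satisfies_Mw) auto
qed

lemma satisfies_mono:
  assumes "finite W" "W \<noteq> {}" "finite W'" "W' \<noteq> {}" "\<And>x. fac W x \<Longrightarrow> fac W' x" "satisfies (Mw W') (u, v)"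
  shows "satisfies (Mw W) (u, v)"
  using assms(5,6) unfolding satisfies_Mw[OF assms(1,2)] satisfies_Mw[OF assms(3,4)] by blast

lemma mprod_hom:
  assumes "\<And>x y. x \<in> carrier A \<Longrightarrow> y \<in> carrier A \<Longrightarrow> h (x \<otimes>\<^bsub>A\<^esub> y) = h x \<otimes>\<^bsub>B\<^esub> h y"
    and "h \<one>\<^bsub>A\<^esub> = \<one>\<^bsub>B\<^esub>" "monoid A" "set xs \<subseteq> carrier A"
  shows "h (mprod A xs) = mprod B (map h xs)"
  using assms(4) by (induction xs) (simp_all add: assms(1,2) mprod_closed[OF assms(3)])

lemma satisfies_inj_hom:
  assumes h: "\<And>x y. x \<in> carrier A \<Longrightarrow> y \<in> carrier A \<Longrightarrow> h (x \<otimes>\<^bsub>A\<^esub> y) = h x \<otimes>\<^bsub>B\<^esub> h y"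
    "h \<one>\<^bsub>A\<^esub> = \<one>\<^bsub>B\<^esub>" "h ` carrier A \<subseteq> carrier B" "inj_on h (carrier A)"
    and A: "monoid A" and B: "satisfies B e"
  shows "satisfies A e"
proof -
  obtain u v where e: "e = (u, v)" by (cases e)
  show ?thesis unfolding e
  proof (rule satisfiesI)
    fix \<phi> assume \<phi>: "\<And>x::letter. \<phi> x \<in> carrier A"
    then have sub: "set (map \<phi> w) \<subseteq> carrier A" for w by auto
    have "mprod B (map (\<lambda>x. h (\<phi> x)) u) = mprod B (map (\<lambda>x. h (\<phi> x)) v)"
      using B[unfolded e] h(3) \<phi> by (intro satisfiesD) auto
    then have "h (mprod A (map \<phi> u)) = h (mprod A (map \<phi> v))"
      using mprod_hom[of A h B, OF h(1,2) A sub] by (simp add: comp_def)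
    then show "mprod A (map \<phi> u) = mprod A (map \<phi> v)"
      using h(4) mprod_closed[OF A sub] by (auto dest: inj_onD)
  qed
qed

text \<open>Transport of structure along an injection; it provides members of the varieties over the
  given universe with the same identities as the generating monoids.\<close>

lemma countable_copy:
  fixes M :: "'k monoid"
  assumes M: "monoid M" and c: "countable (carrier M)" and inf: "infinite (UNIV :: 'm set)"
  obtains A :: "'m monoid" where "monoid A" "\<And>e. satisfies A e \<longleftrightarrow> satisfies M e"
proof -
  obtain g :: "nat \<Rightarrow> 'm" where g: "inj g" using infinite_countable_subset[OF inf] by auto
  define f where "f = g \<circ> to_nat_on (carrier M)"
  have f: "inj_on f (carrier M)"
    unfolding f_def using c g by (intro comp_inj_on inj_on_to_nat_on) (auto intro: inj_on_subset)
  define i where "i = inv_into (carrier M) f"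
  have i: "i (f x) = x" if "x \<in> carrier M" for x using f that by (simp add: i_def)
  define A where "A = \<lparr>carrier = f ` carrier M, monoid.mult = (\<lambda>x y. f (i x \<otimes>\<^bsub>M\<^esub> i y)), one = f \<one>\<^bsub>M\<^esub>\<rparr>"
  have A: "monoid A"
    by (rule monoidI) (auto simp: A_def i M monoid.m_closed monoid.one_closed monoid.l_one monoid.r_one monoid.m_assoc)
  have "satisfies A e \<longleftrightarrow> satisfies M e" for e
  proof
    assume "satisfies A e"
    then show "satisfies M e"
      by (rule satisfies_inj_hom[where h = f, rotated -1])
        (use f M in \<open>auto simp: A_def i\<close>)
  next
    assume "satisfies M e"
    then show "satisfies A e"
      by (rule satisfies_inj_hom[where h = i, rotated -1])
        (use A M i in \<open>auto simp: A_def inj_on_def monoid.m_closed monoid.one_closed\<close>)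
  qed
  then show ?thesis using A that by blast
qed

section \<open>Opposite monoids and dual varieties\<close>

lemma mprod_opposite:
  "monoid M \<Longrightarrow> set xs \<subseteq> carrier M \<Longrightarrow> mprod (opposite M) xs = mprod M (rev xs)"
  by (induction xs) (auto simp: opposite_def mprod_append monoid.r_one)

lemma monoid_opposite: "monoid M \<Longrightarrow> monoid (opposite M)"
  by (rule monoidI) (auto simp: opposite_def monoid.m_closed monoid.one_closed monoid.l_one monoid.r_one monoid.m_assoc)

lemma satisfies_opposite:
  assumes "monoid M"
  shows "satisfies (opposite M) (u, v) \<longleftrightarrow> satisfies M (rev u, rev v)"
proof -
  have "mprod (opposite M) (map \<phi> w) = mprod M (map \<phi> (rev w))" if "\<And>x::letter. \<phi> x \<in> carrier M" for \<phi> w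
    using mprod_opposite[OF assms, of "map \<phi> w"] that by (auto simp: rev_map)
  moreover have "carrier (opposite M) = carrier M" by (simp add: opposite_def)
  ultimately show ?thesis unfolding satisfies_def by simp
qed

text \<open>Passing to the opposite monoid reverses the words of an identity, and doing so twice
  gives back the monoid.\<close>

lemma dual_variety_var:
  "dual_variety (var \<Sigma>) = var ((\<lambda>(u, v). (rev u, rev v)) ` \<Sigma>)"
proof (intro Set.set_eqI iffI)
  fix M :: "'m monoid"
  assume "M \<in> dual_variety (var \<Sigma>)"
  then obtain N :: "'m monoid" where M: "monoid M" and N: "monoid N" "\<forall>e\<in>\<Sigma>. satisfies N e" and "M \<cong> opposite N"
    unfolding dual_variety_def var_def by blast
  then obtain h where h: "h \<in> iso M (opposite N)" unfolding is_iso_def by blast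
  have oN: "monoid (opposite N)" using N(1) by (rule monoid_opposite)
  have hm: "h (x \<otimes>\<^bsub>M\<^esub> y) = h x \<otimes>\<^bsub>opposite N\<^esub> h y" if "x \<in> carrier M" "y \<in> carrier M" for x y
    using h that by (auto simp: iso_def hom_def)
  have bij: "bij_betw h (carrier M) (carrier (opposite N))" using h by (simp add: iso_def)
  obtain x where x: "x \<in> carrier M" "h x = \<one>\<^bsub>opposite N\<^esub>"
    using bij monoid.one_closed[OF oN] by (metis bij_betw_imp_surj_on imageE)
  have c: "h \<one>\<^bsub>M\<^esub> \<in> carrier (opposite N)"
    using bij monoid.one_closed[OF M] by (auto simp: bij_betw_def)
  have "h \<one>\<^bsub>M\<^esub> \<otimes>\<^bsub>opposite N\<^esub> h x = h x"
    using hm[OF monoid.one_closed[OF M] x(1)] M x(1) by (simp add: monoid.l_one)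
  then have one: "h \<one>\<^bsub>M\<^esub> = \<one>\<^bsub>opposite N\<^esub>" using x(2) c oN by (simp add: monoid.r_one)
  have "satisfies M (rev u, rev v)" if "(u, v) \<in> \<Sigma>" for u v
  proof (rule satisfies_inj_hom[OF hm one])
    show "satisfies (opposite N) (rev u, rev v)" using N that by (auto simp: satisfies_opposite)
  qed (use bij M in \<open>auto simp: bij_betw_def\<close>)
  then show "M \<in> var ((\<lambda>(u, v). (rev u, rev v)) ` \<Sigma>)" using M by (auto simp: var_def)
next
  fix M :: "'m monoid"
  assume "M \<in> var ((\<lambda>(u, v). (rev u, rev v)) ` \<Sigma>)"
  then have M: "monoid M" "\<And>u v. (u, v) \<in> \<Sigma> \<Longrightarrow> satisfies M (rev u, rev v)" by (force simp: var_def)+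
  have "opposite M \<in> var \<Sigma>" using M monoid_opposite by (auto simp: var_def satisfies_opposite)
  moreover have "opposite (opposite M) = M" by (simp add: opposite_def)
  then have "M \<cong> opposite (opposite M)" by (simp add: iso_refl)
  ultimately show "M \<in> dual_variety (var \<Sigma>)" using M(1) unfolding dual_variety_def by blast
qed

lemma dual_var_E: "dual_variety var_E = var ids_dual_E"
  unfolding var_E_def dual_variety_var ids_dual_E_def by simp

text \<open>Truncation at 2 is compatible with sums and with multiplication by a fixed
  number.\<close>

lemma min_2_length_subst:
  assumes "\<And>c. min 2 (count_list u c) = min 2 (count_list v c)"
  shows "min 2 (length (subst \<Phi> u)) = min 2 (length (subst \<Phi> v))"
proof -
  have len: "length (subst \<Phi> w) = (\<Sum>c\<in>set u \<union> set v. count_list w c * length (\<Phi> c))"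
    if "set w \<subseteq> set u \<union> set v" for w
    using that
  proof (induction w)
    case (Cons x w)
    have "(\<Sum>c\<in>set u \<union> set v. count_list (x # w) c * length (\<Phi> c)) =
        (\<Sum>c\<in>set u \<union> set v. count_list w c * length (\<Phi> c) + (if c = x then length (\<Phi> c) else 0))"
      by (rule sum.cong) auto
    then show ?case using Cons by (simp add: sum.distrib)
  qed simp
  have mm: "min 2 (m * l) = min 2 (n * l)" if "min 2 m = min 2 n" for m n l :: nat
  proof (cases "l = 0 \<or> m = n")
    case False
    then have "m \<ge> 2" "n \<ge> 2" "l \<ge> 1" using that by auto
    then have "m * l \<ge> 2" "n * l \<ge> 2" by (metis mult_le_mono mult.right_neutral)+
    then show ?thesis by simp
  qed auto
  have ma: "min 2 (m + k) = min 2 (n + l)" if "min 2 m = min 2 n" "min 2 k = min 2 l" for m n k l :: nat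
    using that by (auto simp: min_def split: if_splits)
  have "min 2 (\<Sum>c\<in>S. count_list u c * length (\<Phi> c)) = min 2 (\<Sum>c\<in>S. count_list v c * length (\<Phi> c))"
    if "finite S" for S
    using that by (induction S) (auto intro!: ma mm assms)
  then show ?thesis by (simp add: len)
qed

context four_letters
begin

section \<open>Comparison of ata^+ and a^+t with a^+ta^+\<close>

definition "wA = [a, a, t, a, a]"

lemma subst_two:
  assumes "c \<noteq> z" "z \<notin> set w1" "z \<notin> set w2"
  shows "subst (\<lambda>x. if x = c then [a] else if x = z then [t] else []) (w1 @ [z] @ w2) =
    replicate (count_list w1 c) a @ [t] @ replicate (count_list w2 c) a"
proof -
  have "subst (\<lambda>x. if x = c then [a] else if x = z then [t] else []) w = replicate (count_list w c) a"
    if "z \<notin> set w" for w using that by (induction w) auto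
  then show ?thesis using assms by simp
qed

text \<open>The first letter tells whether \<open>k\<close> is 0, and adjacency of the first two a
  distinguishes 1 from larger exponents.\<close>

lemma lam_power_left:
  assumes "replicate k a @ [t] @ replicate m a \<sim> replicate k' a @ [t] @ replicate m' a" "k \<le> 1"
  shows "k' = k"
proof -
  have "hd (remdups_adj (replicate k a @ [t] @ replicate m a)) = hd (remdups_adj (replicate k' a @ [t] @ replicate m' a))"
    using assms(1) unfolding lam_iff by simp
  then have h: "k = 0 \<longleftrightarrow> k' = 0" using neq by (cases k; cases k') auto
  have f: "fta a (replicate k a @ [t] @ replicate m a) \<longleftrightarrow> fta a (replicate k' a @ [t] @ replicate m' a)"
    using assms(1) unfolding lam_iff by blast
  show ?thesis
  proof (cases k)
    case 0
    then show ?thesis using h by simp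
  next
    case (Suc k0)
    then have k: "k = 1" using assms(2) by simp
    obtain k1 where k1: "k' = Suc k1" using h k by (cases k') auto
    show ?thesis using f neq k k1 by (cases k1) auto
  qed
qed

lemma lam_power_right:
  assumes "replicate k a @ [t] @ replicate m a \<sim> replicate k' a @ [t]"
  shows "m = 0"
proof -
  have "last (remdups_adj (replicate k a @ [t] @ replicate m a)) = last (remdups_adj (replicate k' a @ [t]))"
    using assms unfolding lam_iff by simp
  then show ?thesis using neq by (cases "m = 0") (simp_all add: last_append)
qed

lemma fac_wE:
  assumes "set A \<subseteq> {a}"
  shows "fac {wE} A" "fac {wE} (A @ [t])"
proof -
  have "[a] @ ([a] @ A) @ [t] \<sim> [a] @ [a] @ [t]" using assms by (intro dup_lam') auto
  then have *: "[a, a] @ A @ [t] \<sim> wE" by (simp add: wE_def)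
  show "fac {wE} A" by (rule fac1I[OF *])
  show "fac {wE} (A @ [t])" by (rule fac1I[of "[a, a]" _ "[]"]) (use * in simp)
qed

lemma fac_wF:
  assumes "set A \<subseteq> {a}" "length A \<le> 1" "set B \<subseteq> {a}"
  shows "fac {wF} (A @ [t] @ B)"
proof -
  have "[a, t] @ (B @ [a, a]) @ [] \<sim> [a, t] @ [a, a] @ []" using assms by (intro dup_lam'[of a]) auto
  then have *: "[a, t] @ B @ [a, a] \<sim> wF" by (simp add: wF_def)
  have "A = [] \<or> A = [a]" using assms(1,2) by (cases A) auto
  then show ?thesis
  proof
    assume "A = []"
    then show ?thesis using fac1I[of "[a]" "[t] @ B" "[a, a]"] * by simp
  next
    assume "A = [a]"
    then show ?thesis using fac1I[of "[]" "[a, t] @ B" "[a, a]"] * by simp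
  qed
qed

lemma lam_wA:
  assumes "set A \<subseteq> {a}" "length A \<ge> 2" "set B \<subseteq> {a}" "B \<noteq> []"
  shows "A @ [t] @ B \<sim> wA"
proof -
  have r: "A = replicate (length A) a" using assms(1) single_letter[of A a] by (rule iffD1[rotated])
  have "A \<sim> [a, a]" using powers_lam[OF assms(2), of 2 a] by (subst r) (simp add: numeral_2_eq_2)
  then have "A @ [t] @ B \<sim> [a, a] @ [t] @ B" by (intro lam_append) simp_all
  moreover have "[a, a, t] @ B @ [] \<sim> [a, a, t] @ [a, a] @ []" using assms by (intro dup_lam') auto
  then have "[a, a] @ [t] @ B \<sim> wA" by (simp add: wA_def)
  ultimately show ?thesis by (rule lam_trans)
qed

lemma lam_wA_D:
  assumes "p @ x @ q \<sim> wA" "t \<in> set x"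
  obtains A B where "x = A @ [t] @ B" "set A \<subseteq> {a}" "set B \<subseteq> {a}"
proof -
  obtain A B where x: "x = A @ [t] @ B" "t \<notin> set A" using count_list_conv_split[OF assms(2)] by blast
  have "set (p @ x @ q) = {a, t}" using lam_set[OF assms(1)] by (auto simp: wA_def)
  moreover have "t \<notin> mul (p @ x @ q)" using assms(1) neq unfolding lam_iff by (simp add: wA_def mul_def)
  then have "count_list B t = 0" using x by simp
  then have "t \<notin> set B" by (simp add: count_list_0_iff)
  ultimately show ?thesis using that[of A B] x by auto
qed

text \<open>Images that are factors of ata^+ or a^+t are covered by the hypotheses. Any other image
  lies in the class of a^+ta^+ itself, and its t comes from a simple letter z. The numbers of
  occurrences before z, truncated at 2, are fixed by ata^+, the set of letters after z by a^+t;
  together they place the image of \<open>v\<close> in the same class.\<close>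

lemma satisfies_wA_aux:
  assumes F: "satisfies (Mw {wF}) (u, v)" and E: "satisfies (Mw {wE}) (u, v)"
    and x: "p @ subst \<Phi> u @ q \<sim> wA"
  shows "subst \<Phi> u \<sim> subst \<Phi> v"
proof -
  have F': "subst \<Psi> u \<sim> subst \<Psi> v" if "fac {wF} (subst \<Psi> u) \<or> fac {wF} (subst \<Psi> v)" for \<Psi>
    using F that by (subst (asm) satisfies_Mw) auto
  have E': "subst \<Psi> u \<sim> subst \<Psi> v" if "fac {wE} (subst \<Psi> u) \<or> fac {wE} (subst \<Psi> v)" for \<Psi>
    using E that by (subst (asm) satisfies_Mw) auto
  have setx: "set (subst \<Phi> u) \<subseteq> {a, t}" using lam_set[OF x] by (auto simp: wA_def)
  show ?thesis
  proof (cases "t \<in> set (subst \<Phi> u)")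
    case False
    then have "set (subst \<Phi> u) \<subseteq> {a}" using setx by auto
    then show ?thesis using E' fac_wE(1) by blast
  next
    case True
    from lam_wA_D[OF x True] obtain A B where AB: "subst \<Phi> u = A @ [t] @ B" "set A \<subseteq> {a}" "set B \<subseteq> {a}" .
    consider "B = []" | "length A \<le> 1" | "B \<noteq> []" "length A \<ge> 2" by linarith
    then show ?thesis
    proof cases
      case 1
      then show ?thesis using E'[of \<Phi>] fac_wE(2)[OF AB(2)] AB(1) by simp
    next
      case 2
      then show ?thesis using F'[of \<Phi>] fac_wF[OF AB(2) 2 AB(3)] AB(1) by simp
    next
      case 3
      have tcount: "count_list (subst \<Phi> u) t = 1" using AB neq by (auto simp: count_list_0_iff)
      obtain z where z: "z \<in> set u" "t \<in> set (\<Phi> z)" using True by (auto simp: subst_def)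
      obtain u1 u2 where u: "u = u1 @ [z] @ u2" "z \<notin> set u1" using count_list_conv_split[OF z(1)] by blast
      have "count_list (\<Phi> z) t \<noteq> 0" using z(2) by (simp add: count_list_0_iff)
      then have "count_list (subst \<Phi> u1) t = 0" "count_list (subst \<Phi> u2) t = 0" "count_list (\<Phi> z) t = 1"
        using tcount u(1) by auto
      then have nt: "t \<notin> set (subst \<Phi> u1)" "t \<notin> set (subst \<Phi> u2)" by (simp_all add: count_list_0_iff)
      then have z2: "z \<notin> set u2" using z(2) by (auto simp: subst_def)
      obtain K L where KL: "\<Phi> z = K @ [t] @ L" "t \<notin> set K" using count_list_conv_split[OF z(2)] by blast
      then have "t \<notin> set L" using \<open>count_list (\<Phi> z) t = 1\<close> by (simp add: count_list_0_iff)
      have eq: "(subst \<Phi> u1 @ K) @ [t] @ (L @ subst \<Phi> u2) = A @ [t] @ B" using AB(1) u(1) KL(1) by simp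
      have "t \<notin> set A" using AB(2) neq by auto
      have A: "A = subst \<Phi> u1 @ K" "B = L @ subst \<Phi> u2"
        using eq \<open>t \<notin> set A\<close> nt KL(2) append_Cons_eq_iff[of t "subst \<Phi> u1 @ K" "L @ subst \<Phi> u2" A B]
          \<open>t \<notin> set L\<close> by auto
      have "subst (\<lambda>x. if x = z then [a] else []) w = replicate (count_list w z) a" for w
        by (induction w) auto
      note sz = this
      have uz: "count_list u z = 1" using u z2 by (simp add: count_list_0_iff)
      have "fac {wF} ([a, t] @ [a] @ [a])" by (rule fac1I[of "[]" _ "[]"]) (simp add: wF_def)
      then have "fac {wF} [a]" by (rule fac_append)
      \<comment> \<open>Erasing everything but \<open>z\<close> shows that \<open>z\<close> is
        simple in \<open>v\<close> as well.\<close>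
      then have l: "[a] \<sim> replicate (count_list v z) a"
        using F'[of "\<lambda>x. if x = z then [a] else []"] uz by (simp add: sz)
      have "count_list (replicate (count_list v z) a) a = 1" using lam_count1[OF l, of a] by simp
      moreover have "count_list (replicate n a) a = n" for n by (induction n) auto
      ultimately have vz: "count_list v z = 1" by simp
      then obtain v1 v2 where v: "v = v1 @ [z] @ v2" "z \<notin> set v1" "z \<notin> set v2" using split_once by metis
      have su: "subst (\<lambda>x. if x = c then [a] else if x = z then [t] else []) u =
          replicate (count_list u1 c) a @ [t] @ replicate (count_list u2 c) a"
        and sv: "subst (\<lambda>x. if x = c then [a] else if x = z then [t] else []) v =
          replicate (count_list v1 c) a @ [t] @ replicate (count_list v2 c) a" if "c \<noteq> z" for c
        using subst_two[OF that] u v z2 by simp_all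
      have rep: "set (replicate n a) \<subseteq> {a}" for n by auto
      \<comment> \<open>A word with at most one a before t is a factor of ata^+, so numbers 0 and 1
        on either side are preserved exactly.\<close>
      have left: "min 2 (count_list u1 c) = min 2 (count_list v1 c)" for c
      proof (cases "c = z")
        case False
        have "count_list v1 c = count_list u1 c" if "count_list u1 c \<le> 1 \<or> count_list v1 c \<le> 1"
        proof -
          have "fac {wF} (replicate (count_list u1 c) a @ [t] @ replicate (count_list u2 c) a) \<or>
              fac {wF} (replicate (count_list v1 c) a @ [t] @ replicate (count_list v2 c) a)"
            using that fac_wF[OF rep _ rep] by auto
          then have l: "replicate (count_list u1 c) a @ [t] @ replicate (count_list u2 c) a \<sim>
              replicate (count_list v1 c) a @ [t] @ replicate (count_list v2 c) a"
            using F'[of "\<lambda>x. if x = c then [a] else if x = z then [t] else []"] unfolding su[OF False] sv[OF False]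
            by simp
          show ?thesis using that lam_power_left[OF l] lam_power_left[OF lam_sym[OF l]] by auto
        qed
        then show ?thesis by (cases "count_list u1 c \<le> 1 \<or> count_list v1 c \<le> 1") auto
      qed (use u v in simp)
      \<comment> \<open>A word with no a after t is a factor of a^+t, so absence after z is
        preserved in both directions.\<close>
      have right: "c \<in> set u2 \<longleftrightarrow> c \<in> set v2" for c
      proof (cases "c = z")
        case False
        have "count_list u2 c = 0 \<longleftrightarrow> count_list v2 c = 0"
        proof -
          have l: "replicate (count_list u1 c) a @ [t] @ replicate (count_list u2 c) a \<sim>
              replicate (count_list v1 c) a @ [t] @ replicate (count_list v2 c) a"
            if "count_list u2 c = 0 \<or> count_list v2 c = 0"
          proof -
            have "fac {wE} (replicate (count_list u1 c) a @ [t] @ replicate (count_list u2 c) a) \<or>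
                fac {wE} (replicate (count_list v1 c) a @ [t] @ replicate (count_list v2 c) a)"
              using that fac_wE(2)[OF rep] by auto
            then show ?thesis
              using E'[of "\<lambda>x. if x = c then [a] else if x = z then [t] else []"] unfolding su[OF False] sv[OF False]
              by simp
          qed
          show ?thesis
          proof
            assume "count_list u2 c = 0"
            then show "count_list v2 c = 0" using lam_power_right[OF lam_sym] l by fastforce
          next
            assume "count_list v2 c = 0"
            then show "count_list u2 c = 0" using lam_power_right l by fastforce
          qed
        qed
        then show ?thesis by (metis count_list_0_iff)
      qed (use z2 v in simp)
      have "set (subst \<Phi> v1) \<subseteq> {a}"
      proof -
        have "c \<in> set u1" if "c \<in> set v1" for c
        proof -
          have "count_list v1 c \<noteq> 0" using that by (simp add: count_list_0_iff)
          then have "count_list u1 c \<noteq> 0" using left[of c] by auto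
          then show ?thesis by (metis count_list_0_iff)
        qed
        then show ?thesis using A(1) AB(2) by (auto simp: subst_def)
      qed
      moreover have "set (subst \<Phi> v2) \<subseteq> {a}" using right A(2) AB(3) by (auto simp: subst_def)
      moreover have "min 2 (length (subst \<Phi> v1)) = min 2 (length (subst \<Phi> u1))"
        by (rule min_2_length_subst) (simp add: left)
      then have "length (subst \<Phi> v1 @ K) \<ge> 2" using 3(2) A(1) by (auto simp: min_def split: if_splits)
      moreover have "L @ subst \<Phi> v2 \<noteq> []" using 3(1) A(2) right by (auto simp: subst_def)
      ultimately have "(subst \<Phi> v1 @ K) @ [t] @ (L @ subst \<Phi> v2) \<sim> wA"
        using AB(2,3) A by (intro lam_wA) auto
      moreover have "subst \<Phi> v = (subst \<Phi> v1 @ K) @ [t] @ (L @ subst \<Phi> v2)" using v(1) KL(1) by simp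
      moreover have "subst \<Phi> u \<sim> wA" unfolding AB(1) using AB(2,3) 3 by (intro lam_wA)
      ultimately show ?thesis using lam_sym lam_trans by metis
    qed
  qed
qed

lemma satisfies_FE:
  "satisfies (Mw {wF, wE}) (u, v) \<longleftrightarrow> satisfies (Mw {wF}) (u, v) \<and> satisfies (Mw {wE}) (u, v)"
proof -
  have *: "{wF, wE} = {wF} \<union> {wE}" by blast
  show ?thesis unfolding * by (rule satisfies_union) simp_all
qed

lemma satisfies_wA:
  "satisfies (Mw {wA}) (u, v) \<longleftrightarrow> satisfies (Mw {wF, wE}) (u, v)"
proof
  assume A: "satisfies (Mw {wA}) (u, v)"
  have "fac {wA} x" if x: "fac {wF, wE} x" for x
  proof -
    obtain p q where "p @ x @ q \<sim> wF \<or> p @ x @ q \<sim> wE" using x unfolding fac_def by blast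
    then show ?thesis
    proof
      assume "p @ x @ q \<sim> wF"
      from lam_append[OF lam_refl[of "[a]"] this] show ?thesis
        using fac1I[of "[a] @ p" x q] by (simp add: wF_def wA_def)
    next
      assume "p @ x @ q \<sim> wE"
      from lam_append[OF this lam_refl[of "[a, a]"]] show ?thesis
        using fac1I[of p x "q @ [a, a]"] by (simp add: wE_def wA_def)
    qed
  qed
  then show "satisfies (Mw {wF, wE}) (u, v)" by (intro satisfies_mono[OF _ _ _ _ _ A]) auto
next
  assume "satisfies (Mw {wF, wE}) (u, v)"
  then have FE: "satisfies (Mw {wF}) (u, v)" "satisfies (Mw {wE}) (u, v)"
    unfolding satisfies_FE by blast+
  show "satisfies (Mw {wA}) (u, v)"
    by (rule satisfies_factorI)
      (use satisfies_wA_aux[OF FE] satisfies_wA_aux[OF FE[THEN satisfies_sym]] lam_sym in blast)+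
qed

theorem generated_wA: "generated_variety {Mw {wF, wE}} = generated_variety {Mw {wA}}"
proof -
  have m: "monoid (Mw {wF, wE})" "monoid (Mw {wA})" by (rule monoid_Mw; simp)+
  show ?thesis unfolding m[THEN generated_variety_single] satisfies_wA ..
qed

text \<open>Copies of both generating monoids over the universe belong to the two varieties, so the
  identities common to these varieties are exactly those of both generators.\<close>

theorem join_eq:
  assumes inf: "infinite (UNIV :: 'm set)"
  shows "(variety_join var_F (dual_variety var_E) :: 'm monoid set) = generated_variety {Mw {wF, wE}}"
proof -
  let ?K = "var_F \<union> dual_variety var_E :: 'm monoid set"
  have mon: "\<forall>A\<in>?K. monoid A" unfolding var_ids var_def dual_variety_def by blast
  have m: "monoid (Mw {wF, wE})" "monoid (Mw {wF})" "monoid (Mw {wE})" by (rule monoid_Mw; simp)+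
  have c: "countable (carrier (Mw {wF}))" "countable (carrier (Mw {wE}))" by (rule countable_Mw; simp)+
  have "(\<forall>A\<in>?K. satisfies A (u, v)) \<longleftrightarrow> satisfies (Mw {wF, wE}) (u, v)" for u v
    unfolding satisfies_FE
  proof (intro iffI conjI)
    assume K: "\<forall>A\<in>?K. satisfies A (u, v)"
    obtain A :: "'m monoid" where A: "monoid A" "\<And>e. satisfies A e \<longleftrightarrow> satisfies (Mw {wF}) e"
      using countable_copy[OF m(2) c(1) inf] by metis
    have "A \<in> var_F" unfolding var_ids var_def using A sat_ids_F by blast
    then show "satisfies (Mw {wF}) (u, v)" using K A(2) by blast
    obtain B :: "'m monoid" where B: "monoid B" "\<And>e. satisfies B e \<longleftrightarrow> satisfies (Mw {wE}) e"
      using countable_copy[OF m(3) c(2) inf] by metis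
    have "B \<in> dual_variety var_E" unfolding dual_var_E var_def using B sat_ids_dual_E by blast
    then show "satisfies (Mw {wE}) (u, v)" using K B(2) by blast
  next
    assume FE: "satisfies (Mw {wF}) (u, v) \<and> satisfies (Mw {wE}) (u, v)"
    have "satisfies A (u, v)" if A: "A \<in> var_F" for A :: "'m monoid"
    proof (rule generated_variety_satisfies)
      show "A \<in> generated_variety {Mw {wF}}" using A unfolding var_F_eq .
    qed (use FE m(2) in blast)+
    moreover have "satisfies A (u, v)" if "A \<in> dual_variety var_E" for A :: "'m monoid"
    proof -
      have "monoid A" "\<forall>e\<in>ids_dual_E. satisfies A e" using that unfolding dual_var_E var_def by blast+
      then show ?thesis by (rule deriv_sound[OF complete_dual_E[OF conjunct2[OF FE]]])
    qed
    ultimately show "\<forall>A\<in>?K. satisfies A (u, v)" by blast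
  qed
  then show ?thesis
    unfolding variety_join_def generated_variety_eq[OF mon] generated_variety_single[OF m(1)] by simp
qed

lemma juxt_letters:
  "juxt [single a, single t, many a] = cls wF"
  "juxt [many a, single t] = cls wE"
  "juxt [many a, single t, many a] = cls wA"
  "juxt [single a, single b, single t, many a, single s, many b] = cls wH"
  "juxt [single b, many a, single s, many b] = cls wI"
  "juxt [single a, single t, single b, many a, single s, many b] = cls wJ"
  using juxt_cls[of "[[a], [t], [a, a]]"] juxt_cls[of "[[a, a], [t]]"] juxt_cls[of "[[a, a], [t], [a, a]]"]
    juxt_cls[of "[[a], [b], [t], [a, a], [s], [b, b]]"] juxt_cls[of "[[b], [a, a], [s], [b, b]]"]
    juxt_cls[of "[[a], [t], [b], [a, a], [s], [b, b]]"]
  by (simp_all add: single_cls many_cls w_defs wA_def)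

end


theorem theorem7p2:
  fixes a b t s :: letter
  assumes letters: "distinct [a, b, t, s]"
    and universe: "infinite (UNIV :: 'm set)"
  shows "((var_F :: 'm monoid set) =
        generated_variety {M_lam {juxt [single a, single t, many a]}}) \<and>
    (variety_join var_F (dual_variety var_E) =
        (generated_variety {M_lam {juxt [single a, single t, many a], juxt [many a, single t]}}
          :: 'm monoid set)) \<and>
    ((generated_variety {M_lam {juxt [single a, single t, many a], juxt [many a, single t]}}
          :: 'm monoid set) =
        generated_variety {M_lam {juxt [many a, single t, many a]}}) \<and>
    ((var_H :: 'm monoid set) =
        generated_variety {M_lam {juxt [single a, single b, single t, many a, single s, many b]}}) \<and>
    (card (carrier (M_lam {juxt [single b, many a, single s, many b]})) = 19) \<and>
    ((var_I :: 'm monoid set) =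
        generated_variety {M_lam {juxt [single b, many a, single s, many b]}}) \<and>
    (card (carrier (M_lam {juxt [single a, single t, single b, many a, single s, many b]})) = 34) \<and>
    ((var_J :: 'm monoid set) =
        generated_variety {M_lam {juxt [single a, single t, single b, many a, single s, many b]}})"
proof -
  interpret four_letters a b t s by unfold_locales (rule letters)
  note eqs = var_F_eq join_eq[OF universe] generated_wA var_H_eq card_I var_I_eq card_J var_J_eq
  show ?thesis
    unfolding juxt_letters by (intro conjI eqs[unfolded image_insert image_empty])
qed

end
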